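(* Let $H$ be a weak Hopf algebra in $\mathcal C$ with invertible antipode. If $A_H\hookrightarrow A$ is an $H$-cleft extension with cleaving morphism $f$, then $h=\mu_A\circ(f\otimes(f^{-1}\circ\eta_H)):H\to A$ is a total integral. Moreover, if $H$ is cocommutative, then $h$ is convolution invertible.
   Context: Setting. $\mathcal C$ is a strict symmetric monoidal category with tensor product $\otimes$, unit object $K$, symmetry $c$, and with equalizers (hence idempotents split). In tensor products, identities are denoted by their objects ($P\otimes f=id_P\otimes f$). Algebras $(A,\eta_A,\mu_A)$ and coalgebras $(D,\varepsilon_D,\delta_D)$ are (co)associative and (co)unital; $D$ is cocommutative if $c_{D,D}\circ\delta_D=\delta_D$. $\mu_{A\otimes B}=(\mu_A\otimes\mu_B)\circ(A\otimes c_{B,A}\otimes B)$, $\delta_{D\otimes E}=(D\otimes c_{D,E}\otimes E)\circ(\delta_D\otimes\delta_E)$. For a coalgebra $B$, an algebra $A$ and $\alpha,\beta:B\to A$, $\alpha\wedge\beta=\mu_A\circ(\alpha\otimes\beta)\circ\delta_B$. Weak Hopf algebra. An object $H$ with an algebra and a coalgebra structure such that: $\delta_H\circ\mu_H=(\mu_H\otimes\mu_H)\circ\delta_{H\otimes H}$; $\varepsilon_H\circ\mu_H\circ(\mu_H\otimes H)=(\varepsilon_H\otimes\varepsilon_H)\circ(\mu_H\otimes\mu_H)\circ(H\otimes\delta_H\otimes H)=(\varepsilon_H\otimes\varepsilon_H)\circ(\mu_H\otimes\mu_H)\circ(H\otimes(c_{H,H}\circ\delta_H)\otimes H)$; $(\delta_H\otimes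 H)\circ\delta_H\circ\eta_H=(H\otimes\mu_H\otimes H)\circ(\delta_H\otimes\delta_H)\circ(\eta_H\otimes\eta_H)=(H\otimes(\mu_H\circ c_{H,H})\otimes H)\circ(\delta_H\otimes\delta_H)\circ(\eta_H\otimes\eta_H)$; and there is an antipode $\lambda_H:H\to H$ with $id_H\wedge\lambda_H=\Pi_H^L$, $\lambda_H\wedge id_H=\Pi_H^R$, $\lambda_H\wedge id_H\wedge\lambda_H=\lambda_H$, where $\Pi_H^L=((\varepsilon_H\circ\mu_H)\otimes H)\circ(H\otimes c_{H,H})\circ((\delta_H\circ\eta_H)\otimes H)$ and $\Pi_H^R=(H\otimes(\varepsilon_H\circ\mu_H))\circ(c_{H,H}\otimes H)\circ(H\otimes(\delta_H\circ\eta_H))$. Comodule algebras. A right $H$-comodule algebra is an algebra $A$ with a right $H$-comodule structure $\rho_A:A\to A\otimes H$ such that $\rho_A\circ\mu_A=\mu_{A\otimes H}\circ(\rho_A\otimes\rho_A)$ and $(A\otimes\Pi_H^L)\circ\rho_A\circ\eta_A=\rho_A\circ\eta_A$. Its subalgebra of coinvariants $i_A:A_H\to A$ is the equalizer of $\rho_A$ and $(A\otimes\Pi_H^L)\circ\rho_A$. Put $e_A=(A\otimes(\varepsilon_H\circ\mu_H))\circ(c_{H,A}\otimes H)\circ(H\otimes(\rho_A\circ\eta_A)):H\to A$. Cleft extensions. For a right $H$-comodule algebra $(A,\rho_A)$, an integral is a morphism of right $H$-comodules $f:H\to A$ ($H$ with coaction $\delta_H$); it is total if $f\circ\eta_H=\eta_A$.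 It is convolution invertible if there is $f^{-1}:H\to A$ (the necessarily unique convolution inverse) with $f^{-1}\wedge f=e_A$, $f\wedge f^{-1}=(A\otimes(\varepsilon_H\circ\mu_H))\circ((\rho_A\circ\eta_A)\otimes H)$, $f^{-1}\wedge f\wedge f^{-1}=f^{-1}$. $A_H\hookrightarrow A$ is an $H$-cleft extension with cleaving morphism $f$ if $f:H\to A$ is a convolution invertible integral such that $f\wedge f^{-1}$ factorizes through $i_A$. *)

theory Defs
  imports Main
begin

section \<open>Strict symmetric monoidal categories with equalizers\<close>

text \<open>Objects and morphisms form sets inside the types \<open>'o\<close> and \<open>'m\<close>. Composition is
  written in the usual (right to left) order and is only specified on composable pairs. The
  two components of the tensor product have different notations: \<open>\<odot>\<close> on objects and
  \<open>\<otimes>\<close> on morphisms; the identity of \<open>A\<close> is \<open>\<I> A\<close> and is not identified with \<open>A\<close>.\<close>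

record ('o, 'm) smc =
  Obj :: "'o set"
  Arr :: "'m set"
  src :: "'m \<Rightarrow> 'o"
  tgt :: "'m \<Rightarrow> 'o"
  ident :: "'o \<Rightarrow> 'm"  ("\<I>\<index>")
  comp :: "'m \<Rightarrow> 'm \<Rightarrow> 'm"  (infixr "\<cdot>\<index>" 65)
  tensor_obj :: "'o \<Rightarrow> 'o \<Rightarrow> 'o"  (infixr "\<odot>\<index>" 75)
  tensor_arr :: "'m \<Rightarrow> 'm \<Rightarrow> 'm"  (infixr "\<otimes>\<index>" 70)
  unit_obj :: 'o  ("\<K>\<index>")
  symmetry :: "'o \<Rightarrow> 'o \<Rightarrow> 'm"  ("\<c>\<index>")

definition hom :: "('o, 'm, 'x) smc_scheme \<Rightarrow> 'o \<Rightarrow> 'o \<Rightarrow> 'm set"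
  where "hom C A B = {f \<in> Arr C. src C f = A \<and> tgt C f = B}"

definition is_iso :: "('o, 'm, 'x) smc_scheme \<Rightarrow> 'm \<Rightarrow> bool"
  where "is_iso C f \<longleftrightarrow> f \<in> Arr C \<and>
    (\<exists>g \<in> hom C (tgt C f) (src C f). g \<cdot> f = \<I> (src C f) \<and> f \<cdot> g = \<I> (tgt C f))"
  for C (structure)

definition is_equalizer :: "('o, 'm, 'x) smc_scheme \<Rightarrow> 'o \<Rightarrow> 'm \<Rightarrow> 'm \<Rightarrow> 'm \<Rightarrow> bool"
  where "is_equalizer C E e f g \<longleftrightarrow>
    f \<in> Arr C \<and> g \<in> hom C (src C f) (tgt C f) \<and> e \<in> hom C E (src C f) \<and> f \<cdot> e = g \<cdot> e \<and>
    (\<forall>X \<in> Obj C. \<forall>x \<in> hom C X (src C f). f \<cdot> x = g \<cdot> x \<longrightarrow> (\<exists>!u. u \<in> hom C X E \<and> e \<cdot> u = x))"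
  for C (structure)

locale category =
  fixes C :: "('o, 'm, 'x) smc_scheme" (structure)
  assumes src_closed: "f \<in> Arr C \<Longrightarrow> src C f \<in> Obj C"
    and tgt_closed: "f \<in> Arr C \<Longrightarrow> tgt C f \<in> Obj C"
    and ident_closed: "A \<in> Obj C \<Longrightarrow> \<I> A \<in> hom C A A"
    and comp_closed: "\<lbrakk>f \<in> hom C X Y; g \<in> hom C Y Z\<rbrakk> \<Longrightarrow> g \<cdot> f \<in> hom C X Z"
    and ident_left: "f \<in> hom C X Y \<Longrightarrow> \<I> Y \<cdot> f = f"
    and ident_right: "f \<in> hom C X Y \<Longrightarrow> f \<cdot> \<I> X = f"
    and comp_assoc: "\<lbrakk>f \<in> hom C W X; g \<in> hom C X Y; h \<in> hom C Y Z\<rbrakk> \<Longrightarrow>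
      (h \<cdot> g) \<cdot> f = h \<cdot> (g \<cdot> f)"

locale strict_monoidal_category = category +
  assumes unit_obj_closed: "\<K> \<in> Obj C"
    and tensor_obj_closed: "\<lbrakk>X \<in> Obj C; Y \<in> Obj C\<rbrakk> \<Longrightarrow> X \<odot> Y \<in> Obj C"
    and tensor_obj_assoc: "\<lbrakk>X \<in> Obj C; Y \<in> Obj C; Z \<in> Obj C\<rbrakk> \<Longrightarrow>
      (X \<odot> Y) \<odot> Z = X \<odot> (Y \<odot> Z)"
    and tensor_obj_unit_left: "X \<in> Obj C \<Longrightarrow> \<K> \<odot> X = X"
    and tensor_obj_unit_right: "X \<in> Obj C \<Longrightarrow> X \<odot> \<K> = X"
    and tensor_arr_closed: "\<lbrakk>f \<in> hom C X Y; g \<in> hom C X' Y'\<rbrakk> \<Longrightarrow>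
      f \<otimes> g \<in> hom C (X \<odot> X') (Y \<odot> Y')"
    and tensor_ident: "\<lbrakk>X \<in> Obj C; Y \<in> Obj C\<rbrakk> \<Longrightarrow> \<I> X \<otimes> \<I> Y = \<I> (X \<odot> Y)"
    and tensor_comp: "\<lbrakk>f \<in> hom C X Y; g \<in> hom C Y Z; f' \<in> hom C X' Y'; g' \<in> hom C Y' Z'\<rbrakk> \<Longrightarrow>
      (g \<cdot> f) \<otimes> (g' \<cdot> f') = (g \<otimes> g') \<cdot> (f \<otimes> f')"
    and tensor_arr_assoc: "\<lbrakk>f \<in> Arr C; g \<in> Arr C; h \<in> Arr C\<rbrakk> \<Longrightarrow>
      (f \<otimes> g) \<otimes> h = f \<otimes> (g \<otimes> h)"
    and tensor_arr_unit_left: "f \<in> Arr C \<Longrightarrow> \<I> \<K> \<otimes> f = f"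
    and tensor_arr_unit_right: "f \<in> Arr C \<Longrightarrow> f \<otimes> \<I> \<K> = f"

locale strict_symmetric_monoidal_category = strict_monoidal_category +
  assumes symmetry_closed: "\<lbrakk>X \<in> Obj C; Y \<in> Obj C\<rbrakk> \<Longrightarrow> \<c> X Y \<in> hom C (X \<odot> Y) (Y \<odot> X)"
    and symmetry_natural: "\<lbrakk>f \<in> hom C X Y; g \<in> hom C X' Y'\<rbrakk> \<Longrightarrow>
      \<c> Y Y' \<cdot> (f \<otimes> g) = (g \<otimes> f) \<cdot> \<c> X X'"
    and symmetry_inverse: "\<lbrakk>X \<in> Obj C; Y \<in> Obj C\<rbrakk> \<Longrightarrow> \<c> Y X \<cdot> \<c> X Y = \<I> (X \<odot> Y)"
    and symmetry_hexagon: "\<lbrakk>X \<in> Obj C; Y \<in> Obj C; Z \<in> Obj C\<rbrakk> \<Longrightarrow>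
      \<c> X (Y \<odot> Z) = (\<I> Y \<otimes> \<c> X Z) \<cdot> (\<c> X Y \<otimes> \<I> Z)"

locale strict_symmetric_monoidal_category_with_equalizers = strict_symmetric_monoidal_category +
  assumes has_equalizers: "\<lbrakk>f \<in> hom C X Y; g \<in> hom C X Y\<rbrakk> \<Longrightarrow> \<exists>E e. is_equalizer C E e f g"


section \<open>Algebras and coalgebras\<close>

record ('o, 'm) algebra =
  obj :: 'o
  unit :: 'm  ("\<eta>\<index>")
  mult :: 'm  ("\<mu>\<index>")

definition is_algebra :: "('o, 'm, 'x) smc_scheme \<Rightarrow> ('o, 'm, 'y) algebra_scheme \<Rightarrow> bool"
  where "is_algebra C A \<longleftrightarrow>
    obj A \<in> Obj C \<and> \<eta>\<^bsub>A\<^esub> \<in> hom C \<K> (obj A) \<and> \<mu>\<^bsub>A\<^esub> \<in> hom C (obj A \<odot> obj A) (obj A) \<and>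
    \<mu>\<^bsub>A\<^esub> \<cdot> (\<mu>\<^bsub>A\<^esub> \<otimes> \<I> (obj A)) = \<mu>\<^bsub>A\<^esub> \<cdot> (\<I> (obj A) \<otimes> \<mu>\<^bsub>A\<^esub>) \<and>
    \<mu>\<^bsub>A\<^esub> \<cdot> (\<eta>\<^bsub>A\<^esub> \<otimes> \<I> (obj A)) = \<I> (obj A) \<and>
    \<mu>\<^bsub>A\<^esub> \<cdot> (\<I> (obj A) \<otimes> \<eta>\<^bsub>A\<^esub>) = \<I> (obj A)"
  for C (structure)

definition is_coalgebra :: "('o, 'm, 'x) smc_scheme \<Rightarrow> 'o \<Rightarrow> 'm \<Rightarrow> 'm \<Rightarrow> bool"
  where "is_coalgebra C D eps del \<longleftrightarrow>
    D \<in> Obj C \<and> eps \<in> hom C D \<K> \<and> del \<in> hom C D (D \<odot> D) \<and>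
    (del \<otimes> \<I> D) \<cdot> del = (\<I> D \<otimes> del) \<cdot> del \<and>
    (eps \<otimes> \<I> D) \<cdot> del = \<I> D \<and>
    (\<I> D \<otimes> eps) \<cdot> del = \<I> D"
  for C (structure)

definition is_cocommutative :: "('o, 'm, 'x) smc_scheme \<Rightarrow> 'o \<Rightarrow> 'm \<Rightarrow> bool"
  where "is_cocommutative C D del \<longleftrightarrow> \<c> D D \<cdot> del = del"
  for C (structure)

definition tensor_mult ::
    "('o, 'm, 'x) smc_scheme \<Rightarrow> ('o, 'm, 'y) algebra_scheme \<Rightarrow> ('o, 'm, 'z) algebra_scheme \<Rightarrow> 'm"
  where "tensor_mult C A B = (\<mu>\<^bsub>A\<^esub> \<otimes> \<mu>\<^bsub>B\<^esub>) \<cdot> (\<I> (obj A) \<otimes> \<c> (obj B) (obj A) \<otimes> \<I> (obj B))"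
  for C (structure)

definition tensor_comult :: "('o, 'm, 'x) smc_scheme \<Rightarrow> 'o \<Rightarrow> 'm \<Rightarrow> 'o \<Rightarrow> 'm \<Rightarrow> 'm"
  where "tensor_comult C D delD E delE = (\<I> D \<otimes> \<c> D E \<otimes> \<I> E) \<cdot> (delD \<otimes> delE)"
  for C (structure)

text \<open>\<open>convolution C del A a b\<close> is \<open>a \<and> b\<close> for morphisms from a coalgebra with comultiplication
  \<open>del\<close> to the algebra \<open>A\<close>.\<close>

definition convolution ::
    "('o, 'm, 'x) smc_scheme \<Rightarrow> 'm \<Rightarrow> ('o, 'm, 'y) algebra_scheme \<Rightarrow> 'm \<Rightarrow> 'm \<Rightarrow> 'm"
  where "convolution C del A a b = \<mu>\<^bsub>A\<^esub> \<cdot> (a \<otimes> b) \<cdot> del"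
  for C (structure)


section \<open>Weak Hopf algebras\<close>

record ('o, 'm) weak_hopf = "('o, 'm) algebra" +
  counit :: 'm  ("\<epsilon>\<index>")
  comult :: 'm  ("\<delta>\<index>")
  antipode :: 'm

definition Pi_L :: "('o, 'm, 'x) smc_scheme \<Rightarrow> ('o, 'm, 'y) weak_hopf_scheme \<Rightarrow> 'm"
  where "Pi_L C H =
    ((\<epsilon>\<^bsub>H\<^esub> \<cdot> \<mu>\<^bsub>H\<^esub>) \<otimes> \<I> (obj H)) \<cdot> (\<I> (obj H) \<otimes> \<c> (obj H) (obj H)) \<cdot>
    ((\<delta>\<^bsub>H\<^esub> \<cdot> \<eta>\<^bsub>H\<^esub>) \<otimes> \<I> (obj H))"
  for C (structure)

definition Pi_R :: "('o, 'm, 'x) smc_scheme \<Rightarrow> ('o, 'm, 'y) weak_hopf_scheme \<Rightarrow> 'm"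
  where "Pi_R C H =
    (\<I> (obj H) \<otimes> (\<epsilon>\<^bsub>H\<^esub> \<cdot> \<mu>\<^bsub>H\<^esub>)) \<cdot> (\<c> (obj H) (obj H) \<otimes> \<I> (obj H)) \<cdot>
    (\<I> (obj H) \<otimes> (\<delta>\<^bsub>H\<^esub> \<cdot> \<eta>\<^bsub>H\<^esub>))"
  for C (structure)

locale weak_hopf_algebra =
  fixes C :: "('o, 'm, 'x) smc_scheme" (structure)
    and H :: "('o, 'm, 'y) weak_hopf_scheme"
  assumes algebra: "is_algebra C H"
    and coalgebra: "is_coalgebra C (obj H) \<epsilon>\<^bsub>H\<^esub> \<delta>\<^bsub>H\<^esub>"
    and comult_mult:
      "\<delta>\<^bsub>H\<^esub> \<cdot> \<mu>\<^bsub>H\<^esub> = (\<mu>\<^bsub>H\<^esub> \<otimes> \<mu>\<^bsub>H\<^esub>) \<cdot> tensor_comult C (obj H) \<delta>\<^bsub>H\<^esub> (obj H) \<delta>\<^bsub>H\<^esub>"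
    and counit_mult_1:
      "\<epsilon>\<^bsub>H\<^esub> \<cdot> \<mu>\<^bsub>H\<^esub> \<cdot> (\<mu>\<^bsub>H\<^esub> \<otimes> \<I> (obj H)) =
       (\<epsilon>\<^bsub>H\<^esub> \<otimes> \<epsilon>\<^bsub>H\<^esub>) \<cdot> (\<mu>\<^bsub>H\<^esub> \<otimes> \<mu>\<^bsub>H\<^esub>) \<cdot> (\<I> (obj H) \<otimes> \<delta>\<^bsub>H\<^esub> \<otimes> \<I> (obj H))"
    and counit_mult_2:
      "\<epsilon>\<^bsub>H\<^esub> \<cdot> \<mu>\<^bsub>H\<^esub> \<cdot> (\<mu>\<^bsub>H\<^esub> \<otimes> \<I> (obj H)) =
       (\<epsilon>\<^bsub>H\<^esub> \<otimes> \<epsilon>\<^bsub>H\<^esub>) \<cdot> (\<mu>\<^bsub>H\<^esub> \<otimes> \<mu>\<^bsub>H\<^esub>) \<cdot>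
       (\<I> (obj H) \<otimes> (\<c> (obj H) (obj H) \<cdot> \<delta>\<^bsub>H\<^esub>) \<otimes> \<I> (obj H))"
    and comult_unit_1:
      "(\<delta>\<^bsub>H\<^esub> \<otimes> \<I> (obj H)) \<cdot> \<delta>\<^bsub>H\<^esub> \<cdot> \<eta>\<^bsub>H\<^esub> =
       (\<I> (obj H) \<otimes> \<mu>\<^bsub>H\<^esub> \<otimes> \<I> (obj H)) \<cdot> (\<delta>\<^bsub>H\<^esub> \<otimes> \<delta>\<^bsub>H\<^esub>) \<cdot> (\<eta>\<^bsub>H\<^esub> \<otimes> \<eta>\<^bsub>H\<^esub>)"
    and comult_unit_2:
      "(\<delta>\<^bsub>H\<^esub> \<otimes> \<I> (obj H)) \<cdot> \<delta>\<^bsub>H\<^esub> \<cdot> \<eta>\<^bsub>H\<^esub> =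
       (\<I> (obj H) \<otimes> (\<mu>\<^bsub>H\<^esub> \<cdot> \<c> (obj H) (obj H)) \<otimes> \<I> (obj H)) \<cdot>
       (\<delta>\<^bsub>H\<^esub> \<otimes> \<delta>\<^bsub>H\<^esub>) \<cdot> (\<eta>\<^bsub>H\<^esub> \<otimes> \<eta>\<^bsub>H\<^esub>)"
    and antipode_closed: "antipode H \<in> hom C (obj H) (obj H)"
    and antipode_right: "convolution C \<delta>\<^bsub>H\<^esub> H (\<I> (obj H)) (antipode H) = Pi_L C H"
    and antipode_left: "convolution C \<delta>\<^bsub>H\<^esub> H (antipode H) (\<I> (obj H)) = Pi_R C H"
    and antipode_regular:
      "convolution C \<delta>\<^bsub>H\<^esub> H (convolution C \<delta>\<^bsub>H\<^esub> H (antipode H) (\<I> (obj H))) (antipode H) =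
       antipode H"


section \<open>Comodule algebras, integrals and cleft extensions\<close>

record ('o, 'm) comodule_algebra = "('o, 'm) algebra" +
  coact :: 'm  ("\<rho>\<index>")

locale right_comodule_algebra =
  fixes C :: "('o, 'm, 'x) smc_scheme" (structure)
    and H :: "('o, 'm, 'y) weak_hopf_scheme"
    and A :: "('o, 'm, 'z) comodule_algebra_scheme"
  assumes algebra: "is_algebra C A"
    and coact_closed: "\<rho>\<^bsub>A\<^esub> \<in> hom C (obj A) (obj A \<odot> obj H)"
    and coact_counit: "(\<I> (obj A) \<otimes> \<epsilon>\<^bsub>H\<^esub>) \<cdot> \<rho>\<^bsub>A\<^esub> = \<I> (obj A)"
    and coact_coassoc: "(\<rho>\<^bsub>A\<^esub> \<otimes> \<I> (obj H)) \<cdot> \<rho>\<^bsub>A\<^esub> = (\<I> (obj A) \<otimes> \<delta>\<^bsub>H\<^esub>) \<cdot> \<rho>\<^bsub>A\<^esub>"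
    and coact_mult: "\<rho>\<^bsub>A\<^esub> \<cdot> \<mu>\<^bsub>A\<^esub> = tensor_mult C A H \<cdot> (\<rho>\<^bsub>A\<^esub> \<otimes> \<rho>\<^bsub>A\<^esub>)"
    and coact_unit: "(\<I> (obj A) \<otimes> Pi_L C H) \<cdot> \<rho>\<^bsub>A\<^esub> \<cdot> \<eta>\<^bsub>A\<^esub> = \<rho>\<^bsub>A\<^esub> \<cdot> \<eta>\<^bsub>A\<^esub>"

definition is_coinvariants ::
    "('o, 'm, 'x) smc_scheme \<Rightarrow> ('o, 'm, 'y) weak_hopf_scheme \<Rightarrow>
     ('o, 'm, 'z) comodule_algebra_scheme \<Rightarrow> 'o \<Rightarrow> 'm \<Rightarrow> bool"
  where "is_coinvariants C H A AH i \<longleftrightarrow>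
    is_equalizer C AH i \<rho>\<^bsub>A\<^esub> ((\<I> (obj A) \<otimes> Pi_L C H) \<cdot> \<rho>\<^bsub>A\<^esub>)"
  for C (structure)

definition e_map ::
    "('o, 'm, 'x) smc_scheme \<Rightarrow> ('o, 'm, 'y) weak_hopf_scheme \<Rightarrow>
     ('o, 'm, 'z) comodule_algebra_scheme \<Rightarrow> 'm"
  where "e_map C H A =
    (\<I> (obj A) \<otimes> (\<epsilon>\<^bsub>H\<^esub> \<cdot> \<mu>\<^bsub>H\<^esub>)) \<cdot> (\<c> (obj H) (obj A) \<otimes> \<I> (obj H)) \<cdot>
    (\<I> (obj H) \<otimes> (\<rho>\<^bsub>A\<^esub> \<cdot> \<eta>\<^bsub>A\<^esub>))"
  for C (structure)

definition is_integral ::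
    "('o, 'm, 'x) smc_scheme \<Rightarrow> ('o, 'm, 'y) weak_hopf_scheme \<Rightarrow>
     ('o, 'm, 'z) comodule_algebra_scheme \<Rightarrow> 'm \<Rightarrow> bool"
  where "is_integral C H A f \<longleftrightarrow>
    f \<in> hom C (obj H) (obj A) \<and> \<rho>\<^bsub>A\<^esub> \<cdot> f = (f \<otimes> \<I> (obj H)) \<cdot> \<delta>\<^bsub>H\<^esub>"
  for C (structure)

definition is_total_integral ::
    "('o, 'm, 'x) smc_scheme \<Rightarrow> ('o, 'm, 'y) weak_hopf_scheme \<Rightarrow>
     ('o, 'm, 'z) comodule_algebra_scheme \<Rightarrow> 'm \<Rightarrow> bool"
  where "is_total_integral C H A f \<longleftrightarrow> is_integral C H A f \<and> f \<cdot> \<eta>\<^bsub>H\<^esub> = \<eta>\<^bsub>A\<^esub>"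
  for C (structure)

text \<open>\<open>is_convolution_inverse C H A f g\<close> says that \<open>g\<close> is the convolution inverse of \<open>f\<close>; the
  three equations determine \<open>g\<close> uniquely.\<close>

definition is_convolution_inverse ::
    "('o, 'm, 'x) smc_scheme \<Rightarrow> ('o, 'm, 'y) weak_hopf_scheme \<Rightarrow>
     ('o, 'm, 'z) comodule_algebra_scheme \<Rightarrow> 'm \<Rightarrow> 'm \<Rightarrow> bool"
  where "is_convolution_inverse C H A f g \<longleftrightarrow>
    g \<in> hom C (obj H) (obj A) \<and>
    convolution C \<delta>\<^bsub>H\<^esub> A g f = e_map C H A \<and>
    convolution C \<delta>\<^bsub>H\<^esub> A f g =
      (\<I> (obj A) \<otimes> (\<epsilon>\<^bsub>H\<^esub> \<cdot> \<mu>\<^bsub>H\<^esub>)) \<cdot> ((\<rho>\<^bsub>A\<^esub> \<cdot> \<eta>\<^bsub>A\<^esub>) \<otimes> \<I> (obj H)) \<and>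
    convolution C \<delta>\<^bsub>H\<^esub> A (convolution C \<delta>\<^bsub>H\<^esub> A g f) g = g"
  for C (structure)

definition is_convolution_invertible ::
    "('o, 'm, 'x) smc_scheme \<Rightarrow> ('o, 'm, 'y) weak_hopf_scheme \<Rightarrow>
     ('o, 'm, 'z) comodule_algebra_scheme \<Rightarrow> 'm \<Rightarrow> bool"
  where "is_convolution_invertible C H A f \<longleftrightarrow> (\<exists>g. is_convolution_inverse C H A f g)"

definition is_cleft_extension ::
    "('o, 'm, 'x) smc_scheme \<Rightarrow> ('o, 'm, 'y) weak_hopf_scheme \<Rightarrow>
     ('o, 'm, 'z) comodule_algebra_scheme \<Rightarrow> 'o \<Rightarrow> 'm \<Rightarrow> 'm \<Rightarrow> bool"
  where "is_cleft_extension C H A AH i f \<longleftrightarrow>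
    is_coinvariants C H A AH i \<and> is_integral C H A f \<and>
    (\<exists>g. is_convolution_inverse C H A f g \<and>
      (\<exists>u \<in> hom C (obj H) AH. i \<cdot> u = convolution C \<delta>\<^bsub>H\<^esub> A f g))"
  for C (structure)

end

theory Submission
  imports Defs "HOL-Combinatorics.Transposition"
begin

text \<open>Sweedler notation is used throughout: \<open>\<delta>(x) = x\<^sub>1 \<otimes> x\<^sub>2\<close>, \<open>\<rho>(a) = a\<^sub>0 \<otimes> a\<^sub>1\<close>, two copies of \<open>\<delta>(1)\<close> in one formula
are told apart as \<open>1\<^sub>1 \<otimes> 1\<^sub>2\<close> and \<open>1'\<^sub>1 \<otimes> 1'\<^sub>2\<close>, and \<open>u\<^sub>0 \<otimes> u\<^sub>1\<close> stands for \<open>\<rho>(1)\<close>, the coaction on the unit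
of \<open>A\<close>. Let \<open>g\<close> be the convolution inverse of \<open>f\<close>, let \<open>K = f \<and> g\<close>, so that \<open>K(x) = u\<^sub>0 \<epsilon>(u\<^sub>1 x)\<close>,
and let \<open>E = e\<^sub>A\<close>, so that \<open>E(x) = u\<^sub>0 \<epsilon>(x u\<^sub>1)\<close>. The theorem is about \<open>t(x) = f(x) g(1)\<close>.

The coaction on \<open>g\<close> is \<open>\<rho>(g(x)) = g(x\<^sub>2) \<otimes> \<lambda>(x\<^sub>1)\<close> (lemma \<open>rho_g\<close>). Indeed \<open>\<rho> \<circ> g\<close> and
\<open>x \<mapsto> g(x\<^sub>2) \<otimes> \<lambda>(x\<^sub>1)\<close> are two candidates for a convolution inverse of
\<open>\<rho> \<circ> f = (f \<otimes> H) \<circ> \<delta>\<close>, and coinvariance of \<open>K\<close> says that \<open>\<rho> \<circ> f\<close>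
has the same product with both (lemma \<open>rho_K\<close>); the usual uniqueness argument for inverses then
identifies them, up to the care that is needed because the products are only \<open>\<rho> \<circ> E\<close> and \<open>\<rho> \<circ> K\<close>
instead of the unit.

Every \<open>a\<close> satisfies \<open>a\<^sub>0 \<otimes> \<Pi>\<^sup>L(a\<^sub>1) = u\<^sub>0 a \<otimes> u\<^sub>1\<close> (lemma \<open>rho_PL\<close>), so \<open>a\<close> is coinvariant
precisely when \<open>\<rho>(a) = \<rho>(1) (a \<otimes> 1)\<close>. The antipode sends the left leg of \<open>\<delta>(1)\<close> into the image of
\<open>\<Pi>\<^sup>L\<close>, hence \<open>g(1)\<close> is coinvariant (lemma \<open>rho_g_unit\<close>) and
\<open>\<rho>(f(x) g(1)) = \<rho>(f(x)) \<rho>(1) (g(1) \<otimes> 1) = f(x\<^sub>1) g(1) \<otimes> x\<^sub>2\<close>: \<open>t\<close> is an integral.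

It is total because \<open>g = E \<and> g\<close> gives \<open>g(1) = E(1\<^sub>1) g(1\<^sub>2)\<close>, where \<open>E\<close> may be replaced by \<open>K\<close>
since \<open>u\<^sub>1\<close> commutes with the left leg of \<open>\<delta>(1)\<close>; and \<open>a K(y) = a\<^sub>0 \<epsilon>(a\<^sub>1 y)\<close>, so that
\<open>f(1) g(1) = f(1) K(1\<^sub>1) g(1\<^sub>2) = f(1\<^sub>1) g(1\<^sub>2) = K(1) = 1\<close> (lemma \<open>t_unit\<close>).

If \<open>H\<close> is cocommutative, then \<open>f(1)\<close> and \<open>g(1)\<close> are inverse to each other, because \<open>g(1) f(1) = 1\<close>
holds as well (lemma \<open>g_f_unit\<close>). The convolution inverse of \<open>t\<close> is \<open>k(x) = f(1) g(x)\<close>: clearly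
\<open>t \<and> k = f \<and> g\<close>, and \<open>k \<and> t\<close> sends \<open>x\<close> to \<open>f(1) E(x) g(1) = E(x)\<close>, as \<open>f(1)\<close> is coinvariant and
therefore commutes with the values of \<open>E\<close> (lemma \<open>f_unit_E\<close>).

In a symmetric monoidal category there are no elements \<open>x\<close>, so these computations are carried out
with string diagrams. A diagram is given as a program: a list of instructions, each of which
consumes some named wires and creates others. By coherence (lemma \<open>sigma_comp\<close>) a program denotes
a morphism that depends neither on the order in which the wires are listed nor on the order of
independent instructions. The theorem \<open>eqv_rewrite\<close> replaces a part of a program by an equivalent
part and reduces the correctness of the replacement to a combinatorial condition on concrete
lists, which the simplifier decides. Each equation in Sweedler notation thus becomes a chain of
programs in which every step applies one rule.\<close>

section \<open>Programs over named wires\<close>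

text \<open>A wire carries its object, so that the type of a context can be read off from its wires, and a
number, which makes it distinguishable from other wires of the same object.\<close>

type_synonym 'o wire = "'o \<times> nat"

text \<open>\<open>Wire x y\<close> is an identity morphism that only renames a wire. It is the right-hand side of the
rules that remove a unit or a counit: there the input and the output wire of the diagram become
one, but the rule has to keep both of their names.\<close>

datatype ('o, 'm) instr =
    Op 'm "'o wire list" "'o wire list"
  | Wire "'o wire" "'o wire"

fun ins :: "('o, 'm) instr \<Rightarrow> 'o wire list" where
  "ins (Op m xs ys) = xs" | "ins (Wire x y) = [x]"

fun outs :: "('o, 'm) instr \<Rightarrow> 'o wire list" where
  "outs (Op m xs ys) = ys" | "outs (Wire x y) = [y]"

definition wires :: "('o, 'm) instr list \<Rightarrow> 'o wire set" where
  "wires P = (\<Union>i\<in>set P. set (ins i) \<union> set (outs i))"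

definition without :: "'o wire list \<Rightarrow> 'o wire list \<Rightarrow> 'o wire list" where
  "without \<Gamma> xs = filter (\<lambda>w. w \<notin> set xs) \<Gamma>"

definition step :: "'o wire list \<Rightarrow> ('o, 'm) instr \<Rightarrow> 'o wire list" where
  "step \<Gamma> i = outs i @ without \<Gamma> (ins i)"

fun final :: "'o wire list \<Rightarrow> ('o, 'm) instr list \<Rightarrow> 'o wire list" where
  "final \<Gamma> [] = \<Gamma>" | "final \<Gamma> (i # P) = final (step \<Gamma> i) P"

fun rename_instr :: "('o wire \<Rightarrow> 'o wire) \<Rightarrow> ('o, 'm) instr \<Rightarrow> ('o, 'm) instr" where
  "rename_instr r (Op m xs ys) = Op m (map r xs) (map r ys)"
| "rename_instr r (Wire x y) = Wire (r x) (r y)"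

lemma wires_simps [simp]:
  "wires [] = {}" "wires (i # P) = set (ins i) \<union> set (outs i) \<union> wires P"
  "wires (P @ Q) = wires P \<union> wires Q"
  by (auto simp: wires_def)

lemma set_without [simp]: "set (without \<Gamma> xs) = set \<Gamma> - set xs"
  by (auto simp: without_def)

lemma distinct_without: "distinct \<Gamma> \<Longrightarrow> distinct (without \<Gamma> xs)"
  by (simp add: without_def)

lemma ins_rename_instr [simp]: "ins (rename_instr r i) = map r (ins i)"
  and outs_rename_instr [simp]: "outs (rename_instr r i) = map r (outs i)"
  by (cases i; simp)+

lemma without_map:
  "inj_on r (set \<Gamma> \<union> set xs) \<Longrightarrow> without (map r \<Gamma>) (map r xs) = map r (without \<Gamma> xs)"
proof (induction \<Gamma>)
  case (Cons x \<Gamma>)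
  have "inj_on r (set \<Gamma> \<union> set xs)" using Cons.prems by (rule inj_on_subset) auto
  moreover have "r x \<in> r ` set xs \<longleftrightarrow> x \<in> set xs"
    using Cons.prems by (auto simp: inj_on_def)
  ultimately show ?case using Cons.IH by (simp add: without_def)
qed (simp add: without_def)

section \<open>Calculus of strict symmetric monoidal categories\<close>

context strict_symmetric_monoidal_category
begin

lemma arr_hom: "f \<in> Arr C \<Longrightarrow> f \<in> hom C (src C f) (tgt C f)"
  by (simp add: hom_def)

lemma obj_simps [simp]:
  "\<K> \<in> Obj C"
  "X \<in> Obj C \<Longrightarrow> Y \<in> Obj C \<Longrightarrow> X \<odot> Y \<in> Obj C"
  "X \<in> Obj C \<Longrightarrow> Y \<in> Obj C \<Longrightarrow> Z \<in> Obj C \<Longrightarrow> (X \<odot> Y) \<odot> Z = X \<odot> (Y \<odot> Z)"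
  "X \<in> Obj C \<Longrightarrow> \<K> \<odot> X = X"
  "X \<in> Obj C \<Longrightarrow> X \<odot> \<K> = X"
  "f \<in> Arr C \<Longrightarrow> src C f \<in> Obj C"
  "f \<in> Arr C \<Longrightarrow> tgt C f \<in> Obj C"
  by (simp_all add: unit_obj_closed tensor_obj_closed tensor_obj_assoc tensor_obj_unit_left
      tensor_obj_unit_right src_closed tgt_closed)

lemma ident_simps [simp]:
  "X \<in> Obj C \<Longrightarrow> \<I> X \<in> Arr C" "X \<in> Obj C \<Longrightarrow> src C (\<I> X) = X"
  "X \<in> Obj C \<Longrightarrow> tgt C (\<I> X) = X"
  using ident_closed by (auto simp: hom_def)

lemma comp_simps [simp]:
  assumes "f \<in> Arr C" "g \<in> Arr C" "tgt C f = src C g"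
  shows "g \<cdot> f \<in> Arr C" "src C (g \<cdot> f) = src C f" "tgt C (g \<cdot> f) = tgt C g"
  using comp_closed[of f "src C f" "tgt C f" g "tgt C g"] assms by (auto simp: hom_def)

lemma tensor_simps [simp]:
  assumes "f \<in> Arr C" "g \<in> Arr C"
  shows "f \<otimes> g \<in> Arr C" "src C (f \<otimes> g) = src C f \<odot> src C g"
    "tgt C (f \<otimes> g) = tgt C f \<odot> tgt C g"
  using tensor_arr_closed[OF arr_hom arr_hom, OF assms] by (auto simp: hom_def)

lemma symmetry_simps [simp]:
  assumes "X \<in> Obj C" "Y \<in> Obj C"
  shows "\<c> X Y \<in> Arr C" "src C (\<c> X Y) = X \<odot> Y" "tgt C (\<c> X Y) = Y \<odot> X"
  using symmetry_closed[OF assms] by (auto simp: hom_def)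

lemma comp_ident [simp]:
  "f \<in> Arr C \<Longrightarrow> tgt C f = Y \<Longrightarrow> \<I> Y \<cdot> f = f"
  "f \<in> Arr C \<Longrightarrow> src C f = Y \<Longrightarrow> f \<cdot> \<I> Y = f"
  using ident_left ident_right arr_hom by blast+

lemma comp_assoc' [simp]:
  assumes "f \<in> Arr C" "g \<in> Arr C" "h \<in> Arr C" "tgt C f = src C g" "tgt C g = src C h"
  shows "(h \<cdot> g) \<cdot> f = h \<cdot> g \<cdot> f"
  by (rule comp_assoc[OF arr_hom]) (use assms in \<open>auto simp: hom_def\<close>)

lemma tensor_arr_simps [simp]:
  "f \<in> Arr C \<Longrightarrow> g \<in> Arr C \<Longrightarrow> h \<in> Arr C \<Longrightarrow> (f \<otimes> g) \<otimes> h = f \<otimes> g \<otimes> h"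
  "f \<in> Arr C \<Longrightarrow> \<I> \<K> \<otimes> f = f" "f \<in> Arr C \<Longrightarrow> f \<otimes> \<I> \<K> = f"
  "X \<in> Obj C \<Longrightarrow> Y \<in> Obj C \<Longrightarrow> \<I> X \<otimes> \<I> Y = \<I> (X \<odot> Y)"
  by (simp_all add: tensor_arr_assoc tensor_arr_unit_left tensor_arr_unit_right tensor_ident)

lemma interchange:
  assumes "f \<in> Arr C" "g \<in> Arr C" "f' \<in> Arr C" "g' \<in> Arr C" "tgt C f = src C g" "tgt C f' = src C g'"
  shows "(g \<otimes> g') \<cdot> (f \<otimes> f') = (g \<cdot> f) \<otimes> (g' \<cdot> f')"
  using tensor_comp[of f "src C f" "tgt C f" g "tgt C g" f' "src C f'" "tgt C f'" g' "tgt C g'"] assms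
  by (simp add: hom_def)

lemma interchange_comp:
  assumes "f \<in> Arr C" "g \<in> Arr C" "f' \<in> Arr C" "g' \<in> Arr C" "tgt C f = src C g" "tgt C f' = src C g'"
    "k \<in> Arr C" "tgt C k = src C f \<odot> src C f'"
  shows "(g \<otimes> g') \<cdot> (f \<otimes> f') \<cdot> k = ((g \<cdot> f) \<otimes> (g' \<cdot> f')) \<cdot> k"
  using assms by (simp flip: interchange add: comp_assoc')

lemma naturality:
  assumes "f \<in> Arr C" "g \<in> Arr C" "tgt C f = Y" "tgt C g = Y'"
  shows "\<c> Y Y' \<cdot> (f \<otimes> g) = (g \<otimes> f) \<cdot> \<c> (src C f) (src C g)"
  using symmetry_natural[of f "src C f" "tgt C f" g "src C g" "tgt C g"] assms
  by (simp add: hom_def)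

text \<open>The hexagon for \<open>Y = Z = K\<close> makes \<open>c\<^bsub>X,K\<^esub>\<close> idempotent, and it is invertible.\<close>

lemma symmetry_unit [simp]:
  assumes "X \<in> Obj C"
  shows "\<c> X \<K> = \<I> X" "\<c> \<K> X = \<I> X"
proof -
  have eq: "\<c> X \<K> = \<c> X \<K> \<cdot> \<c> X \<K>"
    using symmetry_hexagon[of X \<K> \<K>] assms by simp
  have inv: "\<c> \<K> X \<cdot> \<c> X \<K> = \<I> X" "\<c> X \<K> \<cdot> \<c> \<K> X = \<I> X"
    using symmetry_inverse[of X \<K>] symmetry_inverse[of \<K> X] assms by simp_all
  have "\<c> X \<K> = (\<c> \<K> X \<cdot> \<c> X \<K>) \<cdot> \<c> X \<K>" using inv assms by simp
  also have "\<dots> = \<c> \<K> X \<cdot> (\<c> X \<K> \<cdot> \<c> X \<K>)" using assms by simp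
  also have "\<dots> = \<I> X" using eq inv by simp
  finally show 1: "\<c> X \<K> = \<I> X" .
  then show "\<c> \<K> X = \<I> X" using inv assms by simp
qed

text \<open>The second hexagon follows from the first one by inverting both sides.\<close>

lemma symmetry_hexagon':
  assumes [simp]: "X \<in> Obj C" "Y \<in> Obj C" "Z \<in> Obj C"
  shows "\<c> (X \<odot> Y) Z = (\<c> X Z \<otimes> \<I> Y) \<cdot> (\<I> X \<otimes> \<c> Y Z)"
proof -
  let ?L = "\<c> (X \<odot> Y) Z" and ?R = "(\<c> X Z \<otimes> \<I> Y) \<cdot> (\<I> X \<otimes> \<c> Y Z)"
  have "\<c> Z (X \<odot> Y) = (\<I> X \<otimes> \<c> Z Y) \<cdot> (\<c> Z X \<otimes> \<I> Y)"
    by (rule symmetry_hexagon) auto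
  then have "?R \<cdot> \<c> Z (X \<odot> Y)
      = (\<c> X Z \<otimes> \<I> Y) \<cdot> ((\<I> X \<otimes> \<c> Y Z) \<cdot> (\<I> X \<otimes> \<c> Z Y)) \<cdot> (\<c> Z X \<otimes> \<I> Y)"
    by simp
  also have "\<dots> = \<I> (Z \<odot> X \<odot> Y)"
    by (simp add: interchange symmetry_inverse)
  finally have "?R \<cdot> \<c> Z (X \<odot> Y) = \<I> (Z \<odot> X \<odot> Y)" .
  moreover have "?R = (?R \<cdot> \<c> Z (X \<odot> Y)) \<cdot> ?L"
    using symmetry_inverse[of "X \<odot> Y" Z] by simp
  ultimately show ?thesis by simp
qed

text \<open>Both sides move \<open>X\<close> past \<open>Y \<otimes> Z\<close> or \<open>Z \<otimes> Y\<close> and exchange \<open>Y\<close> and \<open>Z\<close>; this is naturality of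
\<open>c\<close> in the morphism \<open>c\<^bsub>Z,Y\<^esub>\<close>.\<close>

lemma yang_baxter:
  assumes [simp]: "X \<in> Obj C" "Y \<in> Obj C" "Z \<in> Obj C"
  shows "(\<c> Y X \<otimes> \<I> Z) \<cdot> (\<I> Y \<otimes> \<c> Z X) \<cdot> (\<c> Z Y \<otimes> \<I> X) =
    (\<I> X \<otimes> \<c> Z Y) \<cdot> (\<c> Z X \<otimes> \<I> Y) \<cdot> (\<I> Z \<otimes> \<c> Y X)"
proof -
  have "(\<c> Y X \<otimes> \<I> Z) \<cdot> (\<I> Y \<otimes> \<c> Z X) \<cdot> (\<c> Z Y \<otimes> \<I> X) = \<c> (Y \<odot> Z) X \<cdot> (\<c> Z Y \<otimes> \<I> X)"
    by (subst symmetry_hexagon') auto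
  also have "\<dots> = (\<I> X \<otimes> \<c> Z Y) \<cdot> \<c> (Z \<odot> Y) X"
    by (subst naturality) auto
  finally show ?thesis by (subst (asm) symmetry_hexagon'[of Z Y X]) auto
qed

section \<open>Coherence for permutations of wires\<close>

definition tens :: "'a wire list \<Rightarrow> 'a" where
  "tens \<Gamma> = foldr (\<lambda>w X. fst w \<odot> X) \<Gamma> \<K>"

definition ctx :: "'a wire list \<Rightarrow> bool" where
  "ctx \<Gamma> \<longleftrightarrow> distinct \<Gamma> \<and> (\<forall>w\<in>set \<Gamma>. fst w \<in> Obj C)"

lemma tens_simps [simp]: "tens [] = \<K>" "tens (w # \<Gamma>) = fst w \<odot> tens \<Gamma>"
  by (simp_all add: tens_def)

lemma ctx_simps [simp]:
  "ctx []" "ctx (w # \<Gamma>) \<longleftrightarrow> w \<notin> set \<Gamma> \<and> fst w \<in> Obj C \<and> ctx \<Gamma>"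
  by (auto simp: ctx_def)

lemma ctx_append: "ctx (\<Gamma> @ \<Delta>) \<longleftrightarrow> ctx \<Gamma> \<and> ctx \<Delta> \<and> set \<Gamma> \<inter> set \<Delta> = {}"
  by (auto simp: ctx_def)

lemma ctx_removeAll [simp]: "ctx \<Gamma> \<Longrightarrow> ctx (removeAll x \<Gamma>)"
  by (auto simp: ctx_def distinct_removeAll)

lemma ctx_without [simp]: "ctx \<Gamma> \<Longrightarrow> ctx (without \<Gamma> x)"
  by (auto simp: ctx_def distinct_without)

lemma tens_obj [simp]: "ctx \<Gamma> \<Longrightarrow> tens \<Gamma> \<in> Obj C"
  by (induction \<Gamma>) auto

lemma tens_append [simp]: "ctx \<Gamma> \<Longrightarrow> ctx \<Delta> \<Longrightarrow> tens (\<Gamma> @ \<Delta>) = tens \<Gamma> \<odot> tens \<Delta>"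
  by (induction \<Gamma>) auto

text \<open>The canonical morphism that brings the wire \<open>x\<close> to the front of a context.\<close>

primrec front :: "'a wire \<Rightarrow> 'a wire list \<Rightarrow> 'b" where
  "front x [] = \<I> \<K>"
| "front x (y # \<Gamma>) = (if x = y then \<I> (tens (y # \<Gamma>))
     else (\<c> (fst y) (fst x) \<otimes> \<I> (tens (removeAll x \<Gamma>))) \<cdot> (\<I> (fst y) \<otimes> front x \<Gamma>))"

lemma front_arr [simp]:
  assumes "x \<in> set \<Gamma>" "ctx \<Gamma>"
  shows "front x \<Gamma> \<in> Arr C" "src C (front x \<Gamma>) = tens \<Gamma>"
    "tgt C (front x \<Gamma>) = fst x \<odot> tens (removeAll x \<Gamma>)"
proof -
  have "fst x \<in> Obj C \<and> front x \<Gamma> \<in> Arr C \<and> src C (front x \<Gamma>) = tens \<Gamma> \<and> tgt C (front x \<Gamma>) = fst x \<odot> tens (removeAll x \<Gamma>)"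
    using assms by (induction \<Gamma>) auto
  then show "front x \<Gamma> \<in> Arr C" "src C (front x \<Gamma>) = tens \<Gamma>"
    "tgt C (front x \<Gamma>) = fst x \<odot> tens (removeAll x \<Gamma>)" by auto
qed

lemma ctx_fst: "x \<in> set \<Gamma> \<Longrightarrow> ctx \<Gamma> \<Longrightarrow> fst x \<in> Obj C"
  by (auto simp: ctx_def)

text \<open>The simplifier merges adjacent identities; the reverse direction is needed to align the factors
of a tensor product before an interchange.\<close>

lemma ident_tensor_split:
  assumes "X \<in> Obj C" "Y \<in> Obj C" "f \<in> Arr C"
  shows "\<I> (X \<odot> Y) \<otimes> f = \<I> X \<otimes> (\<I> Y \<otimes> f)" "f \<otimes> \<I> (X \<odot> Y) = (f \<otimes> \<I> X) \<otimes> \<I> Y"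
  using assms by (simp_all flip: tensor_arr_simps(4) del: tensor_arr_simps(4))

lemma tensor_comp_ident:
  assumes "f \<in> Arr C" "g \<in> Arr C" "tgt C f = src C g" "X \<in> Obj C"
  shows "(g \<cdot> f) \<otimes> \<I> X = (g \<otimes> \<I> X) \<cdot> (f \<otimes> \<I> X)"
    "\<I> X \<otimes> (g \<cdot> f) = (\<I> X \<otimes> g) \<cdot> (\<I> X \<otimes> f)"
  using assms by (simp_all add: interchange)

text \<open>Induction step of \<open>front_front\<close>: \<open>fx\<close> and \<open>fy\<close> are the permutations of the remaining wires, and
\<open>Z\<close> is the object of the first wire of the context.\<close>

lemma front_front_step:
  assumes [simp]: "X \<in> Obj C" "Y \<in> Obj C" "Z \<in> Obj C" "T \<in> Obj C" "fx \<in> Arr C" "fy \<in> Arr C" "fx' \<in> Arr C" "fy' \<in> Arr C"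
    "tgt C fx = X \<odot> T" "tgt C fy = Y \<odot> src C fx" "src C fx' = src C fy" "tgt C fx' = X \<odot> src C fy'" "tgt C fy' = Y \<odot> T"
    and IH: "(\<c> Y X \<otimes> \<I> T) \<cdot> (\<I> Y \<otimes> fx) \<cdot> fy = (\<I> X \<otimes> fy') \<cdot> fx'"
  shows "(\<c> Y X \<otimes> \<I> (Z \<odot> T)) \<cdot> (\<I> Y \<otimes> ((\<c> Z X \<otimes> \<I> T) \<cdot> (\<I> Z \<otimes> fx))) \<cdot> (\<c> Z Y \<otimes> \<I> (src C fx)) \<cdot> (\<I> Z \<otimes> fy)
    = (\<I> X \<otimes> ((\<c> Z Y \<otimes> \<I> T) \<cdot> (\<I> Z \<otimes> fy'))) \<cdot> (\<c> Z X \<otimes> \<I> (src C fy')) \<cdot> (\<I> Z \<otimes> fx')"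
proof -
  have split: "\<I> V \<otimes> ((\<c> Z U \<otimes> \<I> T) \<cdot> (\<I> Z \<otimes> g)) = (\<I> V \<otimes> \<c> Z U \<otimes> \<I> T) \<cdot> (\<I> (V \<odot> Z) \<otimes> g)"
    if [simp]: "U \<in> Obj C" "V \<in> Obj C" "g \<in> Arr C" "tgt C g = U \<odot> T" for U V g
    by (simp add: ident_tensor_split(1) interchange)
  have slide: "(\<I> (V \<odot> Z) \<otimes> g) \<cdot> (\<c> Z V \<otimes> \<I> (src C g)) = (\<c> Z V \<otimes> \<I> (U \<odot> T)) \<cdot> (\<I> (Z \<odot> V) \<otimes> g)"
    if [simp]: "U \<in> Obj C" "V \<in> Obj C" "g \<in> Arr C" "tgt C g = U \<odot> T" for U V g
    by (subst (1 2) interchange) auto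
  have join: "(\<I> (Z \<odot> V) \<otimes> g) \<cdot> (\<I> Z \<otimes> k) = \<I> Z \<otimes> ((\<I> V \<otimes> g) \<cdot> k)"
    if [simp]: "V \<in> Obj C" "g \<in> Arr C" "k \<in> Arr C" "tgt C k = V \<odot> src C g" for V g k
    by (simp add: ident_tensor_split(1) interchange)
  have chain: "(\<I> V \<otimes> ((\<c> Z U \<otimes> \<I> T) \<cdot> (\<I> Z \<otimes> g))) \<cdot> (\<c> Z V \<otimes> \<I> (src C g)) \<cdot> (\<I> Z \<otimes> k)
      = (\<I> V \<otimes> \<c> Z U \<otimes> \<I> T) \<cdot> (\<c> Z V \<otimes> \<I> (U \<odot> T)) \<cdot> (\<I> Z \<otimes> ((\<I> V \<otimes> g) \<cdot> k))"
    if [simp]: "U \<in> Obj C" "V \<in> Obj C" "g \<in> Arr C" "tgt C g = U \<odot> T" "k \<in> Arr C" "tgt C k = V \<odot> src C g" for U V g k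
  proof -
    have "(\<I> V \<otimes> ((\<c> Z U \<otimes> \<I> T) \<cdot> (\<I> Z \<otimes> g))) \<cdot> (\<c> Z V \<otimes> \<I> (src C g)) \<cdot> (\<I> Z \<otimes> k)
      = (\<I> V \<otimes> \<c> Z U \<otimes> \<I> T) \<cdot> ((\<I> (V \<odot> Z) \<otimes> g) \<cdot> (\<c> Z V \<otimes> \<I> (src C g))) \<cdot> (\<I> Z \<otimes> k)"
      by (subst split) auto
    also have "\<dots> = (\<I> V \<otimes> \<c> Z U \<otimes> \<I> T) \<cdot> (\<c> Z V \<otimes> \<I> (U \<odot> T)) \<cdot> ((\<I> (Z \<odot> V) \<otimes> g) \<cdot> (\<I> Z \<otimes> k))"
      by (subst slide[of U]) auto
    finally show ?thesis by (subst (asm) join) auto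
  qed
  have yb: "(\<c> Y X \<otimes> \<I> (Z \<odot> T)) \<cdot> (\<I> Y \<otimes> \<c> Z X \<otimes> \<I> T) \<cdot> (\<c> Z Y \<otimes> \<I> (X \<odot> T))
    = (\<I> X \<otimes> \<c> Z Y \<otimes> \<I> T) \<cdot> (\<c> Z X \<otimes> \<I> (Y \<odot> T)) \<cdot> (\<I> Z \<otimes> \<c> Y X \<otimes> \<I> T)"
    using arg_cong[OF yang_baxter[of X Y Z], of "\<lambda>f. f \<otimes> \<I> T"]
    by (simp add: tensor_comp_ident)
  let ?k = "(\<I> Y \<otimes> fx) \<cdot> fy"
  have "(\<c> Y X \<otimes> \<I> (Z \<odot> T)) \<cdot> (\<I> Y \<otimes> ((\<c> Z X \<otimes> \<I> T) \<cdot> (\<I> Z \<otimes> fx))) \<cdot> (\<c> Z Y \<otimes> \<I> (src C fx)) \<cdot> (\<I> Z \<otimes> fy)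
    = ((\<c> Y X \<otimes> \<I> (Z \<odot> T)) \<cdot> (\<I> Y \<otimes> \<c> Z X \<otimes> \<I> T) \<cdot> (\<c> Z Y \<otimes> \<I> (X \<odot> T))) \<cdot> (\<I> Z \<otimes> ?k)"
    by (subst chain) auto
  also have "\<dots> = (\<I> X \<otimes> \<c> Z Y \<otimes> \<I> T) \<cdot> (\<c> Z X \<otimes> \<I> (Y \<odot> T)) \<cdot> ((\<I> Z \<otimes> \<c> Y X \<otimes> \<I> T) \<cdot> (\<I> Z \<otimes> ?k))"
    by (subst yb) auto
  also have "(\<I> Z \<otimes> \<c> Y X \<otimes> \<I> T) \<cdot> (\<I> Z \<otimes> ?k) = \<I> Z \<otimes> ((\<I> X \<otimes> fy') \<cdot> fx')"
    by (simp add: interchange IH)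
  also have "(\<I> X \<otimes> \<c> Z Y \<otimes> \<I> T) \<cdot> (\<c> Z X \<otimes> \<I> (Y \<odot> T)) \<cdot> \<dots>
    = (\<I> X \<otimes> ((\<c> Z Y \<otimes> \<I> T) \<cdot> (\<I> Z \<otimes> fy'))) \<cdot> (\<c> Z X \<otimes> \<I> (src C fy')) \<cdot> (\<I> Z \<otimes> fx')"
    by (rule chain[symmetric]) auto
  finally show ?thesis .
qed

text \<open>The core of coherence: each wire that stands in front of both \<open>x\<close> and \<open>y\<close> contributes one instance
of the Yang-Baxter equation.\<close>

lemma front_front:
  assumes "x \<in> set \<Gamma>" "y \<in> set \<Gamma>" "x \<noteq> y" "ctx \<Gamma>"
  shows "(\<c> (fst y) (fst x) \<otimes> \<I> (tens (removeAll x (removeAll y \<Gamma>)))) \<cdot>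
      (\<I> (fst y) \<otimes> front x (removeAll y \<Gamma>)) \<cdot> front y \<Gamma>
    = (\<I> (fst x) \<otimes> front y (removeAll x \<Gamma>)) \<cdot> front x \<Gamma>"
  using assms
proof (induction \<Gamma>)
  case (Cons z \<Gamma>)
  have ob [simp]: "fst x \<in> Obj C" "fst y \<in> Obj C" "fst z \<in> Obj C"
    using Cons.prems by (auto intro: ctx_fst)
  have [simp]: "ctx \<Gamma>" "z \<notin> set \<Gamma>" using Cons.prems by auto
  consider "z = y" | "z = x" | "z \<noteq> y" "z \<noteq> x" by auto
  then show ?case
  proof cases
    case 1
    then show ?thesis using Cons.prems by (auto simp: interchange)
  next
    case 2
    then show ?thesis using Cons.prems
      by (auto simp: interchange interchange_comp symmetry_inverse removeAll_id)
  next
    case 3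
    have m [simp]: "x \<in> set \<Gamma>" "y \<in> set \<Gamma>" "x \<noteq> y" "y \<noteq> x" using 3 Cons.prems by auto
    let ?T = "tens (removeAll x (removeAll y \<Gamma>))"
    have T: "removeAll y (removeAll x \<Gamma>) = removeAll x (removeAll y \<Gamma>)"
      by (simp add: removeAll_filter_not_eq conj_commute)
    show ?thesis
      using front_front_step[of "fst x" "fst y" "fst z" "tens (removeAll x (removeAll y \<Gamma>))"
          "front x (removeAll y \<Gamma>)" "front y \<Gamma>" "front x \<Gamma>" "front y (removeAll x \<Gamma>)"]
        Cons.IH 3 T by (simp add: tensor_comp_ident del: comp_assoc')
  qed
qed simp

definition perm :: "'a wire list \<Rightarrow> 'a wire list \<Rightarrow> bool" where
  "perm \<Gamma> \<Delta> \<longleftrightarrow> ctx \<Gamma> \<and> ctx \<Delta> \<and> set \<Gamma> = set \<Delta>"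

text \<open>The canonical permutation from the order \<open>\<Gamma>\<close> to the order \<open>\<Delta>\<close>, built by selecting the wires of
\<open>\<Delta>\<close> one after the other.\<close>

primrec sigma :: "'a wire list \<Rightarrow> 'a wire list \<Rightarrow> 'b" where
  "sigma \<Gamma> [] = \<I> \<K>"
| "sigma \<Gamma> (x # \<Delta>) = (\<I> (fst x) \<otimes> sigma (removeAll x \<Gamma>) \<Delta>) \<cdot> front x \<Gamma>"

lemma perm_ConsD:
  assumes "perm \<Gamma> (x # \<Delta>)"
  shows "x \<in> set \<Gamma>" "ctx \<Gamma>" "perm (removeAll x \<Gamma>) \<Delta>" "fst x \<in> Obj C"
  using assms by (auto simp: perm_def)

lemma perm_refl [simp]: "perm \<Gamma> \<Gamma> \<longleftrightarrow> ctx \<Gamma>"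
  by (auto simp: perm_def)

lemma perm_sym: "perm \<Gamma> \<Delta> \<Longrightarrow> perm \<Delta> \<Gamma>"
  by (auto simp: perm_def)

lemma perm_trans: "perm \<Gamma> \<Delta> \<Longrightarrow> perm \<Delta> \<Theta> \<Longrightarrow> perm \<Gamma> \<Theta>"
  by (auto simp: perm_def)

lemma sigma_arr [simp]:
  assumes "perm \<Gamma> \<Delta>"
  shows "sigma \<Gamma> \<Delta> \<in> Arr C" "src C (sigma \<Gamma> \<Delta>) = tens \<Gamma>" "tgt C (sigma \<Gamma> \<Delta>) = tens \<Delta>"
proof -
  have "sigma \<Gamma> \<Delta> \<in> Arr C \<and> src C (sigma \<Gamma> \<Delta>) = tens \<Gamma> \<and> tgt C (sigma \<Gamma> \<Delta>) = tens \<Delta>"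
    using assms
  proof (induction \<Delta> arbitrary: \<Gamma>)
    case (Cons x \<Delta>)
    note perm_ConsD[OF Cons.prems]
    then show ?case using Cons.IH[of "removeAll x \<Gamma>"] by (auto simp del: removeAll.simps)
  qed (auto simp: perm_def)
  then show "sigma \<Gamma> \<Delta> \<in> Arr C" "src C (sigma \<Gamma> \<Delta>) = tens \<Gamma>" "tgt C (sigma \<Gamma> \<Delta>) = tens \<Delta>" by auto
qed

lemma sigma_refl [simp]: "ctx \<Gamma> \<Longrightarrow> sigma \<Gamma> \<Gamma> = \<I> (tens \<Gamma>)"
  by (induction \<Gamma>) auto

lemma front_sigma:
  assumes "perm \<Gamma> \<Delta>" "x \<in> set \<Delta>"
  shows "front x \<Delta> \<cdot> sigma \<Gamma> \<Delta> = (\<I> (fst x) \<otimes> sigma (removeAll x \<Gamma>) (removeAll x \<Delta>)) \<cdot> front x \<Gamma>"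
  using assms
proof (induction \<Delta> arbitrary: \<Gamma>)
  case (Cons y \<Delta>)
  note y [simp] = perm_ConsD[OF Cons.prems(1)]
  show ?case
  proof (cases "x = y")
    case True
    then have "y \<notin> set \<Delta>" using Cons.prems by (auto simp: perm_def)
    with True show ?thesis using y(3) by simp
  next
    case False
    with Cons.prems have x: "x \<in> set \<Delta>" "x \<in> set \<Gamma>" by (auto simp: perm_def)
    have [simp]: "fst x \<in> Obj C" using x y by (auto intro: ctx_fst)
    have c [simp]: "ctx \<Delta>" "ctx \<Gamma>" "x \<noteq> y" "y \<noteq> x" using y False by (auto simp: perm_def)
    let ?X = "fst x" and ?Y = "fst y" and ?S = "sigma (removeAll x (removeAll y \<Gamma>)) (removeAll x \<Delta>)"
    have p: "perm (removeAll x (removeAll y \<Gamma>)) (removeAll x \<Delta>)" using y(3) by (auto simp: perm_def)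
    have comm: "removeAll y (removeAll x \<Gamma>) = removeAll x (removeAll y \<Gamma>)"
      by (simp add: removeAll_filter_not_eq conj_commute)
    have mem: "x \<in> set (removeAll y \<Gamma>)" "y \<in> set (removeAll x \<Gamma>)" using x y by auto
    note [simp] = x p mem
    have "front x (y # \<Delta>) \<cdot> sigma \<Gamma> (y # \<Delta>) =
      (\<c> ?Y ?X \<otimes> \<I> (tens (removeAll x \<Delta>))) \<cdot> (\<I> ?Y \<otimes> (front x \<Delta> \<cdot> sigma (removeAll y \<Gamma>) \<Delta>)) \<cdot> front y \<Gamma>"
      using y(3) by (simp add: tensor_comp_ident del: set_removeAll)
    also have "\<dots> = ((\<c> ?Y ?X \<otimes> \<I> (tens (removeAll x \<Delta>))) \<cdot> (\<I> (?Y \<odot> ?X) \<otimes> ?S)) \<cdot>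
        (\<I> ?Y \<otimes> front x (removeAll y \<Gamma>)) \<cdot> front y \<Gamma>"
      using Cons.IH[OF y(3) x(1)]
      by (simp add: tensor_comp_ident ident_tensor_split(1) del: set_removeAll)
    also have "(\<c> ?Y ?X \<otimes> \<I> (tens (removeAll x \<Delta>))) \<cdot> (\<I> (?Y \<odot> ?X) \<otimes> ?S)
        = (\<I> (?X \<odot> ?Y) \<otimes> ?S) \<cdot> (\<c> ?Y ?X \<otimes> \<I> (tens (removeAll x (removeAll y \<Gamma>))))"
      by (simp add: interchange)
    also have "\<dots> \<cdot> (\<I> ?Y \<otimes> front x (removeAll y \<Gamma>)) \<cdot> front y \<Gamma>
        = (\<I> (?X \<odot> ?Y) \<otimes> ?S) \<cdot> (\<I> ?X \<otimes> front y (removeAll x \<Gamma>)) \<cdot> front x \<Gamma>"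
      using front_front[of x \<Gamma> y] by (simp del: set_removeAll)
    also have "\<dots> = (\<I> ?X \<otimes> sigma (removeAll x \<Gamma>) (removeAll x (y # \<Delta>))) \<cdot> front x \<Gamma>"
      by (simp add: tensor_comp_ident ident_tensor_split(1) comm del: set_removeAll)
    finally show ?thesis .
  qed
qed simp

text \<open>Selecting a wire after a permutation equals selecting it before (\<open>front_sigma\<close>), and canonical
permutations are built from selections. This is the coherence theorem on which the meaning of
programs rests.\<close>

lemma sigma_comp:
  assumes "perm \<Gamma> \<Delta>" "perm \<Delta> \<Theta>"
  shows "sigma \<Delta> \<Theta> \<cdot> sigma \<Gamma> \<Delta> = sigma \<Gamma> \<Theta>"
  using assms
proof (induction \<Theta> arbitrary: \<Gamma> \<Delta>)
  case (Cons x \<Theta>)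
  note x [simp] = perm_ConsD[OF Cons.prems(2)]
  have g [simp]: "x \<in> set \<Gamma>" "ctx \<Gamma>" using x Cons.prems by (auto simp: perm_def)
  have p [simp]: "perm (removeAll x \<Gamma>) (removeAll x \<Delta>)" using Cons.prems(1) by (auto simp: perm_def)
  have "sigma \<Delta> (x # \<Theta>) \<cdot> sigma \<Gamma> \<Delta>
    = (\<I> (fst x) \<otimes> sigma (removeAll x \<Delta>) \<Theta>) \<cdot> (\<I> (fst x) \<otimes> sigma (removeAll x \<Gamma>) (removeAll x \<Delta>)) \<cdot> front x \<Gamma>"
    using Cons.prems(1) front_sigma[OF Cons.prems(1) x(1)] by simp
  also have "\<dots> = (\<I> (fst x) \<otimes> (sigma (removeAll x \<Delta>) \<Theta> \<cdot> sigma (removeAll x \<Gamma>) (removeAll x \<Delta>))) \<cdot> front x \<Gamma>"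
    by (simp add: tensor_comp_ident)
  finally show ?case using Cons.IH[OF p x(3)] by simp
qed (auto simp: perm_def)

lemma sigma_append_left:
  assumes "perm \<Gamma> \<Delta>" "ctx (R @ \<Gamma>)"
  shows "sigma (R @ \<Gamma>) (R @ \<Delta>) = \<I> (tens R) \<otimes> sigma \<Gamma> \<Delta>"
  using assms
proof (induction R)
  case (Cons x R)
  have "perm (R @ \<Gamma>) (R @ \<Delta>)" using Cons.prems by (auto simp: perm_def ctx_append)
  with Cons show ?case by (auto simp: ctx_append ident_tensor_split(1))
qed simp

lemma front_append:
  assumes "x \<in> set \<Gamma>" "ctx (\<Gamma> @ R)"
  shows "front x (\<Gamma> @ R) = front x \<Gamma> \<otimes> \<I> (tens R)"
  using assms
proof (induction \<Gamma>)
  case (Cons y \<Gamma>)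
  then have [simp]: "ctx R" "ctx \<Gamma>" "fst x \<in> Obj C" "fst y \<in> Obj C" "y \<notin> set \<Gamma>" "y \<notin> set R"
    and R: "removeAll x R = R"
    by (auto simp: ctx_append intro: ctx_fst removeAll_id)
  show ?case using Cons by (auto simp: ctx_append R tensor_comp_ident)
qed simp

lemma sigma_append_right:
  assumes "perm \<Gamma> \<Delta>" "ctx (\<Gamma> @ R)"
  shows "sigma (\<Gamma> @ R) (\<Delta> @ R) = sigma \<Gamma> \<Delta> \<otimes> \<I> (tens R)"
  using assms
proof (induction \<Delta> arbitrary: \<Gamma>)
  case Nil
  then show ?case by (auto simp: perm_def)
next
  case (Cons x \<Delta>)
  note x [simp] = perm_ConsD[OF Cons.prems(1)]
  have r [simp]: "ctx R" using Cons.prems by (simp add: ctx_append)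
  have "x \<notin> set R" using Cons.prems x(1) unfolding ctx_append by blast
  then have R: "removeAll x R = R" by simp
  have "sigma (removeAll x \<Gamma> @ R) (\<Delta> @ R) = sigma (removeAll x \<Gamma>) \<Delta> \<otimes> \<I> (tens R)"
    by (rule Cons.IH[OF x(3)]) (use Cons.prems in \<open>auto simp: ctx_append\<close>)
  then show ?case using Cons.prems
    by (simp add: front_append R tensor_comp_ident)
qed

lemma front_middle:
  assumes "ctx (\<Gamma> @ x # \<Delta>)"
  shows "front x (\<Gamma> @ x # \<Delta>) = \<c> (tens \<Gamma>) (fst x) \<otimes> \<I> (tens \<Delta>)"
  using assms
proof (induction \<Gamma>)
  case (Cons y \<Gamma>)
  then have [simp]: "ctx \<Gamma>" "ctx \<Delta>" "fst x \<in> Obj C" "fst y \<in> Obj C" "x \<noteq> y" "removeAll x \<Gamma> = \<Gamma>" "removeAll x \<Delta> = \<Delta>"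
    by (auto simp: ctx_append)
  have IH: "front x (\<Gamma> @ x # \<Delta>) = \<c> (tens \<Gamma>) (fst x) \<otimes> \<I> (tens \<Delta>)" using Cons by (auto simp: ctx_append)
  show ?case
    by (simp add: IH symmetry_hexagon' tensor_comp_ident)
qed simp

lemma sigma_block:
  assumes "ctx (\<Gamma> @ \<Delta>)"
  shows "sigma (\<Gamma> @ \<Delta>) (\<Delta> @ \<Gamma>) = \<c> (tens \<Gamma>) (tens \<Delta>)"
  using assms
proof (induction \<Delta>)
  case (Cons x \<Delta>)
  then have [simp]: "ctx \<Gamma>" "ctx \<Delta>" "fst x \<in> Obj C" "removeAll x \<Gamma> = \<Gamma>" "removeAll x \<Delta> = \<Delta>"
    by (auto simp: ctx_append)
  have IH: "sigma (\<Gamma> @ \<Delta>) (\<Delta> @ \<Gamma>) = \<c> (tens \<Gamma>) (tens \<Delta>)" using Cons by (auto simp: ctx_append)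
  show ?case
    by (simp add: front_middle[OF Cons.prems] IH symmetry_hexagon)
qed simp

section \<open>The morphism denoted by a program\<close>

fun arr :: "('a, 'b) instr \<Rightarrow> 'b" where
  "arr (Op m xs ys) = m" | "arr (Wire x y) = \<I> (fst x)"

definition typed :: "('a, 'b) instr \<Rightarrow> bool" where
  "typed i \<longleftrightarrow> ctx (ins i) \<and> ctx (outs i) \<and> arr i \<in> hom C (tens (ins i)) (tens (outs i))"

fun valid :: "'a wire list \<Rightarrow> ('a, 'b) instr list \<Rightarrow> 'a wire list \<Rightarrow> bool" where
  "valid \<Gamma> [] \<Delta> \<longleftrightarrow> perm \<Gamma> \<Delta>"
| "valid \<Gamma> (i # P) \<Delta> \<longleftrightarrow> ctx \<Gamma> \<and> typed i \<and> set (ins i) \<subseteq> set \<Gamma> \<and>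
     set (outs i) \<inter> set (without \<Gamma> (ins i)) = {} \<and> valid (step \<Gamma> i) P \<Delta>"

text \<open>Before each instruction its inputs are permuted to the front; afterwards the outputs stand at the
front. At the end the wires are permuted to the required order \<open>\<Delta>\<close>.\<close>

fun sem :: "'a wire list \<Rightarrow> ('a, 'b) instr list \<Rightarrow> 'a wire list \<Rightarrow> 'b" where
  "sem \<Gamma> [] \<Delta> = sigma \<Gamma> \<Delta>"
| "sem \<Gamma> (i # P) \<Delta> = sem (step \<Gamma> i) P \<Delta> \<cdot> (arr i \<otimes> \<I> (tens (without \<Gamma> (ins i)))) \<cdot>
     sigma \<Gamma> (ins i @ without \<Gamma> (ins i))"

lemma typedD [simp]:
  assumes "typed i"
  shows "ctx (ins i)" "ctx (outs i)" "arr i \<in> Arr C" "src C (arr i) = tens (ins i)" "tgt C (arr i) = tens (outs i)"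
  using assms by (auto simp: typed_def hom_def)

lemma perm_ins [simp]:
  assumes "ctx \<Gamma>" "typed i" "set (ins i) \<subseteq> set \<Gamma>"
  shows "perm \<Gamma> (ins i @ without \<Gamma> (ins i))"
  using assms by (auto simp: perm_def ctx_append)

lemma ctx_step [simp]:
  assumes "ctx \<Gamma>" "typed i" "set (outs i) \<inter> set (without \<Gamma> (ins i)) = {}"
  shows "ctx (step \<Gamma> i)" "tens (step \<Gamma> i) = tens (outs i) \<odot> tens (without \<Gamma> (ins i))"
  using assms by (auto simp: step_def ctx_append)

lemma ctx_ins [simp]:
  assumes "ctx \<Gamma>" "typed i"
  shows "ctx (ins i @ without \<Gamma> (ins i))"
  using assms by (auto simp: ctx_append)

lemma set_step: "set (step \<Gamma> i) = set (outs i) \<union> (set \<Gamma> - set (ins i))"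
  by (simp add: step_def)

lemma valid_ctx: "valid \<Gamma> P \<Delta> \<Longrightarrow> ctx \<Gamma> \<and> ctx \<Delta>"
  by (induction P arbitrary: \<Gamma>) (auto simp: perm_def)

lemma valid_perm: "valid \<Gamma> P \<Delta> \<Longrightarrow> perm \<Gamma>' \<Gamma> \<Longrightarrow> valid \<Gamma>' P \<Delta>"
proof (induction P arbitrary: \<Gamma> \<Gamma>')
  case Nil
  then show ?case by (auto intro: perm_trans)
next
  case (Cons i P)
  have "perm (step \<Gamma>' i) (step \<Gamma> i)" using Cons.prems
    by (auto simp: perm_def step_def ctx_append)
  with Cons show ?case by (auto simp: perm_def)
qed

lemma valid_perm_right: "valid \<Gamma> P \<Delta> \<Longrightarrow> perm \<Delta> \<Delta>' \<Longrightarrow> valid \<Gamma> P \<Delta>'"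
  by (induction P arbitrary: \<Gamma>) (auto intro: perm_trans)

lemma sem_arr [simp]:
  assumes "valid \<Gamma> P \<Delta>"
  shows "sem \<Gamma> P \<Delta> \<in> Arr C" "src C (sem \<Gamma> P \<Delta>) = tens \<Gamma>" "tgt C (sem \<Gamma> P \<Delta>) = tens \<Delta>"
proof -
  have "sem \<Gamma> P \<Delta> \<in> Arr C \<and> src C (sem \<Gamma> P \<Delta>) = tens \<Gamma> \<and> tgt C (sem \<Gamma> P \<Delta>) = tens \<Delta>"
    using assms by (induction P arbitrary: \<Gamma>) auto
  then show "sem \<Gamma> P \<Delta> \<in> Arr C" "src C (sem \<Gamma> P \<Delta>) = tens \<Gamma>" "tgt C (sem \<Gamma> P \<Delta>) = tens \<Delta>" by auto
qed

text \<open>The permutation of the wires that are not touched by an instruction slides through it, so the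
order in which the inputs are listed is immaterial.\<close>

lemma sem_perm:
  assumes "valid \<Gamma> P \<Delta>" "perm \<Gamma>' \<Gamma>"
  shows "sem \<Gamma> P \<Delta> \<cdot> sigma \<Gamma>' \<Gamma> = sem \<Gamma>' P \<Delta>"
  using assms
proof (induction P arbitrary: \<Gamma> \<Gamma>')
  case Nil
  then show ?case by (simp add: sigma_comp)
next
  case (Cons i P)
  let ?W = "without \<Gamma> (ins i)" and ?W' = "without \<Gamma>' (ins i)"
  have [simp]: "ctx \<Gamma>" "ctx \<Gamma>'" "typed i" "set (ins i) \<subseteq> set \<Gamma>" "set (ins i) \<subseteq> set \<Gamma>'" "perm \<Gamma>' \<Gamma>"
    "set \<Gamma>' = set \<Gamma>"
    and v [simp]: "valid (step \<Gamma> i) P \<Delta>" "set (outs i) \<inter> (set \<Gamma> - set (ins i)) = {}"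
    using Cons.prems by (auto simp: perm_def)
  have W [simp]: "perm ?W' ?W" by (auto simp: perm_def)
  have [simp]: "perm (ins i @ ?W') (ins i @ ?W)" by (auto simp: perm_def)
  have s: "perm (step \<Gamma>' i) (step \<Gamma> i)" by (auto simp: perm_def set_step)
  have v': "valid (step \<Gamma>' i) P \<Delta>" using v s valid_perm by blast
  have "sem \<Gamma> (i # P) \<Delta> \<cdot> sigma \<Gamma>' \<Gamma>
    = sem (step \<Gamma> i) P \<Delta> \<cdot> (arr i \<otimes> \<I> (tens ?W)) \<cdot> sigma \<Gamma>' (ins i @ ?W)"
    by (simp add: sigma_comp)
  also have "sigma \<Gamma>' (ins i @ ?W) = sigma (ins i @ ?W') (ins i @ ?W) \<cdot> sigma \<Gamma>' (ins i @ ?W')"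
    by (simp add: sigma_comp)
  also have "sigma (ins i @ ?W') (ins i @ ?W) = \<I> (tens (ins i)) \<otimes> sigma ?W' ?W"
    by (rule sigma_append_left) auto
  also have "(arr i \<otimes> \<I> (tens ?W)) \<cdot> (\<I> (tens (ins i)) \<otimes> sigma ?W' ?W) \<cdot> sigma \<Gamma>' (ins i @ ?W')
    = (\<I> (tens (outs i)) \<otimes> sigma ?W' ?W) \<cdot> (arr i \<otimes> \<I> (tens ?W')) \<cdot> sigma \<Gamma>' (ins i @ ?W')"
    by (simp add: interchange_comp)
  also have "\<I> (tens (outs i)) \<otimes> sigma ?W' ?W = sigma (step \<Gamma>' i) (step \<Gamma> i)"
    unfolding step_def by (rule sigma_append_left[symmetric]) (auto simp: ctx_append)
  also have "sem (step \<Gamma> i) P \<Delta> \<cdot> sigma (step \<Gamma>' i) (step \<Gamma> i) \<cdot> (arr i \<otimes> \<I> (tens ?W')) \<cdot> sigma \<Gamma>' (ins i @ ?W')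
    = (sem (step \<Gamma> i) P \<Delta> \<cdot> sigma (step \<Gamma>' i) (step \<Gamma> i)) \<cdot> (arr i \<otimes> \<I> (tens ?W')) \<cdot> sigma \<Gamma>' (ins i @ ?W')"
    using s by simp
  also have "sem (step \<Gamma> i) P \<Delta> \<cdot> sigma (step \<Gamma>' i) (step \<Gamma> i) = sem (step \<Gamma>' i) P \<Delta>"
    using v(1) s by (rule Cons.IH)
  finally show ?case by simp
qed

lemma sem_perm_right:
  assumes "valid \<Gamma> P \<Delta>" "perm \<Delta> \<Delta>'"
  shows "sigma \<Delta> \<Delta>' \<cdot> sem \<Gamma> P \<Delta> = sem \<Gamma> P \<Delta>'"
  using assms
proof (induction P arbitrary: \<Gamma>)
  case (Cons i P)
  have v: "valid (step \<Gamma> i) P \<Delta>" using Cons.prems by simp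
  let ?k = "(arr i \<otimes> \<I> (tens (without \<Gamma> (ins i)))) \<cdot> sigma \<Gamma> (ins i @ without \<Gamma> (ins i))"
  have "sigma \<Delta> \<Delta>' \<cdot> sem (step \<Gamma> i) P \<Delta> \<cdot> ?k = (sigma \<Delta> \<Delta>' \<cdot> sem (step \<Gamma> i) P \<Delta>) \<cdot> ?k"
    using Cons.prems v by simp
  then show ?case using Cons.IH[OF v Cons.prems(2)] by simp
qed (simp add: sigma_comp)

lemma valid_final: "valid \<Gamma> P \<Delta> \<Longrightarrow> perm (final \<Gamma> P) \<Delta>"
  by (induction P arbitrary: \<Gamma>) auto

lemma valid_append: "valid \<Gamma> (P @ Q) \<Delta> \<longleftrightarrow> valid \<Gamma> P (final \<Gamma> P) \<and> valid (final \<Gamma> P) Q \<Delta>"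
  by (induction P arbitrary: \<Gamma>) (auto dest: valid_ctx)

lemma valid_append_iff:
  assumes "valid \<Gamma> P \<Theta>"
  shows "valid \<Gamma> (P @ Q) \<Delta> \<longleftrightarrow> valid \<Theta> Q \<Delta>"
proof -
  have "perm (final \<Gamma> P) \<Theta>" using valid_final[OF assms] .
  then have "valid \<Gamma> P (final \<Gamma> P)" using assms valid_perm_right perm_sym by blast
  then show ?thesis using valid_append valid_perm \<open>perm (final \<Gamma> P) \<Theta>\<close> perm_sym by blast
qed

lemma sem_append:
  assumes "valid \<Gamma> P \<Theta>" "valid \<Theta> Q \<Delta>"
  shows "sem \<Gamma> (P @ Q) \<Delta> = sem \<Theta> Q \<Delta> \<cdot> sem \<Gamma> P \<Theta>"
  using assms
proof (induction P arbitrary: \<Gamma>)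
  case (Cons i P)
  then show ?case using Cons.IH[of "step \<Gamma> i"] valid_append_iff[of "step \<Gamma> i" P \<Theta>] by simp
qed (simp add: sem_perm)

lemma step_append:
  assumes "set (ins i) \<inter> set R = {}"
  shows "step (\<Gamma> @ R) i = step \<Gamma> i @ R" "without (\<Gamma> @ R) (ins i) = without \<Gamma> (ins i) @ R"
proof -
  have "filter (\<lambda>w. w \<notin> set (ins i)) R = R" using assms by (auto simp: filter_id_conv)
  then show "step (\<Gamma> @ R) i = step \<Gamma> i @ R" "without (\<Gamma> @ R) (ins i) = without \<Gamma> (ins i) @ R"
    by (simp_all add: step_def without_def)
qed

lemma valid_frame:
  assumes "valid \<Gamma> P \<Delta>" "ctx R" "set \<Gamma> \<inter> set R = {}" "wires P \<inter> set R = {}"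
  shows "valid (\<Gamma> @ R) P (\<Delta> @ R)"
  using assms
proof (induction P arbitrary: \<Gamma>)
  case (Cons i P)
  have i: "set (ins i) \<inter> set R = {}" "set (outs i) \<inter> set R = {}" using Cons.prems by auto
  have "valid (step \<Gamma> i @ R) P (\<Delta> @ R)"
    by (rule Cons.IH) (use Cons.prems i in \<open>auto simp: set_step\<close>)
  then show ?case using Cons.prems i by (auto simp: step_append ctx_append)
qed (auto simp: perm_def ctx_append)

lemma sem_frame:
  assumes "valid \<Gamma> P \<Delta>" "ctx R" "set \<Gamma> \<inter> set R = {}" "wires P \<inter> set R = {}"
  shows "sem (\<Gamma> @ R) P (\<Delta> @ R) = sem \<Gamma> P \<Delta> \<otimes> \<I> (tens R)"
  using assms
proof (induction P arbitrary: \<Gamma>)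
  case Nil
  then show ?case by (auto simp: perm_def ctx_append sigma_append_right)
next
  case (Cons i P)
  let ?W = "without \<Gamma> (ins i)"
  have i: "set (ins i) \<inter> set R = {}" "set (outs i) \<inter> set R = {}" using Cons.prems by auto
  have g [simp]: "ctx \<Gamma>" "typed i" "set (ins i) \<subseteq> set \<Gamma>" "set (outs i) \<inter> (set \<Gamma> - set (ins i)) = {}"
    "valid (step \<Gamma> i) P \<Delta>" "ctx R" using Cons.prems by auto
  have IH: "sem (step \<Gamma> i @ R) P (\<Delta> @ R) = sem (step \<Gamma> i) P \<Delta> \<otimes> \<I> (tens R)"
    by (rule Cons.IH) (use Cons.prems i in \<open>auto simp: set_step\<close>)
  have "sigma (\<Gamma> @ R) ((ins i @ ?W) @ R) = sigma \<Gamma> (ins i @ ?W) \<otimes> \<I> (tens R)"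
    by (rule sigma_append_right) (use Cons.prems in \<open>auto simp: ctx_append\<close>)
  moreover have "tens (?W @ R) = tens ?W \<odot> tens R" by simp
  ultimately show ?case using i IH
    by (simp add: step_append tensor_comp_ident)
qed

text \<open>Reduced to \<open>sem_frame\<close> by conjugation with the block permutation, which is a single symmetry.\<close>

lemma sem_frame_left:
  assumes "valid \<Gamma> P \<Delta>" "ctx R" "set \<Gamma> \<inter> set R = {}" "wires P \<inter> set R = {}" "set \<Delta> \<inter> set R = {}"
  shows "sem (R @ \<Gamma>) P (R @ \<Delta>) = \<I> (tens R) \<otimes> sem \<Gamma> P \<Delta>" "valid (R @ \<Gamma>) P (R @ \<Delta>)"
proof -
  have c [simp]: "ctx \<Gamma>" "ctx \<Delta>" "ctx R" using valid_ctx[OF assms(1)] assms(2) by auto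
  have v: "valid (\<Gamma> @ R) P (\<Delta> @ R)" using valid_frame assms by blast
  have p: "perm (R @ \<Gamma>) (\<Gamma> @ R)" "perm (\<Delta> @ R) (R @ \<Delta>)"
    using assms by (auto simp: perm_def ctx_append)
  have v1: "valid (R @ \<Gamma>) P (\<Delta> @ R)" using v p valid_perm by blast
  then show "valid (R @ \<Gamma>) P (R @ \<Delta>)" using p valid_perm_right by blast
  have "sem (R @ \<Gamma>) P (R @ \<Delta>) = sigma (\<Delta> @ R) (R @ \<Delta>) \<cdot> sem (\<Gamma> @ R) P (\<Delta> @ R) \<cdot> sigma (R @ \<Gamma>) (\<Gamma> @ R)"
    using sem_perm[OF v p(1)] sem_perm_right[OF v1 p(2)] by simp
  also have "\<dots> = \<c> (tens \<Delta>) (tens R) \<cdot> (sem \<Gamma> P \<Delta> \<otimes> \<I> (tens R)) \<cdot> \<c> (tens R) (tens \<Gamma>)"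
    using assms p by (simp add: sigma_block sem_frame ctx_append perm_def Int_commute)
  also have "\<dots> = (\<c> (tens \<Delta>) (tens R) \<cdot> (sem \<Gamma> P \<Delta> \<otimes> \<I> (tens R))) \<cdot> \<c> (tens R) (tens \<Gamma>)"
    using assms by simp
  also have "\<c> (tens \<Delta>) (tens R) \<cdot> (sem \<Gamma> P \<Delta> \<otimes> \<I> (tens R)) = (\<I> (tens R) \<otimes> sem \<Gamma> P \<Delta>) \<cdot> \<c> (tens \<Gamma>) (tens R)"
    using assms by (subst naturality) auto
  finally show "sem (R @ \<Gamma>) P (R @ \<Delta>) = \<I> (tens R) \<otimes> sem \<Gamma> P \<Delta>"
    using assms by (simp add: symmetry_inverse)
qed

text \<open>Parallel composition; together with the reverse order of execution in the next lemma it yields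
the commutation of independent instructions.\<close>

lemma sem_tensor:
  assumes P: "valid \<Gamma> P \<Delta>" and P': "valid \<Gamma>' P' \<Delta>'"
    and d: "set \<Gamma> \<inter> set \<Gamma>' = {}" "set \<Delta> \<inter> set \<Gamma>' = {}" "set \<Delta> \<inter> set \<Delta>' = {}"
      "wires P \<inter> set \<Gamma>' = {}" "wires P' \<inter> set \<Delta> = {}"
  shows "valid (\<Gamma> @ \<Gamma>') (P @ P') (\<Delta> @ \<Delta>')" "sem (\<Gamma> @ \<Gamma>') (P @ P') (\<Delta> @ \<Delta>') = sem \<Gamma> P \<Delta> \<otimes> sem \<Gamma>' P' \<Delta>'"
proof -
  have c: "ctx \<Gamma>" "ctx \<Delta>" "ctx \<Gamma>'" "ctx \<Delta>'" using valid_ctx P P' by blast+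
  have 1: "valid (\<Gamma> @ \<Gamma>') P (\<Delta> @ \<Gamma>')" "sem (\<Gamma> @ \<Gamma>') P (\<Delta> @ \<Gamma>') = sem \<Gamma> P \<Delta> \<otimes> \<I> (tens \<Gamma>')"
    using valid_frame[OF P c(3)] sem_frame[OF P c(3)] d by auto
  have 2: "valid (\<Delta> @ \<Gamma>') P' (\<Delta> @ \<Delta>')" "sem (\<Delta> @ \<Gamma>') P' (\<Delta> @ \<Delta>') = \<I> (tens \<Delta>) \<otimes> sem \<Gamma>' P' \<Delta>'"
    using sem_frame_left[OF P' c(2)] d by auto
  show "valid (\<Gamma> @ \<Gamma>') (P @ P') (\<Delta> @ \<Delta>')" using 1 2 valid_append_iff by blast
  show "sem (\<Gamma> @ \<Gamma>') (P @ P') (\<Delta> @ \<Delta>') = sem \<Gamma> P \<Delta> \<otimes> sem \<Gamma>' P' \<Delta>'"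
    using sem_append[OF 1(1) 2(1)] 1(2) 2(2) P P' c by (simp add: interchange)
qed

lemma sem_tensor_swap:
  assumes P: "valid \<Gamma> P \<Delta>" and P': "valid \<Gamma>' P' \<Delta>'"
    and d: "set \<Gamma> \<inter> set \<Gamma>' = {}" "set \<Gamma> \<inter> set \<Delta>' = {}" "set \<Delta> \<inter> set \<Delta>' = {}"
      "wires P \<inter> set \<Delta>' = {}" "wires P' \<inter> set \<Gamma> = {}"
  shows "valid (\<Gamma> @ \<Gamma>') (P' @ P) (\<Delta> @ \<Delta>')" "sem (\<Gamma> @ \<Gamma>') (P' @ P) (\<Delta> @ \<Delta>') = sem \<Gamma> P \<Delta> \<otimes> sem \<Gamma>' P' \<Delta>'"
proof -
  have c: "ctx \<Gamma>" "ctx \<Delta>" "ctx \<Gamma>'" "ctx \<Delta>'" using valid_ctx P P' by blast+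
  have 1: "valid (\<Gamma> @ \<Delta>') P (\<Delta> @ \<Delta>')" "sem (\<Gamma> @ \<Delta>') P (\<Delta> @ \<Delta>') = sem \<Gamma> P \<Delta> \<otimes> \<I> (tens \<Delta>')"
    using valid_frame[OF P c(4)] sem_frame[OF P c(4)] d by auto
  have 2: "valid (\<Gamma> @ \<Gamma>') P' (\<Gamma> @ \<Delta>')" "sem (\<Gamma> @ \<Gamma>') P' (\<Gamma> @ \<Delta>') = \<I> (tens \<Gamma>) \<otimes> sem \<Gamma>' P' \<Delta>'"
    using sem_frame_left[OF P' c(1)] d by auto
  show "valid (\<Gamma> @ \<Gamma>') (P' @ P) (\<Delta> @ \<Delta>')" using 1 2 valid_append_iff by blast
  show "sem (\<Gamma> @ \<Gamma>') (P' @ P) (\<Delta> @ \<Delta>') = sem \<Gamma> P \<Delta> \<otimes> sem \<Gamma>' P' \<Delta>'"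
    using sem_append[OF 2(1) 1(1)] 1(2) 2(2) P P' c by (simp add: interchange)
qed

section \<open>Equivalence of programs\<close>

definition eqv :: "'a wire list \<Rightarrow> 'a wire list \<Rightarrow> ('a, 'b) instr list \<Rightarrow> ('a, 'b) instr list \<Rightarrow> bool" where
  "eqv \<Gamma> \<Delta> P Q \<longleftrightarrow> valid \<Gamma> P \<Delta> \<and> valid \<Gamma> Q \<Delta> \<and> sem \<Gamma> P \<Delta> = sem \<Gamma> Q \<Delta>"

lemma eqv_refl: "valid \<Gamma> P \<Delta> \<Longrightarrow> eqv \<Gamma> \<Delta> P P"
  by (simp add: eqv_def)

lemma eqv_sym: "eqv \<Gamma> \<Delta> P Q \<Longrightarrow> eqv \<Gamma> \<Delta> Q P"
  by (simp add: eqv_def)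

lemma eqv_trans [trans]: "eqv \<Gamma> \<Delta> P Q \<Longrightarrow> eqv \<Gamma> \<Delta> Q R \<Longrightarrow> eqv \<Gamma> \<Delta> P R"
  by (simp add: eqv_def)

lemma eqv_append:
  assumes "eqv \<Gamma> \<Theta> P P'" "eqv \<Theta> \<Delta> Q Q'"
  shows "eqv \<Gamma> \<Delta> (P @ Q) (P' @ Q')"
  using assms by (auto simp: eqv_def valid_append_iff sem_append)

lemma eqv_perm:
  assumes "eqv \<Gamma> \<Delta> P Q" "perm \<Gamma>' \<Gamma>" "perm \<Delta> \<Delta>'"
  shows "eqv \<Gamma>' \<Delta>' P Q"
proof -
  have v: "valid \<Gamma>' P \<Delta>" "valid \<Gamma>' Q \<Delta>" using assms by (auto simp: eqv_def intro: valid_perm)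
  then have "valid \<Gamma>' P \<Delta>'" "valid \<Gamma>' Q \<Delta>'" using assms(3) valid_perm_right by blast+
  moreover have "sem \<Gamma>' P \<Delta>' = sem \<Gamma>' Q \<Delta>'"
    using v assms sem_perm sem_perm_right unfolding eqv_def by metis
  ultimately show ?thesis by (simp add: eqv_def)
qed

lemma eqv_Cons: "valid \<Gamma> (i # P) \<Delta> \<Longrightarrow> eqv (step \<Gamma> i) \<Delta> P Q \<Longrightarrow> eqv \<Gamma> \<Delta> (i # P) (i # Q)"
  by (auto simp: eqv_def)

text \<open>This allows a rule to be applied inside a larger program; \<open>W\<close> collects the wires that pass by the
part to be replaced, and by \<open>sem_frame\<close> they are carried along unchanged.\<close>

lemma eqv_context:
  assumes LR: "eqv \<Theta> \<Theta>' L R" and v: "valid \<Gamma> (pre @ L @ post) \<Delta>"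
    and W: "W = without (final \<Gamma> pre) \<Theta>" and sub: "set \<Theta> \<subseteq> set (final \<Gamma> pre)"
    and d: "wires L \<inter> set W = {}" "wires R \<inter> set W = {}"
  shows "eqv \<Gamma> \<Delta> (pre @ L @ post) (pre @ R @ post)"
proof -
  let ?G = "final \<Gamma> pre"
  have pre: "valid \<Gamma> pre ?G" and rest: "valid ?G (L @ post) \<Delta>" using v valid_append by blast+
  have c: "ctx ?G" "ctx \<Theta>" "ctx \<Theta>'" using valid_ctx[OF rest] LR valid_ctx[of \<Theta> L \<Theta>'] by (auto simp: eqv_def)
  then have cW: "ctx W" "set \<Theta> \<inter> set W = {}" by (auto simp: W)
  then have p: "perm ?G (\<Theta> @ W)" using c sub by (auto simp: perm_def ctx_append W)
  have L: "valid (\<Theta> @ W) L (\<Theta>' @ W)" "valid (\<Theta> @ W) R (\<Theta>' @ W)"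
    using LR cW d valid_frame[of \<Theta> L \<Theta>' W] valid_frame[of \<Theta> R \<Theta>' W] by (simp_all add: eqv_def)
  have "eqv (\<Theta> @ W) (\<Theta>' @ W) L R"
    using LR cW d L sem_frame[of \<Theta> L \<Theta>' W] sem_frame[of \<Theta> R \<Theta>' W] by (simp add: eqv_def)
  then have 1: "eqv ?G (\<Theta>' @ W) L R"
    by (rule eqv_perm[OF _ p]) (use valid_ctx[OF L(1)] in simp)
  have "valid ?G L (\<Theta>' @ W)" using 1 by (simp add: eqv_def)
  from valid_append_iff[OF this] rest have "valid (\<Theta>' @ W) post \<Delta>" by blast
  then show ?thesis
    by (intro eqv_append[OF eqv_refl[OF pre]] eqv_append[OF 1] eqv_refl)
qed

lemma valid_single:
  assumes "typed i"
  shows "valid (ins i) [i] (outs i)" "sem (ins i) [i] (outs i) = arr i"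
proof -
  have [simp]: "without (ins i) (ins i) = []" by (auto simp: without_def filter_empty_conv)
  show "valid (ins i) [i] (outs i)" "sem (ins i) [i] (outs i) = arr i"
    using assms by (auto simp: step_def)
qed

lemma eqv_swap:
  assumes v: "valid \<Gamma> (i # j # P) \<Delta>"
    and d: "(set (ins i) \<union> set (outs i)) \<inter> (set (ins j) \<union> set (outs j)) = {}"
  shows "eqv \<Gamma> \<Delta> (i # j # P) (j # i # P)"
proof -
  have t: "typed i" "typed j" using v by auto
  have "set (ins i) \<inter> set (ins j) = {}" "set (outs i) \<inter> set (ins j) = {}"
    "set (outs i) \<inter> set (outs j) = {}" "set (ins i) \<inter> set (outs j) = {}"
    "wires [i] \<inter> set (ins j) = {}" "wires [j] \<inter> set (outs i) = {}"
    "wires [i] \<inter> set (outs j) = {}" "wires [j] \<inter> set (ins i) = {}"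
    using d by auto
  note d' = this
  note 1 = sem_tensor[OF valid_single(1)[OF t(1)] valid_single(1)[OF t(2)] d'(1,2,3,5,6)]
  note 2 = sem_tensor_swap[OF valid_single(1)[OF t(1)] valid_single(1)[OF t(2)] d'(1,4,3,7,8)]
  have e: "eqv (ins i @ ins j) (outs i @ outs j) [i, j] [j, i]"
    using 1 2 by (simp add: eqv_def del: valid.simps sem.simps)
  let ?W = "without \<Gamma> (ins i @ ins j)"
  have "set (ins i) \<subseteq> set \<Gamma>" "set (ins j) \<subseteq> set (step \<Gamma> i)" "set (outs i) \<inter> (set \<Gamma> - set (ins i)) = {}"
    "set (outs j) \<inter> (set (step \<Gamma> i) - set (ins j)) = {}" using v by auto
  then have "set (ins j) \<subseteq> set \<Gamma>" "wires [i, j] \<inter> set ?W = {}" "wires [j, i] \<inter> set ?W = {}"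
    unfolding set_step wires_simps set_without set_append using d by blast+
  then have "eqv \<Gamma> \<Delta> ([] @ [i, j] @ P) ([] @ [j, i] @ P)"
    using e v \<open>set (ins i) \<subseteq> set \<Gamma>\<close>
    by (intro eqv_context[where W = ?W and \<Theta> = "ins i @ ins j"]) simp_all
  then show ?thesis by simp
qed

lemma ctx_map:
  assumes "inj_on r W" "\<And>w. w \<in> W \<Longrightarrow> fst (r w) = fst w" "set \<Gamma> \<subseteq> W"
  shows "ctx (map r \<Gamma>) \<longleftrightarrow> ctx \<Gamma>" "tens (map r \<Gamma>) = tens \<Gamma>"
proof -
  show "ctx (map r \<Gamma>) \<longleftrightarrow> ctx \<Gamma>"
  proof -
    have "fst (r w) = fst w" if "w \<in> set \<Gamma>" for w using assms(2,3) that by blast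
    then show ?thesis using inj_on_subset[OF assms(1,3)] by (simp add: ctx_def distinct_map)
  qed
  show "tens (map r \<Gamma>) = tens \<Gamma>" using assms(2,3) by (induction \<Gamma>) auto
qed

lemma removeAll_map:
  "inj_on r (insert x (set \<Gamma>)) \<Longrightarrow> removeAll (r x) (map r \<Gamma>) = map r (removeAll x \<Gamma>)"
  by (induction \<Gamma>) (auto simp: inj_on_def)

lemma front_map:
  assumes "inj_on r W" "\<And>w. w \<in> W \<Longrightarrow> fst (r w) = fst w" "set \<Gamma> \<subseteq> W" "x \<in> W"
  shows "front (r x) (map r \<Gamma>) = front x \<Gamma>"
  using assms(3)
proof (induction \<Gamma>)
  case (Cons y \<Gamma>)
  have "r x = r y \<longleftrightarrow> x = y" using assms Cons.prems by (auto dest: inj_onD)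
  moreover have "removeAll (r x) (map r \<Gamma>) = map r (removeAll x \<Gamma>)"
    using assms Cons.prems by (intro removeAll_map inj_on_subset[OF assms(1)]) auto
  moreover have "tens (map r (removeAll x \<Gamma>)) = tens (removeAll x \<Gamma>)" "tens (map r \<Gamma>) = tens \<Gamma>"
    using assms Cons.prems by (auto intro!: ctx_map(2))
  ultimately show ?case using Cons assms by auto
qed simp

lemma sigma_map:
  assumes "inj_on r W" "\<And>w. w \<in> W \<Longrightarrow> fst (r w) = fst w" "set \<Gamma> \<subseteq> W" "set \<Delta> \<subseteq> W"
  shows "sigma (map r \<Gamma>) (map r \<Delta>) = sigma \<Gamma> \<Delta>"
  using assms(3,4)
proof (induction \<Delta> arbitrary: \<Gamma>)
  case (Cons x \<Delta>)
  have "removeAll (r x) (map r \<Gamma>) = map r (removeAll x \<Gamma>)"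
    using assms Cons.prems by (intro removeAll_map inj_on_subset[OF assms(1)]) auto
  moreover have "front (r x) (map r \<Gamma>) = front x \<Gamma>"
    using assms(1,2) Cons.prems by (intro front_map) auto
  moreover have "sigma (map r (removeAll x \<Gamma>)) (map r \<Delta>) = sigma (removeAll x \<Gamma>) \<Delta>"
    using Cons.prems by (intro Cons.IH) auto
  ultimately show ?case using assms Cons.prems by simp
qed simp

lemma typed_rename_instr:
  assumes "inj_on r W" "\<And>w. w \<in> W \<Longrightarrow> fst (r w) = fst w" "set (ins i) \<union> set (outs i) \<subseteq> W"
  shows "typed (rename_instr r i) \<longleftrightarrow> typed i" "arr (rename_instr r i) = arr i"
proof -
  show a: "arr (rename_instr r i) = arr i" using assms by (cases i) auto
  show "typed (rename_instr r i) \<longleftrightarrow> typed i"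
    unfolding typed_def a using assms ctx_map[OF assms(1)] by auto
qed

text \<open>Only the objects of the wires enter the denoted morphism.\<close>

lemma rename:
  assumes "inj_on r W" "\<And>w. w \<in> W \<Longrightarrow> fst (r w) = fst w" "set \<Gamma> \<union> wires P \<union> set \<Delta> \<subseteq> W"
  shows "valid \<Gamma> P \<Delta> \<Longrightarrow> valid (map r \<Gamma>) (map (rename_instr r) P) (map r \<Delta>)"
    and "sem (map r \<Gamma>) (map (rename_instr r) P) (map r \<Delta>) = sem \<Gamma> P \<Delta>"
proof -
  have "(valid \<Gamma> P \<Delta> \<longrightarrow> valid (map r \<Gamma>) (map (rename_instr r) P) (map r \<Delta>)) \<and>
      sem (map r \<Gamma>) (map (rename_instr r) P) (map r \<Delta>) = sem \<Gamma> P \<Delta>"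
    using assms(3)
  proof (induction P arbitrary: \<Gamma>)
    case Nil
    then show ?case using assms(1,2) ctx_map[of r W] sigma_map[of r W \<Gamma> \<Delta>]
      by (auto simp: perm_def)
  next
    case (Cons i P)
    have w: "without (map r \<Gamma>) (map r (ins i)) = map r (without \<Gamma> (ins i))"
      using assms(1) Cons.prems by (intro without_map) (auto intro: inj_on_subset)
    then have s: "step (map r \<Gamma>) (rename_instr r i) = map r (step \<Gamma> i)" by (simp add: step_def)
    have IH: "valid (step \<Gamma> i) P \<Delta> \<longrightarrow> valid (map r (step \<Gamma> i)) (map (rename_instr r) P) (map r \<Delta>)"
      "sem (map r (step \<Gamma> i)) (map (rename_instr r) P) (map r \<Delta>) = sem (step \<Gamma> i) P \<Delta>"
      using Cons.IH[of "step \<Gamma> i"] Cons.prems by (auto simp: set_step)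
    have t: "typed (rename_instr r i) \<longleftrightarrow> typed i" "arr (rename_instr r i) = arr i"
      using typed_rename_instr[OF assms(1,2)] Cons.prems by auto
    have c: "ctx (map r \<Gamma>) \<longleftrightarrow> ctx \<Gamma>" "tens (map r (without \<Gamma> (ins i))) = tens (without \<Gamma> (ins i))"
      using ctx_map(1)[OF assms(1,2), of \<Gamma>] ctx_map(2)[OF assms(1,2), of "without \<Gamma> (ins i)"] Cons.prems
      by auto
    have sg: "sigma (map r \<Gamma>) (map r (ins i @ without \<Gamma> (ins i))) = sigma \<Gamma> (ins i @ without \<Gamma> (ins i))"
      using assms(1,2) Cons.prems by (intro sigma_map) auto
    have d: "set (outs i) \<inter> set (without \<Gamma> (ins i)) = {} \<Longrightarrow> r ` set (outs i) \<inter> r ` set (without \<Gamma> (ins i)) = {}"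
      using assms(1) Cons.prems by (subst inj_on_image_Int[symmetric, of r W]) auto
    show ?case
      using IH c sg d t by (auto simp: s w simp del: set_without)
  qed
  then show "valid \<Gamma> P \<Delta> \<Longrightarrow> valid (map r \<Gamma>) (map (rename_instr r) P) (map r \<Delta>)"
    "sem (map r \<Gamma>) (map (rename_instr r) P) (map r \<Delta>) = sem \<Gamma> P \<Delta>" by auto
qed

section \<open>Identity wires\<close>

lemma transpose_map_id: "x \<notin> set \<Gamma> \<Longrightarrow> z \<notin> set \<Gamma> \<Longrightarrow> map (transpose x z) \<Gamma> = \<Gamma>"
  by (induction \<Gamma>) (auto simp: transpose_def)

lemma rename_transpose:
  assumes "fst x = fst z" "valid \<Gamma> P \<Delta>"
  shows "valid (map (transpose x z) \<Gamma>) (map (rename_instr (transpose x z)) P) (map (transpose x z) \<Delta>)"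
    and "sem (map (transpose x z) \<Gamma>) (map (rename_instr (transpose x z)) P) (map (transpose x z) \<Delta>) = sem \<Gamma> P \<Delta>"
proof -
  have inj: "inj_on (transpose x z) UNIV" by (auto simp: transpose_def inj_on_def)
  have f: "fst (transpose x z w) = fst w" for w using assms(1) by (simp add: transpose_def)
  show "valid (map (transpose x z) \<Gamma>) (map (rename_instr (transpose x z)) P) (map (transpose x z) \<Delta>)"
    "sem (map (transpose x z) \<Gamma>) (map (rename_instr (transpose x z)) P) (map (transpose x z) \<Delta>) = sem \<Gamma> P \<Delta>"
    by (rule rename[OF inj f]; simp add: assms(2))+
qed

lemma typed_Wire: "typed (Wire x z) \<longleftrightarrow> fst x \<in> Obj C \<and> fst x = fst z"
proof -
  have "fst x \<in> Obj C \<Longrightarrow> \<I> (fst x) \<in> hom C (fst x) (fst z) \<longleftrightarrow> fst x = fst z"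
    by (simp add: hom_def)
  then show ?thesis by (auto simp: typed_def)
qed

text \<open>An identity wire can be removed by giving its output the name of its input in the rest of the
program. The transposition of the two names is used instead of a substitution because it is
injective on all names; it does not affect the final context if neither name occurs there.\<close>

lemma wire_forward:
  assumes v: "valid \<Gamma> (Wire x z # P) \<Delta>" and "x \<notin> set \<Delta>" "z \<notin> set \<Delta>"
  shows "eqv \<Gamma> \<Delta> (Wire x z # P) (map (rename_instr (transpose x z)) P)"
proof -
  let ?W = "without \<Gamma> [x]" and ?P = "map (rename_instr (transpose x z)) P"
  have x: "x \<in> set \<Gamma>" "ctx \<Gamma>" "fst x = fst z" "fst x \<in> Obj C" "z \<notin> set ?W" "x \<notin> set ?W"
    and v1: "valid (z # ?W) P \<Delta>"
    using v by (auto simp: typed_Wire step_def)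
  have p: "perm \<Gamma> (x # ?W)" using x by (auto simp: perm_def)
  have \<Delta>: "map (transpose x z) \<Delta> = \<Delta>" by (rule transpose_map_id) fact+
  have \<Gamma>: "map (transpose x z) (z # ?W) = x # ?W"
    using transpose_map_id[OF x(6,5)] by (simp add: transpose_def)
  note 1 = rename_transpose[OF x(3) v1, unfolded \<Gamma> \<Delta>]
  have "sem \<Gamma> (Wire x z # P) \<Delta> = sem \<Gamma> ?P \<Delta>"
    using sem_perm[OF 1(1) p] 1(2) x v1 p sigma_arr[OF p] by (simp add: step_def del: set_without sigma.simps)
  then show ?thesis using v valid_perm[OF 1(1) p] by (simp add: eqv_def)
qed

text \<open>If the output of an identity wire belongs to the final context, then it is the program before the
wire that has to be renamed.\<close>

lemma wire_backward:
  assumes v: "valid \<Gamma> (P @ [Wire x z]) \<Theta>" and "x \<notin> set \<Gamma>" "z \<notin> set \<Gamma>"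
  shows "eqv \<Gamma> \<Theta> (P @ [Wire x z]) (map (rename_instr (transpose x z)) P)"
proof -
  define G where "G = final \<Gamma> P"
  let ?W = "without G [x]" and ?P = "map (rename_instr (transpose x z)) P"
  have P: "valid \<Gamma> P G" and w: "valid G [Wire x z] \<Theta>" using v valid_append by (auto simp: G_def)
  have x: "x \<in> set G" "ctx G" "fst x = fst z" "fst x \<in> Obj C" "z \<notin> set ?W" "x \<notin> set ?W"
    and q: "perm (z # ?W) \<Theta>"
    using w by (auto simp: typed_Wire step_def)
  have p: "perm G (x # ?W)" using x by (auto simp: perm_def)
  have P1: "valid \<Gamma> P (x # ?W)" using valid_perm_right[OF P p] .
  have \<Gamma>: "map (transpose x z) \<Gamma> = \<Gamma>" by (rule transpose_map_id) fact+
  have W: "map (transpose x z) (x # ?W) = z # ?W"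
    using transpose_map_id[OF x(6,5)] by (simp add: transpose_def)
  note 1 = rename_transpose[OF x(3) P1, unfolded \<Gamma> W]
  have t: "typed (Wire x z)" using x by (simp add: typed_Wire)
  have wv: "valid (x # ?W) [Wire x z] (z # ?W)" "sem (x # ?W) [Wire x z] (z # ?W) = \<I> (tens (x # ?W))"
    using valid_frame[OF valid_single(1)[OF t], of ?W] sem_frame[OF valid_single(1)[OF t], of ?W]
      valid_single(2)[OF t] x by auto
  have "valid \<Gamma> (P @ [Wire x z]) (z # ?W)" using P1 wv valid_append_iff by blast
  moreover have "sem \<Gamma> (P @ [Wire x z]) (z # ?W) = sem \<Gamma> ?P (z # ?W)"
    using sem_append[OF P1 wv(1)] wv(2) P1 1(2) x by simp
  ultimately have "eqv \<Gamma> (z # ?W) (P @ [Wire x z]) ?P" using 1 by (simp add: eqv_def)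
  then show ?thesis by (rule eqv_perm) (use q v valid_ctx in auto)
qed

text \<open>Removes the identity wires from a program; one that leads directly from the initial to the final
context has no other instruction to be merged with and stays.\<close>

fun contract :: "'a wire list \<Rightarrow> 'a wire list \<Rightarrow> ('a, 'b) instr list \<Rightarrow> ('a, 'b) instr list \<Rightarrow> ('a, 'b) instr list" where
  "contract \<Gamma> \<Delta> pre [] = pre"
| "contract \<Gamma> \<Delta> pre (Op m xs ys # P) = contract \<Gamma> \<Delta> (pre @ [Op m xs ys]) P"
| "contract \<Gamma> \<Delta> pre (Wire x z # P) =
    (if x \<notin> set \<Delta> \<and> z \<notin> set \<Delta> then contract \<Gamma> \<Delta> pre (map (rename_instr (transpose x z)) P)
     else if x \<notin> set \<Gamma> \<and> z \<notin> set \<Gamma> then contract \<Gamma> \<Delta> (map (rename_instr (transpose x z)) pre) P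
     else contract \<Gamma> \<Delta> (pre @ [Wire x z]) P)"

lemma eqv_contract:
  assumes "valid \<Gamma> (pre @ P) \<Delta>"
  shows "eqv \<Gamma> \<Delta> (pre @ P) (contract \<Gamma> \<Delta> pre P)"
  using assms
proof (induction \<Gamma> \<Delta> pre P rule: contract.induct)
  case (3 \<Gamma> \<Delta> pre x z P)
  have v: "valid \<Gamma> pre (final \<Gamma> pre)" "valid (final \<Gamma> pre) (Wire x z # P) \<Delta>" "valid \<Gamma> ((pre @ [Wire x z]) @ P) \<Delta>"
    using "3.prems" valid_append[of \<Gamma> pre "Wire x z # P"] by auto
  consider "x \<notin> set \<Delta> \<and> z \<notin> set \<Delta>" | "\<not> (x \<notin> set \<Delta> \<and> z \<notin> set \<Delta>)" "x \<notin> set \<Gamma> \<and> z \<notin> set \<Gamma>"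
    | "\<not> (x \<notin> set \<Delta> \<and> z \<notin> set \<Delta>)" "\<not> (x \<notin> set \<Gamma> \<and> z \<notin> set \<Gamma>)" by blast
  then show ?case
  proof cases
    case 1
    have e: "eqv \<Gamma> \<Delta> (pre @ Wire x z # P) (pre @ map (rename_instr (transpose x z)) P)"
      using eqv_append[OF eqv_refl[OF v(1)] wire_forward[OF v(2)]] 1 by blast
    then have "valid \<Gamma> (pre @ map (rename_instr (transpose x z)) P) \<Delta>" by (simp add: eqv_def)
    from eqv_trans[OF e "3.IH"(1)[OF 1 this]] 1 show ?thesis by simp
  next
    case 2
    have w: "valid \<Gamma> (pre @ [Wire x z]) (final \<Gamma> (pre @ [Wire x z]))" "valid (final \<Gamma> (pre @ [Wire x z])) P \<Delta>"
      using v(3) valid_append by blast+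
    have "eqv \<Gamma> \<Delta> ((pre @ [Wire x z]) @ P) (map (rename_instr (transpose x z)) pre @ P)"
      by (rule eqv_append[OF wire_backward[OF w(1)] eqv_refl[OF w(2)]]) (use 2 in auto)
    then have e: "eqv \<Gamma> \<Delta> (pre @ Wire x z # P) (map (rename_instr (transpose x z)) pre @ P)" by simp
    then have "valid \<Gamma> (map (rename_instr (transpose x z)) pre @ P) \<Delta>" by (simp add: eqv_def)
    from eqv_trans[OF e "3.IH"(2)[OF 2 this]] 2 show ?thesis by auto
  next
    case 3
    then show ?thesis using "3.IH"(3)[OF 3] "3.prems" by auto
  qed
qed (simp_all add: eqv_refl)

section \<open>Rewriting of programs\<close>

definition indep :: "('a, 'b) instr \<Rightarrow> ('a, 'b) instr \<Rightarrow> bool" where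
  "indep i j \<longleftrightarrow> list_all (\<lambda>w. w \<notin> set (ins j @ outs j)) (ins i @ outs i)"

fun pull_front :: "('a, 'b) instr \<Rightarrow> ('a, 'b) instr list \<Rightarrow> ('a, 'b) instr list option" where
  "pull_front i [] = None"
| "pull_front i (j # Q) = (if i = j then Some Q else if indep i j then map_option (Cons j) (pull_front i Q) else None)"

text \<open>Decides whether \<open>Q\<close> arises from \<open>P\<close> by exchanging adjacent independent instructions.\<close>

fun reorders :: "('a, 'b) instr list \<Rightarrow> ('a, 'b) instr list \<Rightarrow> bool" where
  "reorders [] Q \<longleftrightarrow> Q = []"
| "reorders (i # P) Q \<longleftrightarrow> (case pull_front i Q of None \<Rightarrow> False | Some Q' \<Rightarrow> reorders P Q')"

lemma eqv_pull_front:
  assumes "pull_front i Q = Some Q'" "valid \<Gamma> (i # Q') \<Delta>"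
  shows "eqv \<Gamma> \<Delta> (i # Q') Q"
  using assms
proof (induction Q arbitrary: Q' \<Gamma>)
  case (Cons j Q)
  show ?case
  proof (cases "i = j")
    case True
    then show ?thesis using Cons.prems by (auto intro: eqv_refl)
  next
    case False
    then obtain Q1 where Q1: "pull_front i Q = Some Q1" "Q' = j # Q1" "indep i j"
      using Cons.prems(1) by (auto split: if_splits)
    have 1: "eqv \<Gamma> \<Delta> (i # j # Q1) (j # i # Q1)"
      using Cons.prems(2) Q1 by (intro eqv_swap) (auto simp: indep_def list_all_iff)
    then have "valid \<Gamma> (j # i # Q1) \<Delta>" by (simp add: eqv_def)
    then have "eqv \<Gamma> \<Delta> (j # i # Q1) (j # Q)" by (intro eqv_Cons Cons.IH Q1) auto
    with 1 Q1 show ?thesis using eqv_trans by blast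
  qed
qed simp

lemma eqv_reorders: "reorders P Q \<Longrightarrow> valid \<Gamma> P \<Delta> \<Longrightarrow> eqv \<Gamma> \<Delta> P Q"
proof (induction P arbitrary: Q \<Gamma>)
  case (Cons i P)
  then obtain Q' where Q': "pull_front i Q = Some Q'" "reorders P Q'" by (auto split: option.splits)
  have 1: "eqv \<Gamma> \<Delta> (i # P) (i # Q')" using Cons Q' by (intro eqv_Cons) auto
  then have "eqv \<Gamma> \<Delta> (i # Q') Q" using eqv_pull_front Q' by (simp add: eqv_def)
  with 1 show ?case by (rule eqv_trans)
qed (auto intro: eqv_refl)

text \<open>A rule is stated with wire numbers of its own; \<open>ns\<close> lists the wires of the program that they
stand for.\<close>

fun rename_by :: "nat list \<Rightarrow> 'a wire \<Rightarrow> 'a wire" where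
  "rename_by ns (X, n) = (X, ns ! n)"

text \<open>Collects the instructions that can be executed before the part \<open>L\<close> of a program, and those that
have to wait for it. The result is a guess: \<open>replaces\<close> tests by \<open>reorders\<close> that it is right.\<close>

fun split :: "('a, 'b) instr list \<Rightarrow> ('a, 'b) instr list \<Rightarrow> ('a, 'b) instr list \<Rightarrow> ('a, 'b) instr list
    \<Rightarrow> ('a, 'b) instr list \<Rightarrow> ('a, 'b) instr list \<times> ('a, 'b) instr list" where
  "split L [] pre got post = (pre, post)"
| "split L (i # P) pre got post =
    (if i \<in> set L then split L P pre (i # got) post
     else if list_all (indep i) (got @ post) then split L P (pre @ [i]) got post
     else split L P pre got (post @ [i]))"

definition apart :: "('a, 'b) instr list \<Rightarrow> ('a, 'b) instr list \<Rightarrow> 'a wire list \<Rightarrow> bool" where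
  "apart L R W \<longleftrightarrow> list_all (\<lambda>i. list_all (\<lambda>w. w \<notin> set W) (ins i @ outs i)) (L @ R)"

lemma apartD: "apart L R W \<Longrightarrow> wires L \<inter> set W = {} \<and> wires R \<inter> set W = {}"
  unfolding apart_def list_all_iff wires_def by auto

fun replaces :: "'a wire list \<Rightarrow> 'a wire list \<Rightarrow> 'a wire list \<Rightarrow> ('a, 'b) instr list \<Rightarrow> ('a, 'b) instr list
    \<Rightarrow> ('a, 'b) instr list \<Rightarrow> ('a, 'b) instr list \<Rightarrow> ('a, 'b) instr list \<times> ('a, 'b) instr list \<Rightarrow> bool" where
  "replaces \<Gamma> \<Delta> \<Theta> L R P Q (pre, post) \<longleftrightarrow>
     reorders P (pre @ L @ post) \<and>
     list_all (\<lambda>w. w \<in> set (final \<Gamma> pre)) \<Theta> \<and>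
     apart L R (without (final \<Gamma> pre) \<Theta>) \<and>
     reorders (contract \<Gamma> \<Delta> [] (pre @ R @ post)) Q"

definition rewrites_to :: "'a wire list \<Rightarrow> 'a wire list \<Rightarrow> 'a wire list \<Rightarrow> ('a, 'b) instr list \<Rightarrow> ('a, 'b) instr list
    \<Rightarrow> ('a, 'b) instr list \<Rightarrow> ('a, 'b) instr list \<Rightarrow> bool" where
  "rewrites_to \<Gamma> \<Delta> \<Theta> L R P Q \<longleftrightarrow> replaces \<Gamma> \<Delta> \<Theta> L R P Q (split L P [] [] [])"

text \<open>Injectivity of the renaming on the wires of a rule, in decidable form.\<close>

definition fits :: "nat list \<Rightarrow> 'a wire list \<Rightarrow> ('a, 'b) instr list \<Rightarrow> bool" where
  "fits ns \<Gamma> P \<longleftrightarrow> distinct ns \<and> list_all (\<lambda>w. snd w < length ns) \<Gamma> \<and>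
     list_all (\<lambda>i. list_all (\<lambda>w. snd w < length ns) (ins i @ outs i)) P"

lemma eqv_rename:
  assumes "eqv \<Gamma> \<Delta> L R" "fits ns (\<Gamma> @ \<Delta>) (L @ R)"
  shows "eqv (map (rename_by ns) \<Gamma>) (map (rename_by ns) \<Delta>) (map (rename_instr (rename_by ns)) L) (map (rename_instr (rename_by ns)) R)"
proof -
  let ?W = "{w. snd w < length ns}"
  have inj: "inj_on (rename_by ns) ?W"
    using assms(2) by (auto simp: inj_on_def fits_def nth_eq_iff_index_eq)
  have sub: "set \<Gamma> \<union> wires L \<union> set \<Delta> \<subseteq> ?W" "set \<Gamma> \<union> wires R \<union> set \<Delta> \<subseteq> ?W"
    using assms(2) by (auto simp: fits_def list_all_iff wires_def)
  note rL = rename[OF inj _ sub(1)] and rR = rename[OF inj _ sub(2)]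
  show ?thesis using rL rR assms(1) by (auto simp: eqv_def)
qed

text \<open>All side conditions of a rewriting step are collected in \<open>c\<close>, which is a computation on
concrete lists once the two programs, the rule and the renaming \<open>ns\<close> are given.\<close>

theorem eqv_rewrite:
  assumes LR: "eqv \<Theta> \<Theta>' L R" and v: "valid \<Gamma> P \<Delta>"
    and c: "fits ns (\<Theta> @ \<Theta>') (L @ R) \<and>
      rewrites_to \<Gamma> \<Delta> (map (rename_by ns) \<Theta>) (map (rename_instr (rename_by ns)) L) (map (rename_instr (rename_by ns)) R) P Q"
  shows "eqv \<Gamma> \<Delta> P Q"
proof -
  let ?L = "map (rename_instr (rename_by ns)) L" and ?R = "map (rename_instr (rename_by ns)) R" and ?\<Theta> = "map (rename_by ns) \<Theta>"
  obtain pre post where s: "split ?L P [] [] [] = (pre, post)" by fastforce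
  have c1: "reorders P (pre @ ?L @ post)" "set ?\<Theta> \<subseteq> set (final \<Gamma> pre)"
    "apart ?L ?R (without (final \<Gamma> pre) ?\<Theta>)" "reorders (contract \<Gamma> \<Delta> [] (pre @ ?R @ post)) Q"
    using c by (auto simp: rewrites_to_def s list_all_iff)
  have a: "eqv \<Gamma> \<Delta> P (pre @ ?L @ post)" using c1(1) v by (rule eqv_reorders)
  have b: "eqv \<Gamma> \<Delta> (pre @ ?L @ post) (pre @ ?R @ post)"
    using apartD[OF c1(3)] c1(2) a unfolding eqv_def
    by (intro eqv_context[OF eqv_rename[OF LR conjunct1[OF c]] _ refl, unfolded eqv_def]) simp_all
  have e: "eqv \<Gamma> \<Delta> (pre @ ?R @ post) (contract \<Gamma> \<Delta> [] (pre @ ?R @ post))"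
    using eqv_contract[of \<Gamma> "[]" "pre @ ?R @ post" \<Delta>] b by (simp add: eqv_def)
  have "eqv \<Gamma> \<Delta> (contract \<Gamma> \<Delta> [] (pre @ ?R @ post)) Q"
    using c1(4) e by (intro eqv_reorders) (auto simp: eqv_def)
  then show ?thesis using a b e eqv_trans by blast
qed

section \<open>Programs for composite morphisms\<close>

definition repr :: "'b \<Rightarrow> 'a wire list \<Rightarrow> ('a, 'b) instr list \<Rightarrow> 'a wire list \<Rightarrow> bool" where
  "repr e \<Gamma> P \<Delta> \<longleftrightarrow> valid \<Gamma> P \<Delta> \<and> sem \<Gamma> P \<Delta> = e"

definition created :: "('a, 'b) instr list \<Rightarrow> 'a wire list" where
  "created P = concat (map outs P)"

text \<open>The hypothesis on \<open>created\<close> says that no wire name is used twice. It is inherited by the parts of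
a composition or of a tensor product, so it needs to be checked only once for a whole expression.\<close>

definition compiled :: "'b \<Rightarrow> 'a wire list \<Rightarrow> ('a, 'b) instr list \<Rightarrow> 'a wire list \<Rightarrow> bool" where
  "compiled e \<Gamma> P \<Delta> \<longleftrightarrow> wires P \<subseteq> set \<Gamma> \<union> set (created P) \<and> set \<Delta> \<subseteq> set \<Gamma> \<union> set (created P) \<and>
     (ctx \<Gamma> \<and> distinct (\<Gamma> @ created P) \<longrightarrow> repr e \<Gamma> P \<Delta>)"

text \<open>A form of \<open>compiled\<close> that is suited to resolution: the expression \<open>e\<close> consumes an initial segment
of the context and of the program, and the primed arguments are what is left. Applying the
introduction rules below to a concrete program retraces the structure of \<open>e\<close>.\<close>

definition compiles :: "'b \<Rightarrow> 'a wire list \<Rightarrow> 'a wire list \<Rightarrow> ('a, 'b) instr list \<Rightarrow> ('a, 'b) instr list \<Rightarrow>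
    'a wire list \<Rightarrow> 'a wire list \<Rightarrow> bool" where
  "compiles e \<Gamma> \<Gamma>' P P' \<Delta> \<Delta>' \<longleftrightarrow> (\<exists>G p D. \<Gamma> = G @ \<Gamma>' \<and> P = p @ P' \<and> \<Delta> = D @ \<Delta>' \<and> compiled e G p D)"

lemma created_simps [simp]: "created [] = []" "created (i # P) = outs i @ created P"
  "created (P @ Q) = created P @ created Q"
  by (simp_all add: created_def)

lemma compiled_comp:
  assumes "compiled g \<Gamma> P \<Theta>" "compiled f \<Theta> Q \<Delta>"
  shows "compiled (f \<cdot> g) \<Gamma> (P @ Q) \<Delta>"
proof -
  have "repr (f \<cdot> g) \<Gamma> (P @ Q) \<Delta>" if c: "ctx \<Gamma>" "distinct (\<Gamma> @ created (P @ Q))"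
  proof -
    have g: "valid \<Gamma> P \<Theta>" "sem \<Gamma> P \<Theta> = g" using assms(1) c by (auto simp: compiled_def repr_def)
    then have \<Theta>: "ctx \<Theta>" using valid_ctx by blast
    then have "distinct (\<Theta> @ created Q)" using assms(1) c by (auto simp: compiled_def ctx_def)
    then have "valid \<Theta> Q \<Delta>" "sem \<Theta> Q \<Delta> = f" using assms(2) \<Theta> by (auto simp: compiled_def repr_def)
    with g show ?thesis by (auto simp: repr_def valid_append_iff sem_append)
  qed
  then show ?thesis using assms by (auto simp: compiled_def)
qed

lemma compiled_tensor:
  assumes "compiled f \<Gamma> P \<Delta>" "compiled g \<Gamma>' P' \<Delta>'"
  shows "compiled (f \<otimes> g) (\<Gamma> @ \<Gamma>') (P @ P') (\<Delta> @ \<Delta>')"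
proof -
  have "repr (f \<otimes> g) (\<Gamma> @ \<Gamma>') (P @ P') (\<Delta> @ \<Delta>')"
    if c: "ctx (\<Gamma> @ \<Gamma>')" "distinct ((\<Gamma> @ \<Gamma>') @ created (P @ P'))"
  proof -
    have 1: "valid \<Gamma> P \<Delta>" "sem \<Gamma> P \<Delta> = f" "valid \<Gamma>' P' \<Delta>'" "sem \<Gamma>' P' \<Delta>' = g"
      using assms c by (auto simp: compiled_def repr_def ctx_append)
    have s: "set \<Delta> \<subseteq> set \<Gamma> \<union> set (created P)" "set \<Delta>' \<subseteq> set \<Gamma>' \<union> set (created P')"
      "wires P \<subseteq> set \<Gamma> \<union> set (created P)" "wires P' \<subseteq> set \<Gamma>' \<union> set (created P')"
      using assms by (auto simp: compiled_def)
    have "set \<Gamma> \<inter> set \<Gamma>' = {}" "set \<Delta> \<inter> set \<Gamma>' = {}" "set \<Delta> \<inter> set \<Delta>' = {}"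
      "wires P \<inter> set \<Gamma>' = {}" "wires P' \<inter> set \<Delta> = {}"
      using s c(2) by (auto; blast)+
    from sem_tensor[OF 1(1,3) this] 1(2,4) show ?thesis by (simp add: repr_def)
  qed
  then show ?thesis using assms by (auto simp: compiled_def)
qed

lemma compiles_comp:
  "compiles g \<Gamma> \<Gamma>' P Q \<Theta> [] \<Longrightarrow> compiles f \<Theta> [] Q R \<Delta> \<Delta>' \<Longrightarrow> compiles (f \<cdot> g) \<Gamma> \<Gamma>' P R \<Delta> \<Delta>'"
  unfolding compiles_def using compiled_comp by fastforce

lemma compiles_tensor:
  "compiles f \<Gamma> \<Gamma>1 P Q \<Delta> \<Delta>1 \<Longrightarrow> compiles g \<Gamma>1 \<Gamma>2 Q R \<Delta>1 \<Delta>2 \<Longrightarrow> compiles (f \<otimes> g) \<Gamma> \<Gamma>2 P R \<Delta> \<Delta>2"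
  unfolding compiles_def using compiled_tensor by fastforce

lemma compiles_op:
  assumes "typed (Op m xs ys)"
  shows "compiles m (xs @ \<Gamma>) \<Gamma> (Op m xs ys # P) P (ys @ \<Delta>) \<Delta>"
proof -
  have "compiled m xs [Op m xs ys] ys"
    using valid_single[OF assms] by (auto simp: compiled_def repr_def)
  then show ?thesis unfolding compiles_def by fastforce
qed

lemmas compiles_ops = compiles_op[where xs = "[]" and ys = "[y]" for y, simplified append.simps]
  compiles_op[where xs = "[x]" and ys = "[]" for x, simplified append.simps]
  compiles_op[where xs = "[x]" and ys = "[y]" for x y, simplified append.simps]
  compiles_op[where xs = "[x, x']" and ys = "[y]" for x x' y, simplified append.simps]
  compiles_op[where xs = "[x]" and ys = "[y, y']" for x y y', simplified append.simps]

lemma compiles_ident: "X \<in> Obj C \<Longrightarrow> compiles (\<I> X) ((X, n) # \<Gamma>) \<Gamma> P P ((X, n) # \<Delta>) \<Delta>"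
  unfolding compiles_def
  by (intro exI[of _ "[(X, n)]"] exI[of _ "[]"]) (auto simp: compiled_def repr_def)

lemma compiles_symmetry:
  assumes "X \<in> Obj C" "Y \<in> Obj C"
  shows "compiles (\<c> X Y) ((X, m) # (Y, n) # \<Gamma>) \<Gamma> P P ((Y, n) # (X, m) # \<Delta>) \<Delta>"
proof -
  have "compiled (\<c> X Y) [(X, m), (Y, n)] [] [(Y, n), (X, m)]"
    using assms sigma_block[of "[(X, m)]" "[(Y, n)]"]
    by (auto simp: compiled_def repr_def perm_def ctx_append)
  then show ?thesis unfolding compiles_def by fastforce
qed

lemma repr_compiles:
  assumes "compiles e \<Gamma> [] P [] \<Delta> []" "ctx \<Gamma>" "distinct (\<Gamma> @ created P)"
  shows "repr e \<Gamma> P \<Delta>"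
  using assms by (auto simp: compiles_def compiled_def)

lemma eqv_repr:
  assumes "repr e \<Gamma> P \<Delta>" "repr e' \<Gamma> Q \<Delta>" "e = e'"
  shows "eqv \<Gamma> \<Delta> P Q"
  using assms by (simp add: repr_def eqv_def)

lemma repr_eqv:
  assumes "repr e \<Gamma> P \<Delta>" "repr e' \<Gamma> Q \<Delta>" "eqv \<Gamma> \<Delta> P Q"
  shows "e = e'"
  using assms by (simp add: repr_def eqv_def)

lemma without_check:
  "without [] xs = []"
  "without (w # \<Gamma>) xs = (if w \<in> set xs then without \<Gamma> xs else w # without \<Gamma> xs)"
  by (simp_all add: without_def)

lemma perm_check:
  "perm \<Gamma> \<Delta> \<longleftrightarrow> ctx \<Gamma> \<and> ctx \<Delta> \<and> list_all (\<lambda>w. w \<in> set \<Delta>) \<Gamma> \<and> list_all (\<lambda>w. w \<in> set \<Gamma>) \<Delta>"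
  by (auto simp: perm_def list_all_iff)

lemma valid_check:
  "valid \<Gamma> [] \<Delta> \<longleftrightarrow> perm \<Gamma> \<Delta>"
  "valid \<Gamma> (i # P) \<Delta> \<longleftrightarrow> ctx \<Gamma> \<and> typed i \<and> list_all (\<lambda>w. w \<in> set \<Gamma>) (ins i) \<and>
     list_all (\<lambda>w. w \<notin> set (without \<Gamma> (ins i))) (outs i) \<and> valid (step \<Gamma> i) P \<Delta>"
  by (auto simp: list_all_iff)

lemma typed_Op: "typed (Op m xs ys) \<longleftrightarrow> ctx xs \<and> ctx ys \<and> m \<in> hom C (tens xs) (tens ys)"
  by (simp add: typed_def)

lemma compiles_wire:
  assumes "X \<in> Obj C"
  shows "compiles (\<I> X) ((X, m) # \<Gamma>) \<Gamma> (Wire (X, m) (X, n) # P) P ((X, n) # \<Delta>) \<Delta>"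
proof -
  have "compiled (\<I> X) [(X, m)] [Wire (X, m) (X, n)] [(X, n)]"
    using valid_single[of "Wire (X, m) (X, n)"] assms by (auto simp: compiled_def repr_def typed_Wire)
  then show ?thesis unfolding compiles_def by fastforce
qed

lemmas compiles_intros = compiles_ops compiles_ident compiles_wire compiles_symmetry compiles_comp compiles_tensor

lemma eqv_of_eq:
  assumes "e = e'" "compiles e \<Gamma> [] P [] \<Delta> []" "compiles e' \<Gamma> [] Q [] \<Delta> []"
    "ctx \<Gamma> \<and> distinct (\<Gamma> @ created P) \<and> distinct (\<Gamma> @ created Q)"
  shows "eqv \<Gamma> \<Delta> P Q"
  using eqv_repr[OF repr_compiles[OF assms(2)] repr_compiles[OF assms(3)] assms(1)] assms(4) by blast

lemma eq_of_eqv: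
  assumes "eqv \<Gamma> \<Delta> P Q" "compiles e \<Gamma> [] P [] \<Delta> []" "compiles e' \<Gamma> [] Q [] \<Delta> []"
    "ctx \<Gamma> \<and> distinct (\<Gamma> @ created P) \<and> distinct (\<Gamma> @ created Q)"
  shows "e = e'"
  using repr_eqv[OF repr_compiles[OF assms(2)] repr_compiles[OF assms(3)] assms(1)] assms(4) by blast

text \<open>The equations by which the simplifier evaluates the side conditions of \<open>eqv_rewrite\<close>.\<close>

lemmas diagram_simps = fits_def rewrites_to_def apart_def indep_def without_check step_def perm_check typed_Op typed_Wire
  valid_check transpose_def

end

section \<open>Weak Hopf algebras\<close>

locale weak_hopf_diagrams =
  strict_symmetric_monoidal_category C + H: weak_hopf_algebra C H
  for C :: "('o, 'm, 'x) smc_scheme" (structure) and H :: "('o, 'm, 'y) weak_hopf_scheme"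
begin

text \<open>The wires \<open>h n\<close> carry \<open>H\<close>. The instructions are named after their operation (\<open>m\<close> multiplication,
\<open>u\<close> unit, \<open>d\<close> comultiplication, \<open>e\<close> counit, \<open>S\<close> antipode, \<open>PL\<close> and \<open>PR\<close> the projections \<open>\<Pi>\<^sup>L\<close>
and \<open>\<Pi>\<^sup>R\<close>), followed by the numbers of the input wires and of the output wires.\<close>

abbreviation "h n \<equiv> (obj H, n)"
abbreviation "mH x y z \<equiv> Op \<mu>\<^bsub>H\<^esub> [h x, h y] [h z]"
abbreviation "uH x \<equiv> Op \<eta>\<^bsub>H\<^esub> [] [h x]"
abbreviation "dH x y z \<equiv> Op \<delta>\<^bsub>H\<^esub> [h x] [h y, h z]"
abbreviation "eH x \<equiv> Op \<epsilon>\<^bsub>H\<^esub> [h x] []"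
abbreviation "S x y \<equiv> Op (antipode H) [h x] [h y]"
abbreviation "PL x y \<equiv> Op (Pi_L C H) [h x] [h y]"
abbreviation "PR x y \<equiv> Op (Pi_R C H) [h x] [h y]"

lemma H_obj [simp]: "obj H \<in> Obj C"
  using H.algebra by (simp add: is_algebra_def)

lemma H_homs [simp]:
  "\<eta>\<^bsub>H\<^esub> \<in> hom C \<K> (obj H)" "\<mu>\<^bsub>H\<^esub> \<in> hom C (obj H \<odot> obj H) (obj H)"
  "\<epsilon>\<^bsub>H\<^esub> \<in> hom C (obj H) \<K>" "\<delta>\<^bsub>H\<^esub> \<in> hom C (obj H) (obj H \<odot> obj H)"
  "antipode H \<in> hom C (obj H) (obj H)"
  using H.algebra H.coalgebra H.antipode_closed by (simp_all add: is_algebra_def is_coalgebra_def)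

lemma H_arrs [simp]:
  "\<eta>\<^bsub>H\<^esub> \<in> Arr C" "src C \<eta>\<^bsub>H\<^esub> = \<K>" "tgt C \<eta>\<^bsub>H\<^esub> = obj H"
  "\<mu>\<^bsub>H\<^esub> \<in> Arr C" "src C \<mu>\<^bsub>H\<^esub> = obj H \<odot> obj H" "tgt C \<mu>\<^bsub>H\<^esub> = obj H"
  "\<epsilon>\<^bsub>H\<^esub> \<in> Arr C" "src C \<epsilon>\<^bsub>H\<^esub> = obj H" "tgt C \<epsilon>\<^bsub>H\<^esub> = \<K>"
  "\<delta>\<^bsub>H\<^esub> \<in> Arr C" "src C \<delta>\<^bsub>H\<^esub> = obj H" "tgt C \<delta>\<^bsub>H\<^esub> = obj H \<odot> obj H"
  "antipode H \<in> Arr C" "src C (antipode H) = obj H" "tgt C (antipode H) = obj H"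
  using H_homs by (simp_all add: hom_def)

lemma Pi_homs [simp]: "Pi_L C H \<in> hom C (obj H) (obj H)" "Pi_R C H \<in> hom C (obj H) (obj H)"
  by (simp_all add: Pi_L_def Pi_R_def hom_def)

lemmas H_alg = H.algebra[unfolded is_algebra_def, THEN conjunct2, THEN conjunct2, THEN conjunct2]
lemmas H_coalg = H.coalgebra[unfolded is_coalgebra_def, THEN conjunct2, THEN conjunct2, THEN conjunct2]

text \<open>The axioms as rules. An instruction for a defined morphism, such as \<open>PL\<close>, is a single box that
its rule unfolds.\<close>

lemma assocH: "eqv [h 0, h 1, h 2] [h 4] [mH 0 1 3, mH 3 2 4] [mH 1 2 3, mH 0 3 4]"
  by (rule eqv_of_eq[OF H_alg[THEN conjunct1]]; (rule compiles_intros | simp add: diagram_simps; fail)+)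

lemma unitHL: "eqv [h 0] [h 2] [uH 1, mH 1 0 2] [Wire (h 0) (h 2)]"
  by (rule eqv_of_eq[OF H_alg[THEN conjunct2, THEN conjunct1]]; (rule compiles_intros | simp add: diagram_simps; fail)+)

lemma unitHR: "eqv [h 0] [h 2] [uH 1, mH 0 1 2] [Wire (h 0) (h 2)]"
  by (rule eqv_of_eq[OF H_alg[THEN conjunct2, THEN conjunct2]]; (rule compiles_intros | simp add: diagram_simps; fail)+)

lemma coassocH: "eqv [h 0] [h 2, h 3, h 4] [dH 0 1 4, dH 1 2 3] [dH 0 2 1, dH 1 3 4]"
  by (rule eqv_of_eq[OF H_coalg[THEN conjunct1]]; (rule compiles_intros | simp add: diagram_simps; fail)+)

lemma counitHR: "eqv [h 0] [h 2] [dH 0 2 1, eH 1] [Wire (h 0) (h 2)]"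
  by (rule eqv_of_eq[OF H_coalg[THEN conjunct2, THEN conjunct2]]; (rule compiles_intros | simp add: diagram_simps; fail)+)

lemma comult_mult: "eqv [h 0, h 1] [h 6, h 7] [mH 0 1 2, dH 2 6 7] [dH 0 2 3, dH 1 4 5, mH 2 4 6, mH 3 5 7]"
  by (rule eqv_of_eq[OF H.comult_mult[unfolded tensor_comult_def]]; (rule compiles_intros | simp add: diagram_simps; fail)+)

lemma counit_mult1: "eqv [h 0, h 1, h 2] [] [mH 0 1 3, mH 3 2 4, eH 4] [dH 1 3 4, mH 0 3 5, mH 4 2 6, eH 5, eH 6]"
  by (rule eqv_of_eq[OF H.counit_mult_1]; (rule compiles_intros | simp add: diagram_simps; fail)+)

lemma counit_mult2: "eqv [h 0, h 1, h 2] [] [mH 0 1 3, mH 3 2 4, eH 4] [dH 1 3 4, mH 0 4 5, mH 3 2 6, eH 5, eH 6]"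
  by (rule eqv_of_eq[OF H.counit_mult_2]; (rule compiles_intros | simp add: diagram_simps; fail)+)

lemma comult_unit1: "eqv [] [h 0, h 1, h 2] [uH 3, dH 3 4 2, dH 4 0 1] [uH 3, uH 4, dH 3 0 5, dH 4 6 2, mH 5 6 1]"
  by (rule eqv_of_eq[OF H.comult_unit_1]; (rule compiles_intros | simp add: diagram_simps; fail)+)

lemma comult_unit2: "eqv [] [h 0, h 1, h 2] [uH 3, dH 3 4 2, dH 4 0 1] [uH 3, uH 4, dH 3 0 5, dH 4 6 2, mH 6 5 1]"
  by (rule eqv_of_eq[OF H.comult_unit_2]; (rule compiles_intros | simp add: diagram_simps; fail)+)

lemma PL_unfold: "eqv [h 0] [h 1] [PL 0 1] [uH 2, dH 2 3 1, mH 3 0 4, eH 4]"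
  by (rule eqv_of_eq[OF Pi_L_def]; (rule compiles_intros | simp add: diagram_simps; fail)+)

lemma PR_unfold: "eqv [h 0] [h 1] [PR 0 1] [uH 2, dH 2 1 3, mH 0 3 4, eH 4]"
  by (rule eqv_of_eq[OF Pi_R_def]; (rule compiles_intros | simp add: diagram_simps; fail)+)

lemma id_S: "eqv [h 0] [h 4] [dH 0 1 2, S 2 3, mH 1 3 4] [PL 0 4]"
  by (rule eqv_of_eq[OF H.antipode_right[unfolded convolution_def]]; (rule compiles_intros | simp add: diagram_simps; fail)+)

lemma S_id: "eqv [h 0] [h 4] [dH 0 1 2, S 1 3, mH 3 2 4] [PR 0 4]"
  by (rule eqv_of_eq[OF H.antipode_left[unfolded convolution_def]]; (rule compiles_intros | simp add: diagram_simps; fail)+)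

lemma S_regular: "eqv [h 0] [h 8] [dH 0 1 2, dH 1 3 4, S 3 5, mH 5 4 6, S 2 7, mH 6 7 8] [S 0 8]"
  by (rule eqv_of_eq[OF H.antipode_regular[unfolded convolution_def]]; (rule compiles_intros | simp add: diagram_simps; fail)+)

text \<open>Weak multiplicativity of the counit splits \<open>\<epsilon>(1\<^sub>1 x y)\<close> as \<open>\<epsilon>(1\<^sub>1 x\<^sub>1) \<epsilon>(x\<^sub>2 y)\<close>, hence
\<open>\<Pi>\<^sup>L(x y) = \<Pi>\<^sup>L(x\<^sub>1) \<epsilon>(x\<^sub>2 y)\<close>.\<close>

lemma PL_mult:
  "eqv [h 0, h 1] [h 3]
    [mH 0 1 2, PL 2 3]
    [dH 0 2 6, mH 6 1 8, eH 8, PL 2 3]"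
proof -
  let ?E = "eqv [h 0, h 1] [h 3]"
  have "?E
    [mH 0 1 2, PL 2 3]
    [mH 0 1 2, uH 4, dH 4 5 3, mH 5 2 6, eH 6]"
    by (rule eqv_rewrite[OF PL_unfold, where ns = "[2, 3, 4, 5, 6]"]) (simp_all add: diagram_simps)
  also have "?E \<dots>
    [uH 4, dH 4 5 3, mH 5 0 2, mH 2 1 6, eH 6]"
    by (rule eqv_rewrite[OF eqv_sym[OF assocH], where ns = "[5, 0, 1, 2, 6]"]) (simp_all add: diagram_simps)
  also have "?E \<dots>
    [uH 4, dH 4 5 3, dH 0 2 6, mH 5 2 7, mH 6 1 8, eH 7, eH 8]"
    by (rule eqv_rewrite[OF counit_mult1, where ns = "[5, 0, 1, 2, 6, 7, 8]"]) (simp_all add: diagram_simps)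
  also have "?E \<dots>
    [dH 0 2 6, mH 6 1 8, eH 8, PL 2 3]"
    by (rule eqv_rewrite[OF eqv_sym[OF PL_unfold], where ns = "[2, 3, 4, 5, 7]"]) (simp_all add: diagram_simps)
  finally show ?thesis .
qed

text \<open>The value \<open>\<Pi>\<^sup>L(x)\<close> is a right leg of \<open>\<delta>(1)\<close>, so the axiom for the iterated comultiplication of the
unit applies: \<open>\<delta>(\<Pi>\<^sup>L(x)) = \<Pi>\<^sup>L(x) 1\<^sub>1 \<otimes> 1\<^sub>2\<close>. The other form of the axiom yields
\<open>1\<^sub>1 \<Pi>\<^sup>L(x) \<otimes> 1\<^sub>2\<close> in the next lemma.\<close>

lemma comult_PL_right:
  "eqv [h 0] [h 2, h 3]
    [PL 0 1, dH 1 2 3]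
    [uH 1, dH 1 8 3, PL 0 7, mH 7 8 2]"
proof -
  let ?E = "eqv [h 0] [h 2, h 3]"
  have "?E
    [PL 0 1, dH 1 2 3]
    [uH 4, dH 4 5 1, mH 5 0 6, eH 6, dH 1 2 3]"
    by (rule eqv_rewrite[OF PL_unfold, where ns = "[0, 1, 4, 5, 6]"]) (simp_all add: diagram_simps)
  also have "?E \<dots>
    [uH 4, dH 4 1 3, dH 1 5 2, mH 5 0 6, eH 6]"
    by (rule eqv_rewrite[OF eqv_sym[OF coassocH], where ns = "[4, 1, 5, 2, 3]"]) (simp_all add: diagram_simps)
  also have "?E \<dots>
    [uH 4, uH 1, dH 4 5 7, dH 1 8 3, mH 7 8 2, mH 5 0 6, eH 6]"
    by (rule eqv_rewrite[OF comult_unit1, where ns = "[5, 2, 3, 4, 1, 7, 8]"]) (simp_all add: diagram_simps)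
  also have "?E \<dots>
    [uH 1, dH 1 8 3, PL 0 7, mH 7 8 2]"
    by (rule eqv_rewrite[OF eqv_sym[OF PL_unfold], where ns = "[0, 7, 4, 5, 6]"]) (simp_all add: diagram_simps)
  finally show ?thesis .
qed

lemma comult_PL_left:
  "eqv [h 0] [h 2, h 3]
    [PL 0 1, dH 1 2 3]
    [uH 1, dH 1 8 3, PL 0 7, mH 8 7 2]"
proof -
  let ?E = "eqv [h 0] [h 2, h 3]"
  have "?E
    [PL 0 1, dH 1 2 3]
    [uH 4, dH 4 5 1, mH 5 0 6, eH 6, dH 1 2 3]"
    by (rule eqv_rewrite[OF PL_unfold, where ns = "[0, 1, 4, 5, 6]"]) (simp_all add: diagram_simps)
  also have "?E \<dots>
    [uH 4, dH 4 1 3, dH 1 5 2, mH 5 0 6, eH 6]"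
    by (rule eqv_rewrite[OF eqv_sym[OF coassocH], where ns = "[4, 1, 5, 2, 3]"]) (simp_all add: diagram_simps)
  also have "?E \<dots>
    [uH 4, uH 1, dH 4 5 7, dH 1 8 3, mH 8 7 2, mH 5 0 6, eH 6]"
    by (rule eqv_rewrite[OF comult_unit2, where ns = "[5, 2, 3, 4, 1, 7, 8]"]) (simp_all add: diagram_simps)
  also have "?E \<dots>
    [uH 1, dH 1 8 3, PL 0 7, mH 8 7 2]"
    by (rule eqv_rewrite[OF eqv_sym[OF PL_unfold], where ns = "[0, 7, 4, 5, 6]"]) (simp_all add: diagram_simps)
  finally show ?thesis .
qed

text \<open>A value of \<open>\<Pi>\<^sup>L\<close> is a right leg and a value of \<open>\<Pi>\<^sup>R\<close> a left leg of \<open>\<delta>(1)\<close>; that such legs commute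
is the agreement of the two forms of the axiom for the iterated comultiplication of the unit.\<close>

lemma PL_PR_commute:
  "eqv [h 0, h 1] [h 4]
    [PL 0 2, PR 1 3, mH 2 3 4]
    [PL 0 2, PR 1 3, mH 3 2 4]"
proof -
  let ?E = "eqv [h 0, h 1] [h 4]"
  have "?E
    [PL 0 2, PR 1 3, mH 2 3 4]
    [PR 1 3, uH 5, dH 5 6 2, mH 6 0 7, eH 7, mH 2 3 4]"
    by (rule eqv_rewrite[OF PL_unfold, where ns = "[0, 2, 5, 6, 7]"]) (simp_all add: diagram_simps)
  also have "?E \<dots>
    [uH 5, dH 5 6 2, mH 6 0 7, eH 7, uH 8, dH 8 3 9, mH 1 9 10, eH 10, mH 2 3 4]"
    by (rule eqv_rewrite[OF PR_unfold, where ns = "[1, 3, 8, 9, 10]"]) (simp_all add: diagram_simps)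
  also have "?E \<dots>
    [uH 5, dH 5 8 9, dH 8 6 4, mH 6 0 7, eH 7, mH 1 9 10, eH 10]"
    by (rule eqv_rewrite[OF eqv_sym[OF comult_unit1], where ns = "[6, 4, 9, 5, 8, 2, 3]"]) (simp_all add: diagram_simps)
  also have "?E \<dots>
    [uH 5, uH 8, dH 5 6 2, dH 8 3 9, mH 3 2 4, mH 6 0 7, eH 7, mH 1 9 10, eH 10]"
    by (rule eqv_rewrite[OF comult_unit2, where ns = "[6, 4, 9, 5, 8, 2, 3]"]) (simp_all add: diagram_simps)
  also have "?E \<dots>
    [uH 8, dH 8 3 9, mH 1 9 10, eH 10, PL 0 2, mH 3 2 4]"
    by (rule eqv_rewrite[OF eqv_sym[OF PL_unfold], where ns = "[0, 2, 5, 6, 7]"]) (simp_all add: diagram_simps)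
  also have "?E \<dots>
    [PL 0 2, PR 1 3, mH 3 2 4]"
    by (rule eqv_rewrite[OF eqv_sym[OF PR_unfold], where ns = "[1, 3, 8, 9, 10]"]) (simp_all add: diagram_simps)
  finally show ?thesis .
qed

text \<open>For \<open>y\<close> in the image of \<open>\<Pi>\<^sup>L\<close>, the legs in \<open>\<delta>(y) = 1\<^sub>1 y \<otimes> 1\<^sub>2\<close> are absorbed by
\<open>\<delta>(x) \<delta>(1) = \<delta>(x)\<close>, so \<open>\<delta>(x y) = x\<^sub>1 y \<otimes> x\<^sub>2\<close>.\<close>

lemma comult_mult_PL:
  "eqv [h 0, h 1] [h 4, h 5]
    [PL 1 2, mH 0 2 3, dH 3 4 5]
    [PL 1 9, dH 0 7 5, mH 7 9 4]"
proof -
  let ?E = "eqv [h 0, h 1] [h 4, h 5]"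
  have "?E
    [PL 1 2, mH 0 2 3, dH 3 4 5]
    [PL 1 2, dH 0 3 6, dH 2 7 8, mH 3 7 4, mH 6 8 5]"
    by (rule eqv_rewrite[OF comult_mult, where ns = "[0, 2, 3, 6, 7, 8, 4, 5]"]) (simp_all add: diagram_simps)
  also have "?E \<dots>
    [dH 0 3 6, uH 2, dH 2 10 8, PL 1 9, mH 10 9 7, mH 3 7 4, mH 6 8 5]"
    by (rule eqv_rewrite[OF comult_PL_left, where ns = "[1, 2, 7, 8, 0, 3, 4, 9, 10]"]) (simp_all add: diagram_simps)
  also have "?E \<dots>
    [dH 0 3 6, uH 2, dH 2 10 8, PL 1 9, mH 6 8 5, mH 3 10 7, mH 7 9 4]"
    by (rule eqv_rewrite[OF eqv_sym[OF assocH], where ns = "[3, 10, 9, 7, 4]"]) (simp_all add: diagram_simps)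
  also have "?E \<dots>
    [uH 2, PL 1 9, mH 0 2 3, dH 3 7 5, mH 7 9 4]"
    by (rule eqv_rewrite[OF eqv_sym[OF comult_mult], where ns = "[0, 2, 3, 6, 10, 8, 7, 5]"]) (simp_all add: diagram_simps)
  also have "?E \<dots>
    [PL 1 9, dH 0 7 5, mH 7 9 4]"
    by (rule eqv_rewrite[OF unitHR, where ns = "[0, 2, 3]"]) (simp_all add: diagram_simps)
  finally show ?thesis .
qed

text \<open>The factor \<open>\<Pi>\<^sup>L\<close> is \<open>id \<and> \<lambda>\<close>, so this is \<open>\<lambda> \<and> id \<and> \<lambda> = \<lambda>\<close>; likewise for \<open>\<Pi>\<^sup>R = \<lambda> \<and> id\<close> in the next
lemma.\<close>

lemma S_PL:
  "eqv [h 0] [h 5]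
    [dH 0 1 2, S 1 3, PL 2 4, mH 3 4 5]
    [S 0 5]"
proof -
  let ?E = "eqv [h 0] [h 5]"
  have "?E
    [dH 0 1 2, S 1 3, PL 2 4, mH 3 4 5]
    [dH 0 1 2, S 1 3, dH 2 6 7, S 7 8, mH 6 8 4, mH 3 4 5]"
    by (rule eqv_rewrite[OF eqv_sym[OF id_S], where ns = "[2, 6, 7, 8, 4]"]) (simp_all add: diagram_simps)
  also have "?E \<dots>
    [dH 0 1 2, S 1 3, dH 2 6 7, S 7 8, mH 3 6 4, mH 4 8 5]"
    by (rule eqv_rewrite[OF eqv_sym[OF assocH], where ns = "[3, 6, 8, 4, 5]"]) (simp_all add: diagram_simps)
  also have "?E \<dots>
    [dH 0 2 7, dH 2 1 6, S 1 3, S 7 8, mH 3 6 4, mH 4 8 5]"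
    by (rule eqv_rewrite[OF eqv_sym[OF coassocH], where ns = "[0, 2, 1, 6, 7]"]) (simp_all add: diagram_simps)
  also have "?E \<dots>
    [S 0 5]"
    by (rule eqv_rewrite[OF S_regular, where ns = "[0, 2, 7, 1, 6, 3, 4, 8, 5]"]) (simp_all add: diagram_simps)
  finally show ?thesis .
qed

lemma PR_S:
  "eqv [h 0] [h 5]
    [dH 0 1 2, PR 1 3, S 2 4, mH 3 4 5]
    [S 0 5]"
proof -
  let ?E = "eqv [h 0] [h 5]"
  have "?E
    [dH 0 1 2, PR 1 3, S 2 4, mH 3 4 5]
    [dH 0 1 2, S 2 4, dH 1 6 7, S 6 8, mH 8 7 3, mH 3 4 5]"
    by (rule eqv_rewrite[OF eqv_sym[OF S_id], where ns = "[1, 6, 7, 8, 3]"]) (simp_all add: diagram_simps)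
  also have "?E \<dots>
    [S 0 5]"
    by (rule eqv_rewrite[OF S_regular, where ns = "[0, 1, 2, 6, 7, 8, 3, 4, 5]"]) (simp_all add: diagram_simps)
  finally show ?thesis .
qed

text \<open>\<open>\<epsilon>(x \<Pi>\<^sup>L(y)) = \<epsilon>(x 1\<^sub>2) \<epsilon>(1\<^sub>1 y) = \<epsilon>(x 1 y)\<close> by weak multiplicativity of the counit.\<close>

lemma counit_mult_PL:
  "eqv [h 0, h 1] []
    [PL 1 2, mH 0 2 3, eH 3]
    [mH 0 1 2, eH 2]"
proof -
  let ?E = "eqv [h 0, h 1] []"
  have "?E
    [PL 1 2, mH 0 2 3, eH 3]
    [uH 4, dH 4 5 2, mH 5 1 6, eH 6, mH 0 2 3, eH 3]"
    by (rule eqv_rewrite[OF PL_unfold, where ns = "[1, 2, 4, 5, 6]"]) (simp_all add: diagram_simps)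
  also have "?E \<dots>
    [uH 4, mH 0 4 5, mH 5 1 2, eH 2]"
    by (rule eqv_rewrite[OF eqv_sym[OF counit_mult2], where ns = "[0, 4, 1, 5, 2, 3, 6]"]) (simp_all add: diagram_simps)
  also have "?E \<dots>
    [mH 0 1 2, eH 2]"
    by (rule eqv_rewrite[OF unitHR, where ns = "[0, 4, 5]"]) (simp_all add: diagram_simps)
  finally show ?thesis .
qed

text \<open>Writing \<open>\<lambda> = \<Pi>\<^sup>R \<and> \<lambda>\<close>, the factor \<open>w = \<Pi>\<^sup>L(y)\<close> moves past \<open>\<Pi>\<^sup>R(x\<^sub>1) = \<lambda>(x\<^sub>1) x\<^sub>2\<close>; then
\<open>x\<^sub>2 w \<lambda>(x\<^sub>3)\<close> is \<open>\<Pi>\<^sup>L(x\<^sub>2 w)\<close> by \<open>comult_mult_PL\<close>, and splitting this with \<open>PL_mult\<close> leaves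
\<open>\<lambda> \<and> \<Pi>\<^sup>L = \<lambda>\<close>. The result \<open>\<Pi>\<^sup>L(y) \<lambda>(x) = \<lambda>(x\<^sub>1) \<epsilon>(x\<^sub>2 y)\<close> is the part of the antimultiplicativity of
\<open>\<lambda>\<close> on which the proof rests.\<close>

lemma PL_mult_S:
  "eqv [h 0, h 1] [h 4]
    [PL 0 2, S 1 3, mH 2 3 4]
    [dH 1 5 2, mH 2 0 12, eH 12, S 5 4]"
proof -
  let ?E = "eqv [h 0, h 1] [h 4]"
  have "?E
    [PL 0 2, S 1 3, mH 2 3 4]
    [PL 0 2, dH 1 5 6, PR 5 7, S 6 8, mH 7 8 3, mH 2 3 4]"
    by (rule eqv_rewrite[OF eqv_sym[OF PR_S], where ns = "[1, 5, 6, 7, 8, 3]"]) (simp_all add: diagram_simps)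
  also have "?E \<dots>
    [PL 0 2, dH 1 5 6, PR 5 7, S 6 8, mH 2 7 3, mH 3 8 4]"
    by (rule eqv_rewrite[OF eqv_sym[OF assocH], where ns = "[2, 7, 8, 3, 4]"]) (simp_all add: diagram_simps)
  \<comment> \<open>\<open>\<Pi>\<^sup>L(y)\<close> moves to the right of \<open>\<Pi>\<^sup>R(x\<^sub>1)\<close>\<close>
  also have "?E \<dots>
    [dH 1 5 6, S 6 8, PL 0 2, PR 5 7, mH 7 2 3, mH 3 8 4]"
    by (rule eqv_rewrite[OF PL_PR_commute, where ns = "[0, 5, 2, 7, 3]"]) (simp_all add: diagram_simps)
  also have "?E \<dots>
    [dH 1 5 6, S 6 8, PL 0 2, dH 5 9 10, S 9 11, mH 11 10 7, mH 7 2 3, mH 3 8 4]"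
    by (rule eqv_rewrite[OF eqv_sym[OF S_id], where ns = "[5, 9, 10, 11, 7]"]) (simp_all add: diagram_simps)
  also have "?E \<dots>
    [dH 1 5 6, S 6 8, PL 0 2, dH 5 9 10, S 9 11, mH 10 2 7, mH 11 7 3, mH 3 8 4]"
    by (rule eqv_rewrite[OF assocH, where ns = "[11, 10, 2, 7, 3]"]) (simp_all add: diagram_simps)
  also have "?E \<dots>
    [dH 1 5 6, S 6 8, PL 0 2, dH 5 9 10, S 9 11, mH 10 2 7, mH 7 8 3, mH 11 3 4]"
    by (rule eqv_rewrite[OF assocH, where ns = "[11, 7, 8, 3, 4]"]) (simp_all add: diagram_simps)
  also have "?E \<dots>
    [PL 0 2, dH 1 9 5, dH 5 10 6, S 6 8, S 9 11, mH 10 2 7, mH 7 8 3, mH 11 3 4]"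
    by (rule eqv_rewrite[OF coassocH, where ns = "[1, 5, 9, 10, 6]"]) (simp_all add: diagram_simps)
  \<comment> \<open>the legs of \<open>x\<^sub>2 w\<close> replace \<open>x\<^sub>2 w \<otimes> x\<^sub>3\<close>, so that \<open>id \<and> \<lambda>\<close> appears\<close>
  also have "?E \<dots>
    [dH 1 9 5, S 9 11, PL 0 12, mH 5 12 13, dH 13 7 6, S 6 8, mH 7 8 3, mH 11 3 4]"
    by (rule eqv_rewrite[OF eqv_sym[OF comult_mult_PL], where ns = "[5, 0, 12, 13, 7, 6, 1, 10, 3, 2]"]) (simp_all add: diagram_simps)
  also have "?E \<dots>
    [dH 1 9 5, S 9 11, PL 0 12, mH 5 12 13, PL 13 3, mH 11 3 4]"
    by (rule eqv_rewrite[OF id_S, where ns = "[13, 7, 6, 8, 3]"]) (simp_all add: diagram_simps)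
  \<comment> \<open>\<open>\<Pi>\<^sup>L(x\<^sub>2 w)\<close> splits, and \<open>\<lambda> \<and> \<Pi>\<^sup>L\<close> can be collapsed\<close>
  also have "?E \<dots>
    [dH 1 9 5, S 9 11, PL 0 12, dH 5 13 2, mH 2 12 6, eH 6, PL 13 3, mH 11 3 4]"
    by (rule eqv_rewrite[OF PL_mult, where ns = "[5, 12, 13, 3, 0, 1, 2, 4, 6]"]) (simp_all add: diagram_simps)
  also have "?E \<dots>
    [dH 1 9 5, S 9 11, dH 5 13 2, PL 13 3, mH 11 3 4, mH 2 0 12, eH 12]"
    by (rule eqv_rewrite[OF counit_mult_PL, where ns = "[2, 0, 12, 6]"]) (simp_all add: diagram_simps)
  also have "?E \<dots>
    [dH 1 5 2, dH 5 9 13, S 9 11, PL 13 3, mH 11 3 4, mH 2 0 12, eH 12]"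
    by (rule eqv_rewrite[OF eqv_sym[OF coassocH], where ns = "[1, 5, 9, 13, 2]"]) (simp_all add: diagram_simps)
  also have "?E \<dots>
    [dH 1 5 2, mH 2 0 12, eH 12, S 5 4]"
    by (rule eqv_rewrite[OF S_PL, where ns = "[5, 9, 13, 11, 3, 4]"]) (simp_all add: diagram_simps)
  finally show ?thesis .
qed

text \<open>The right leg of \<open>\<delta>(1)\<close> is fixed by \<open>\<Pi>\<^sup>L\<close>: after unfolding, the legs \<open>1\<^sub>1 \<otimes> 1'\<^sub>1 1\<^sub>2 \<otimes> 1'\<^sub>2\<close> form the iterated
comultiplication of the unit, whose middle leg meets a counit.\<close>

lemma unit_PL:
  "eqv [] [h 1, h 3]
    [uH 0, dH 0 1 2, PL 2 3]
    [uH 0, dH 0 1 3]"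
proof -
  let ?E = "eqv [] [h 1, h 3]"
  have "?E
    [uH 0, dH 0 1 2, PL 2 3]
    [uH 0, dH 0 1 2, uH 4, dH 4 5 3, mH 5 2 6, eH 6]"
    by (rule eqv_rewrite[OF PL_unfold, where ns = "[2, 3, 4, 5, 6]"]) (simp_all add: diagram_simps)
  also have "?E \<dots>
    [uH 0, dH 0 4 3, dH 4 1 6, eH 6]"
    by (rule eqv_rewrite[OF eqv_sym[OF comult_unit2], where ns = "[1, 6, 3, 0, 4, 2, 5]"]) (simp_all add: diagram_simps)
  also have "?E \<dots>
    [uH 0, dH 0 1 3]"
    by (rule eqv_rewrite[OF counitHR, where ns = "[4, 6, 1]"]) (simp_all add: diagram_simps)
  finally show ?thesis .
qed

text \<open>Again a counit meets the middle leg of the iterated comultiplication of the unit: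
\<open>1\<^sub>1 \<epsilon>(1\<^sub>2 1'\<^sub>1) \<otimes> 1'\<^sub>2 = 1\<^sub>1 \<otimes> 1\<^sub>2\<close>.\<close>

lemma unit_counit:
  "eqv [] [h 1, h 2]
    [uH 0, uH 4, dH 0 1 5, dH 4 6 2, mH 5 6 7, eH 7]
    [uH 0, dH 0 1 2]"
proof -
  let ?E = "eqv [] [h 1, h 2]"
  have "?E
    [uH 0, uH 4, dH 0 1 5, dH 4 6 2, mH 5 6 7, eH 7]
    [uH 0, dH 0 4 2, dH 4 1 7, eH 7]"
    by (rule eqv_rewrite[OF eqv_sym[OF comult_unit1], where ns = "[1, 7, 2, 0, 4, 5, 6]"]) (simp_all add: diagram_simps)
  also have "?E \<dots>
    [uH 0, dH 0 1 2]"
    by (rule eqv_rewrite[OF counitHR, where ns = "[4, 7, 1]"]) (simp_all add: diagram_simps)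
  finally show ?thesis .
qed

lemma PL_PL:
  "eqv [h 0] [h 2]
    [PL 0 1, PL 1 2]
    [PL 0 2]"
proof -
  let ?E = "eqv [h 0] [h 2]"
  have "?E
    [PL 0 1, PL 1 2]
    [uH 3, dH 3 4 1, mH 4 0 5, eH 5, PL 1 2]"
    by (rule eqv_rewrite[OF PL_unfold, where ns = "[0, 1, 3, 4, 5]"]) (simp_all add: diagram_simps)
  also have "?E \<dots>
    [uH 3, dH 3 4 2, mH 4 0 5, eH 5]"
    by (rule eqv_rewrite[OF unit_PL, where ns = "[3, 4, 1, 2]"]) (simp_all add: diagram_simps)
  also have "?E \<dots>
    [PL 0 2]"
    by (rule eqv_rewrite[OF eqv_sym[OF PL_unfold], where ns = "[0, 2, 3, 4, 5]"]) (simp_all add: diagram_simps)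
  finally show ?thesis .
qed

text \<open>\<open>\<lambda>(1) = \<lambda>(1\<^sub>1) \<Pi>\<^sup>L(1\<^sub>2) = \<lambda>(1\<^sub>1) 1\<^sub>2 = \<Pi>\<^sup>R(1) = 1\<close>.\<close>

lemma S_unit:
  "eqv [] [h 1]
    [uH 0, S 0 1]
    [uH 1]"
proof -
  let ?E = "eqv [] [h 1]"
  have "?E
    [uH 0, S 0 1]
    [uH 0, dH 0 2 3, S 2 4, PL 3 5, mH 4 5 1]"
    by (rule eqv_rewrite[OF eqv_sym[OF S_PL], where ns = "[0, 2, 3, 4, 5, 1]"]) (simp_all add: diagram_simps)
  also have "?E \<dots>
    [uH 0, dH 0 2 5, S 2 4, mH 4 5 1]"
    by (rule eqv_rewrite[OF unit_PL, where ns = "[0, 2, 3, 5]"]) (simp_all add: diagram_simps)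
  also have "?E \<dots>
    [uH 0, PR 0 1]"
    by (rule eqv_rewrite[OF S_id, where ns = "[0, 2, 5, 4, 1]"]) (simp_all add: diagram_simps)
  also have "?E \<dots>
    [uH 0, uH 2, dH 2 1 3, mH 0 3 4, eH 4]"
    by (rule eqv_rewrite[OF PR_unfold, where ns = "[0, 1, 2, 3, 4]"]) (simp_all add: diagram_simps)
  also have "?E \<dots>
    [uH 2, dH 2 1 3, eH 3]"
    by (rule eqv_rewrite[OF unitHL, where ns = "[3, 0, 4]"]) (simp_all add: diagram_simps)
  also have "?E \<dots>
    [uH 1]"
    by (rule eqv_rewrite[OF counitHR, where ns = "[2, 3, 1]"]) (simp_all add: diagram_simps)
  finally show ?thesis .
qed

text \<open>With \<open>1\<^sub>1 \<otimes> 1\<^sub>2 = 1\<^sub>1 \<epsilon>(1\<^sub>2 1'\<^sub>1) \<otimes> 1'\<^sub>2\<close>, lemma \<open>PL_mult_S\<close> turns \<open>\<lambda>(1\<^sub>1) \<otimes> 1\<^sub>2\<close> into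
\<open>\<Pi>\<^sup>L(1'\<^sub>1) \<lambda>(1) \<otimes> 1'\<^sub>2\<close>. In particular the left leg lands in the image of \<open>\<Pi>\<^sup>L\<close>.\<close>

lemma unit_S:
  "eqv [] [h 2, h 3]
    [uH 0, dH 0 1 2, S 1 3]
    [uH 4, dH 4 6 2, PL 6 3]"
proof -
  let ?E = "eqv [] [h 2, h 3]"
  have "?E
    [uH 0, dH 0 1 2, S 1 3]
    [uH 0, uH 4, dH 0 1 5, dH 4 6 2, mH 5 6 7, eH 7, S 1 3]"
    by (rule eqv_rewrite[OF eqv_sym[OF unit_counit], where ns = "[0, 1, 2, 3, 4, 5, 6, 7]"]) (simp_all add: diagram_simps)
  also have "?E \<dots>
    [uH 0, uH 4, dH 4 6 2, PL 6 5, S 0 8, mH 5 8 3]"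
    by (rule eqv_rewrite[OF eqv_sym[OF PL_mult_S], where ns = "[6, 0, 5, 8, 3, 1, 2, 4, 9, 10, 11, 12, 7]"]) (simp_all add: diagram_simps)
  also have "?E \<dots>
    [uH 4, dH 4 6 2, PL 6 5, uH 8, mH 5 8 3]"
    by (rule eqv_rewrite[OF S_unit, where ns = "[0, 8]"]) (simp_all add: diagram_simps)
  also have "?E \<dots>
    [uH 4, dH 4 6 2, PL 6 3]"
    by (rule eqv_rewrite[OF unitHR, where ns = "[5, 8, 3]"]) (simp_all add: diagram_simps)
  finally show ?thesis .
qed

text \<open>For \<open>y\<close> in the image of \<open>\<Pi>\<^sup>L\<close> the products \<open>y 1\<^sub>1\<close> and \<open>1\<^sub>1 y\<close> agree, both being a middle leg of the
iterated comultiplication of the unit; the statement is the shape of this that occurs when \<open>E\<close>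
and \<open>K\<close> are compared on the left leg of \<open>\<delta>(1)\<close>.\<close>

lemma counit_PL_unit:
  "eqv [h 0] [h 1]
    [PL 0 2, uH 3, dH 3 4 1, mH 4 2 5, eH 5]
    [uH 3, dH 3 4 1, PL 0 2, mH 2 4 5, eH 5]"
proof -
  let ?E = "eqv [h 0] [h 1]"
  have "?E
    [PL 0 2, uH 3, dH 3 4 1, mH 4 2 5, eH 5]
    [uH 3, dH 3 4 1, uH 6, dH 6 7 2, mH 7 0 8, eH 8, mH 4 2 5, eH 5]"
    by (rule eqv_rewrite[OF PL_unfold, where ns = "[0, 2, 6, 7, 8]"]) (simp_all add: diagram_simps)
  also have "?E \<dots>
    [uH 6, dH 6 3 1, dH 3 7 5, mH 7 0 8, eH 8, eH 5]"
    by (rule eqv_rewrite[OF eqv_sym[OF comult_unit2], where ns = "[7, 5, 1, 6, 3, 2, 4]"]) (simp_all add: diagram_simps)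
  also have "?E \<dots>
    [uH 6, uH 3, dH 6 7 2, dH 3 4 1, mH 2 4 5, mH 7 0 8, eH 8, eH 5]"
    by (rule eqv_rewrite[OF comult_unit1, where ns = "[7, 5, 1, 6, 3, 2, 4]"]) (simp_all add: diagram_simps)
  also have "?E \<dots>
    [uH 3, dH 3 4 1, PL 0 2, mH 2 4 5, eH 5]"
    by (rule eqv_rewrite[OF eqv_sym[OF PL_unfold], where ns = "[0, 2, 6, 7, 8]"]) (simp_all add: diagram_simps)
  finally show ?thesis .
qed

end

section \<open>Comodule algebras\<close>

locale comodule_algebra_diagrams =
  weak_hopf_diagrams C H + A: right_comodule_algebra C H A
  for C :: "('o, 'm, 'x) smc_scheme" (structure) and H :: "('o, 'm, 'y) weak_hopf_scheme"
    and A :: "('o, 'm, 'z) comodule_algebra_scheme"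
begin

text \<open>The wires \<open>a n\<close> carry \<open>A\<close>; \<open>EA\<close> is the instruction for \<open>e\<^sub>A\<close>.\<close>

abbreviation "a n \<equiv> (obj A, n)"
abbreviation "mA x y z \<equiv> Op \<mu>\<^bsub>A\<^esub> [a x, a y] [a z]"
abbreviation "uA x \<equiv> Op \<eta>\<^bsub>A\<^esub> [] [a x]"
abbreviation "rho x y z \<equiv> Op \<rho>\<^bsub>A\<^esub> [a x] [a y, h z]"
abbreviation "EA x y \<equiv> Op (e_map C H A) [h x] [a y]"

lemma A_obj [simp]: "obj A \<in> Obj C"
  using A.algebra by (simp add: is_algebra_def)

lemma A_homs [simp]:
  "\<eta>\<^bsub>A\<^esub> \<in> hom C \<K> (obj A)" "\<mu>\<^bsub>A\<^esub> \<in> hom C (obj A \<odot> obj A) (obj A)"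
  "\<rho>\<^bsub>A\<^esub> \<in> hom C (obj A) (obj A \<odot> obj H)"
  using A.algebra A.coact_closed by (simp_all add: is_algebra_def)

lemma A_arrs [simp]:
  "\<eta>\<^bsub>A\<^esub> \<in> Arr C" "src C \<eta>\<^bsub>A\<^esub> = \<K>" "tgt C \<eta>\<^bsub>A\<^esub> = obj A"
  "\<mu>\<^bsub>A\<^esub> \<in> Arr C" "src C \<mu>\<^bsub>A\<^esub> = obj A \<odot> obj A" "tgt C \<mu>\<^bsub>A\<^esub> = obj A"
  "\<rho>\<^bsub>A\<^esub> \<in> Arr C" "src C \<rho>\<^bsub>A\<^esub> = obj A" "tgt C \<rho>\<^bsub>A\<^esub> = obj A \<odot> obj H"
  using A_homs by (simp_all add: hom_def)

lemma e_map_hom [simp]: "e_map C H A \<in> hom C (obj H) (obj A)"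
  by (simp add: e_map_def hom_def)

lemmas A_alg = A.algebra[unfolded is_algebra_def, THEN conjunct2, THEN conjunct2, THEN conjunct2]

lemma assocA: "eqv [a 0, a 1, a 2] [a 4] [mA 0 1 3, mA 3 2 4] [mA 1 2 3, mA 0 3 4]"
  by (rule eqv_of_eq[OF A_alg[THEN conjunct1]]; (rule compiles_intros | simp add: diagram_simps; fail)+)

lemma unitAL: "eqv [a 0] [a 2] [uA 1, mA 1 0 2] [Wire (a 0) (a 2)]"
  by (rule eqv_of_eq[OF A_alg[THEN conjunct2, THEN conjunct1]]; (rule compiles_intros | simp add: diagram_simps; fail)+)

lemma unitAR: "eqv [a 0] [a 2] [uA 1, mA 0 1 2] [Wire (a 0) (a 2)]"
  by (rule eqv_of_eq[OF A_alg[THEN conjunct2, THEN conjunct2]]; (rule compiles_intros | simp add: diagram_simps; fail)+)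

lemma rho_counit: "eqv [a 0] [a 1] [rho 0 1 2, eH 2] [Wire (a 0) (a 1)]"
  by (rule eqv_of_eq[OF A.coact_counit]; (rule compiles_intros | simp add: diagram_simps; fail)+)

lemma rho_coassoc: "eqv [a 0] [a 2, h 3, h 4] [rho 0 1 4, rho 1 2 3] [rho 0 2 5, dH 5 3 4]"
  by (rule eqv_of_eq[OF A.coact_coassoc]; (rule compiles_intros | simp add: diagram_simps; fail)+)

lemma rho_mult: "eqv [a 0, a 1] [a 3, h 4] [mA 0 1 2, rho 2 3 4] [rho 0 5 6, rho 1 7 8, mA 5 7 3, mH 6 8 4]"
  by (rule eqv_of_eq[OF A.coact_mult[unfolded tensor_mult_def]]; (rule compiles_intros | simp add: diagram_simps; fail)+)

lemma rho_unit: "eqv [] [a 1, h 3] [uA 0, rho 0 1 2, PL 2 3] [uA 0, rho 0 1 3]"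
  by (rule eqv_of_eq[OF A.coact_unit]; (rule compiles_intros | simp add: diagram_simps; fail)+)

lemma E_unfold: "eqv [h 0] [a 1] [EA 0 1] [uA 2, rho 2 1 3, mH 0 3 4, eH 4]"
  by (rule eqv_of_eq[OF e_map_def]; (rule compiles_intros | simp add: diagram_simps; fail)+)

text \<open>\<open>\<rho>(1) \<rho>(a) = \<rho>(1 a)\<close>.\<close>

lemma rho_unit_left:
  "eqv [a 0] [a 6, h 7]
    [uA 3, rho 3 4 5, rho 0 1 2, mA 4 1 6, mH 5 2 7]
    [rho 0 6 7]"
proof -
  let ?E = "eqv [a 0] [a 6, h 7]"
  have "?E
    [uA 3, rho 3 4 5, rho 0 1 2, mA 4 1 6, mH 5 2 7]
    [uA 3, mA 3 0 8, rho 8 6 7]"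
    by (rule eqv_rewrite[OF eqv_sym[OF rho_mult], where ns = "[3, 0, 8, 6, 7, 4, 5, 1, 2]"]) (simp_all add: diagram_simps)
  also have "?E \<dots>
    [rho 0 6 7]"
    by (rule eqv_rewrite[OF unitAL, where ns = "[0, 3, 8]"]) (simp_all add: diagram_simps)
  finally show ?thesis .
qed

lemma rho_unit_right:
  "eqv [a 0] [a 6, h 7]
    [uA 3, rho 3 4 5, rho 0 1 2, mA 1 4 6, mH 2 5 7]
    [rho 0 6 7]"
proof -
  let ?E = "eqv [a 0] [a 6, h 7]"
  have "?E
    [uA 3, rho 3 4 5, rho 0 1 2, mA 1 4 6, mH 2 5 7]
    [uA 3, mA 0 3 8, rho 8 6 7]"
    by (rule eqv_rewrite[OF eqv_sym[OF rho_mult], where ns = "[0, 3, 8, 6, 7, 1, 2, 4, 5]"]) (simp_all add: diagram_simps)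
  also have "?E \<dots>
    [rho 0 6 7]"
    by (rule eqv_rewrite[OF unitAR, where ns = "[0, 3, 8]"]) (simp_all add: diagram_simps)
  finally show ?thesis .
qed

text \<open>A counit inserted after \<open>u\<^sub>0 a\<close> makes \<open>\<rho>(u\<^sub>0 a)\<close> appear; as \<open>u\<^sub>1\<close> is in the image of \<open>\<Pi>\<^sup>L\<close>, its
comultiplication is \<open>1\<^sub>1 u\<^sub>1 \<otimes> 1\<^sub>2\<close>, and \<open>\<rho>(1) \<rho>(a) = \<rho>(a)\<close> leaves
\<open>a\<^sub>0 \<epsilon>(1\<^sub>1 a\<^sub>1) \<otimes> 1\<^sub>2 = a\<^sub>0 \<otimes> \<Pi>\<^sup>L(a\<^sub>1)\<close>. Through this lemma coinvariance of \<open>a\<close> becomes the formula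
\<open>\<rho>(a) = u\<^sub>0 a \<otimes> u\<^sub>1\<close>.\<close>

lemma rho_PL:
  "eqv [a 0] [a 1, h 3]
    [uA 2, rho 2 4 3, mA 4 0 1]
    [rho 0 1 8, PL 8 3]"
proof -
  let ?E = "eqv [a 0] [a 1, h 3]"
  have "?E
    [uA 2, rho 2 4 3, mA 4 0 1]
    [uA 2, rho 2 4 3, mA 4 0 5, rho 5 1 6, eH 6]"
    by (rule eqv_sym[OF eqv_rewrite[OF rho_counit, where ns = "[5, 1, 6]"]]) (simp_all add: diagram_simps)
  also have "?E \<dots>
    [uA 2, rho 2 4 3, rho 4 7 8, rho 0 9 10, mA 7 9 1, mH 8 10 6, eH 6]"
    by (rule eqv_rewrite[OF rho_mult, where ns = "[4, 0, 5, 1, 6, 7, 8, 9, 10]"]) (simp_all add: diagram_simps)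
  also have "?E \<dots>
    [uA 2, rho 0 9 10, rho 2 7 5, dH 5 8 3, mA 7 9 1, mH 8 10 6, eH 6]"
    by (rule eqv_rewrite[OF rho_coassoc, where ns = "[2, 4, 7, 8, 3, 5]"]) (simp_all add: diagram_simps)
  \<comment> \<open>\<open>u\<^sub>1\<close> may be projected by \<open>\<Pi>\<^sup>L\<close>, which gives access to its comultiplication\<close>
  also have "?E \<dots>
    [rho 0 9 10, uA 2, rho 2 7 4, PL 4 5, dH 5 8 3, mA 7 9 1, mH 8 10 6, eH 6]"
    by (rule eqv_rewrite[OF eqv_sym[OF rho_unit], where ns = "[2, 7, 4, 5]"]) (simp_all add: diagram_simps)
  also have "?E \<dots>
    [rho 0 9 10, uA 2, rho 2 7 4, mA 7 9 1, uH 5, dH 5 12 3, PL 4 11, mH 12 11 8, mH 8 10 6, eH 6]"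
    by (rule eqv_rewrite[OF comult_PL_left, where ns = "[4, 5, 8, 3, 0, 1, 2, 11, 12]"]) (simp_all add: diagram_simps)
  also have "?E \<dots>
    [rho 0 9 10, uH 5, dH 5 12 3, uA 2, rho 2 7 11, mA 7 9 1, mH 12 11 8, mH 8 10 6, eH 6]"
    by (rule eqv_rewrite[OF rho_unit, where ns = "[2, 7, 4, 11]"]) (simp_all add: diagram_simps)
  also have "?E \<dots>
    [rho 0 9 10, uH 5, dH 5 12 3, uA 2, rho 2 7 11, mA 7 9 1, mH 11 10 8, mH 12 8 6, eH 6]"
    by (rule eqv_rewrite[OF assocH, where ns = "[12, 11, 10, 8, 6]"]) (simp_all add: diagram_simps)
  also have "?E \<dots>
    [uH 5, dH 5 12 3, rho 0 1 8, mH 12 8 6, eH 6]"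
    by (rule eqv_rewrite[OF rho_unit_left, where ns = "[0, 9, 10, 2, 7, 11, 1, 8]"]) (simp_all add: diagram_simps)
  also have "?E \<dots>
    [rho 0 1 8, PL 8 3]"
    by (rule eqv_rewrite[OF eqv_sym[OF PL_unfold], where ns = "[8, 3, 5, 12, 6]"]) (simp_all add: diagram_simps)
  finally show ?thesis .
qed

text \<open>The computation of \<open>rho_PL\<close> with \<open>\<rho>(a) \<rho>(1)\<close> in place of \<open>\<rho>(1) \<rho>(a)\<close>, and with the other formula
for \<open>\<delta>(u\<^sub>1)\<close>: \<open>a u\<^sub>0 \<otimes> u\<^sub>1 = a\<^sub>0 \<epsilon>(a\<^sub>1 1\<^sub>1) \<otimes> 1\<^sub>2\<close>.\<close>

lemma mult_rho_unit:
  "eqv [a 0] [a 4, h 3]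
    [uA 1, rho 1 2 3, mA 0 2 4]
    [uH 5, dH 5 12 3, rho 0 4 10, mH 10 12 6, eH 6]"
proof -
  let ?E = "eqv [a 0] [a 4, h 3]"
  have "?E
    [uA 1, rho 1 2 3, mA 0 2 4]
    [uA 1, rho 1 2 3, mA 0 2 5, rho 5 4 6, eH 6]"
    by (rule eqv_sym[OF eqv_rewrite[OF rho_counit, where ns = "[5, 4, 6]"]]) (simp_all add: diagram_simps)
  also have "?E \<dots>
    [uA 1, rho 1 2 3, rho 0 7 8, rho 2 9 10, mA 7 9 4, mH 8 10 6, eH 6]"
    by (rule eqv_rewrite[OF rho_mult, where ns = "[0, 2, 5, 4, 6, 7, 8, 9, 10]"]) (simp_all add: diagram_simps)
  also have "?E \<dots>
    [uA 1, rho 0 7 8, rho 1 9 5, dH 5 10 3, mA 7 9 4, mH 8 10 6, eH 6]"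
    by (rule eqv_rewrite[OF rho_coassoc, where ns = "[1, 2, 9, 10, 3, 5]"]) (simp_all add: diagram_simps)
  \<comment> \<open>\<open>u\<^sub>1\<close> may be projected by \<open>\<Pi>\<^sup>L\<close>, which gives access to its comultiplication\<close>
  also have "?E \<dots>
    [rho 0 7 8, uA 1, rho 1 9 2, PL 2 5, dH 5 10 3, mA 7 9 4, mH 8 10 6, eH 6]"
    by (rule eqv_rewrite[OF eqv_sym[OF rho_unit], where ns = "[1, 9, 2, 5]"]) (simp_all add: diagram_simps)
  also have "?E \<dots>
    [rho 0 7 8, uA 1, rho 1 9 2, mA 7 9 4, uH 5, dH 5 12 3, PL 2 11, mH 11 12 10, mH 8 10 6, eH 6]"
    by (rule eqv_rewrite[OF comult_PL_right, where ns = "[2, 5, 10, 3, 0, 1, 4, 11, 12]"]) (simp_all add: diagram_simps)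
  also have "?E \<dots>
    [rho 0 7 8, uH 5, dH 5 12 3, uA 1, rho 1 9 11, mA 7 9 4, mH 11 12 10, mH 8 10 6, eH 6]"
    by (rule eqv_rewrite[OF rho_unit, where ns = "[1, 9, 2, 11]"]) (simp_all add: diagram_simps)
  also have "?E \<dots>
    [rho 0 7 8, uH 5, dH 5 12 3, uA 1, rho 1 9 11, mA 7 9 4, mH 8 11 10, mH 10 12 6, eH 6]"
    by (rule eqv_rewrite[OF eqv_sym[OF assocH], where ns = "[8, 11, 12, 10, 6]"]) (simp_all add: diagram_simps)
  also have "?E \<dots>
    [uH 5, dH 5 12 3, rho 0 4 10, mH 10 12 6, eH 6]"
    by (rule eqv_rewrite[OF rho_unit_right, where ns = "[0, 7, 8, 1, 9, 11, 4, 10]"]) (simp_all add: diagram_simps)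
  finally show ?thesis .
qed

text \<open>\<open>\<rho>(E(x)) = u\<^sub>0 \<otimes> u\<^sub>1 1\<^sub>1 \<epsilon>(x 1\<^sub>2)\<close> by the formula for \<open>\<delta>(u\<^sub>1)\<close>, and
\<open>1\<^sub>1 \<epsilon>(x 1\<^sub>2) = \<Pi>\<^sup>R(x)\<close>.\<close>

lemma rho_E:
  "eqv [h 0] [a 2, h 3]
    [EA 0 1, rho 1 2 3]
    [uA 4, rho 4 2 8, PR 0 9, mH 8 9 3]"
proof -
  let ?E = "eqv [h 0] [a 2, h 3]"
  have "?E
    [EA 0 1, rho 1 2 3]
    [uA 4, rho 4 1 5, mH 0 5 6, eH 6, rho 1 2 3]"
    by (rule eqv_rewrite[OF E_unfold, where ns = "[0, 1, 4, 5, 6]"]) (simp_all add: diagram_simps)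
  also have "?E \<dots>
    [uA 4, rho 4 2 7, dH 7 3 5, mH 0 5 6, eH 6]"
    by (rule eqv_rewrite[OF rho_coassoc, where ns = "[4, 1, 2, 3, 5, 7]"]) (simp_all add: diagram_simps)
  also have "?E \<dots>
    [uA 4, rho 4 2 1, PL 1 7, dH 7 3 5, mH 0 5 6, eH 6]"
    by (rule eqv_rewrite[OF eqv_sym[OF rho_unit], where ns = "[4, 2, 1, 7]"]) (simp_all add: diagram_simps)
  also have "?E \<dots>
    [uA 4, rho 4 2 1, uH 7, dH 7 9 5, PL 1 8, mH 8 9 3, mH 0 5 6, eH 6]"
    by (rule eqv_rewrite[OF comult_PL_right, where ns = "[1, 7, 3, 5, 0, 2, 4, 8, 9]"]) (simp_all add: diagram_simps)
  also have "?E \<dots>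
    [uH 7, dH 7 9 5, mH 0 5 6, eH 6, uA 4, rho 4 2 8, mH 8 9 3]"
    by (rule eqv_rewrite[OF rho_unit, where ns = "[4, 2, 1, 8]"]) (simp_all add: diagram_simps)
  also have "?E \<dots>
    [uA 4, rho 4 2 8, PR 0 9, mH 8 9 3]"
    by (rule eqv_rewrite[OF eqv_sym[OF PR_unfold], where ns = "[0, 9, 7, 5, 6]"]) (simp_all add: diagram_simps)
  finally show ?thesis .
qed

end

section \<open>Cleft extensions\<close>

text \<open>The factorization of \<open>f \<and> g\<close> through the equalizer of coinvariants is stated as an equation,
which can serve as a rule.\<close>

locale cleft_diagrams =
  comodule_algebra_diagrams C H A
  for C :: "('o, 'm, 'x) smc_scheme" (structure) and H :: "('o, 'm, 'y) weak_hopf_scheme"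
    and A :: "('o, 'm, 'z) comodule_algebra_scheme" +
  fixes f g :: 'm
  assumes integral: "is_integral C H A f"
    and inverse: "is_convolution_inverse C H A f g"
    and coinvariant: "(\<I> (obj A) \<otimes> Pi_L C H) \<cdot> \<rho>\<^bsub>A\<^esub> \<cdot> convolution C \<delta>\<^bsub>H\<^esub> A f g = \<rho>\<^bsub>A\<^esub> \<cdot> convolution C \<delta>\<^bsub>H\<^esub> A f g"
begin

text \<open>\<open>KA\<close> is the instruction for \<open>K = f \<and> g\<close>.\<close>

abbreviation "fA x y \<equiv> Op f [h x] [a y]"
abbreviation "gA x y \<equiv> Op g [h x] [a y]"
abbreviation "KA x y \<equiv> Op (convolution C \<delta>\<^bsub>H\<^esub> A f g) [h x] [a y]"

lemma f_g_homs [simp]: "f \<in> hom C (obj H) (obj A)" "g \<in> hom C (obj H) (obj A)"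
  using integral inverse by (simp_all add: is_integral_def is_convolution_inverse_def)

lemma f_g_arrs [simp]:
  "f \<in> Arr C" "src C f = obj H" "tgt C f = obj A" "g \<in> Arr C" "src C g = obj H" "tgt C g = obj A"
  using f_g_homs by (simp_all add: hom_def)

lemma K_hom [simp]: "convolution C \<delta>\<^bsub>H\<^esub> A f g \<in> hom C (obj H) (obj A)"
  by (simp add: convolution_def hom_def)

lemma inverse_eqs:
  "\<mu>\<^bsub>A\<^esub> \<cdot> (g \<otimes> f) \<cdot> \<delta>\<^bsub>H\<^esub> = e_map C H A"
  "convolution C \<delta>\<^bsub>H\<^esub> A f g = (\<I> (obj A) \<otimes> (\<epsilon>\<^bsub>H\<^esub> \<cdot> \<mu>\<^bsub>H\<^esub>)) \<cdot> ((\<rho>\<^bsub>A\<^esub> \<cdot> \<eta>\<^bsub>A\<^esub>) \<otimes> \<I> (obj H))"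
  "\<mu>\<^bsub>A\<^esub> \<cdot> (e_map C H A \<otimes> g) \<cdot> \<delta>\<^bsub>H\<^esub> = g"
  "\<rho>\<^bsub>A\<^esub> \<cdot> f = (f \<otimes> \<I> (obj H)) \<cdot> \<delta>\<^bsub>H\<^esub>"
  using inverse integral unfolding is_convolution_inverse_def is_integral_def convolution_def by auto

lemma K_convolution: "eqv [h 0] [a 4] [KA 0 4] [dH 0 1 2, fA 1 3, gA 2 5, mA 3 5 4]"
  by (rule eqv_of_eq[OF convolution_def]; (rule compiles_intros | simp add: diagram_simps; fail)+)

lemma K_unfold: "eqv [h 0] [a 1] [KA 0 1] [uA 2, rho 2 1 3, mH 3 0 4, eH 4]"
  by (rule eqv_of_eq[OF inverse_eqs(2)]; (rule compiles_intros | simp add: diagram_simps; fail)+)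

lemma g_f: "eqv [h 0] [a 5] [dH 0 1 2, gA 1 3, fA 2 4, mA 3 4 5] [EA 0 5]"
  by (rule eqv_of_eq[OF inverse_eqs(1)]; (rule compiles_intros | simp add: diagram_simps; fail)+)

lemma E_g: "eqv [h 0] [a 5] [dH 0 1 2, EA 1 3, gA 2 4, mA 3 4 5] [gA 0 5]"
  by (rule eqv_of_eq[OF inverse_eqs(3)]; (rule compiles_intros | simp add: diagram_simps; fail)+)

lemma f_coact: "eqv [h 0] [a 2, h 3] [fA 0 1, rho 1 2 3] [dH 0 4 3, fA 4 2]"
  by (rule eqv_of_eq[OF inverse_eqs(4)]; (rule compiles_intros | simp add: diagram_simps; fail)+)

lemma K_coinvariant: "eqv [h 0] [a 2, h 4] [KA 0 1, rho 1 2 3, PL 3 4] [KA 0 1, rho 1 2 4]"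
  by (rule eqv_of_eq[OF coinvariant]; (rule compiles_intros | simp add: diagram_simps; fail)+)

text \<open>\<open>a K(y) = a u\<^sub>0 \<epsilon>(u\<^sub>1 y) = a\<^sub>0 \<epsilon>(a\<^sub>1 1\<^sub>1) \<epsilon>(1\<^sub>2 y) = a\<^sub>0 \<epsilon>(a\<^sub>1 y)\<close>.\<close>

lemma mult_K:
  "eqv [a 0, h 1] [a 3]
    [KA 1 2, mA 0 2 3]
    [rho 0 3 9, mH 9 1 5, eH 5]"
proof -
  let ?E = "eqv [a 0, h 1] [a 3]"
  have "?E
    [KA 1 2, mA 0 2 3]
    [uA 4, rho 4 2 5, mH 5 1 6, eH 6, mA 0 2 3]"
    by (rule eqv_rewrite[OF K_unfold, where ns = "[1, 2, 4, 5, 6]"]) (simp_all add: diagram_simps)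
  also have "?E \<dots>
    [uH 7, dH 7 10 5, rho 0 3 9, mH 9 10 8, eH 8, mH 5 1 6, eH 6]"
    by (rule eqv_rewrite[OF mult_rho_unit, where ns = "[0, 4, 2, 5, 3, 7, 8, 1, 6, 11, 9, 12, 10]"]) (simp_all add: diagram_simps)
  also have "?E \<dots>
    [uH 7, rho 0 3 9, mH 9 7 10, mH 10 1 5, eH 5]"
    by (rule eqv_rewrite[OF eqv_sym[OF counit_mult1], where ns = "[9, 7, 1, 10, 5, 8, 6]"]) (simp_all add: diagram_simps)
  also have "?E \<dots>
    [rho 0 3 9, mH 9 1 5, eH 5]"
    by (rule eqv_rewrite[OF unitHR, where ns = "[9, 7, 10]"]) (simp_all add: diagram_simps)
  finally show ?thesis .
qed

text \<open>Coinvariance of \<open>K\<close> and \<open>rho_PL\<close> give \<open>\<rho>(K(x)) = u\<^sub>0 f(x\<^sub>1) g(x\<^sub>2) \<otimes> u\<^sub>1\<close>, and \<open>rho_PL\<close> for \<open>f(x\<^sub>1)\<close> turns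
this into \<open>f(x\<^sub>1) g(x\<^sub>3) \<otimes> \<Pi>\<^sup>L(x\<^sub>2)\<close>. So \<open>\<rho> \<circ> K\<close> is the convolution product of \<open>\<rho> \<circ> f\<close> with the
map \<open>x \<mapsto> g(x\<^sub>2) \<otimes> \<lambda>(x\<^sub>1)\<close>.\<close>

lemma rho_K:
  "eqv [h 0] [a 2, h 3]
    [KA 0 1, rho 1 2 3]
    [dH 0 4 7, gA 7 9, dH 4 5 10, fA 5 1, mA 1 9 2, dH 10 6 8, S 8 11, mH 6 11 3]"
proof -
  let ?E = "eqv [h 0] [a 2, h 3]"
  have "?E
    [KA 0 1, rho 1 2 3]
    [KA 0 1, rho 1 2 4, PL 4 3]"
    by (rule eqv_rewrite[OF eqv_sym[OF K_coinvariant], where ns = "[0, 1, 2, 4, 3]"]) (simp_all add: diagram_simps)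
  also have "?E \<dots>
    [KA 0 1, uA 5, rho 5 6 3, mA 6 1 2]"
    by (rule eqv_rewrite[OF eqv_sym[OF rho_PL], where ns = "[1, 2, 5, 3, 6, 0, 7, 8, 4]"]) (simp_all add: diagram_simps)
  also have "?E \<dots>
    [uA 5, rho 5 6 3, dH 0 4 7, fA 4 8, gA 7 9, mA 8 9 1, mA 6 1 2]"
    by (rule eqv_rewrite[OF K_convolution, where ns = "[0, 4, 7, 8, 1, 9]"]) (simp_all add: diagram_simps)
  also have "?E \<dots>
    [uA 5, rho 5 6 3, dH 0 4 7, fA 4 8, gA 7 9, mA 6 8 1, mA 1 9 2]"
    by (rule eqv_rewrite[OF eqv_sym[OF assocA], where ns = "[6, 8, 9, 1, 2]"]) (simp_all add: diagram_simps)
  also have "?E \<dots>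
    [dH 0 4 7, fA 4 8, gA 7 9, rho 8 1 10, PL 10 3, mA 1 9 2]"
    by (rule eqv_rewrite[OF rho_PL, where ns = "[8, 1, 5, 3, 6, 0, 2, 4, 10]"]) (simp_all add: diagram_simps)
  also have "?E \<dots>
    [dH 0 4 7, gA 7 9, dH 4 5 10, fA 5 1, PL 10 3, mA 1 9 2]"
    by (rule eqv_rewrite[OF f_coact, where ns = "[4, 8, 1, 10, 5]"]) (simp_all add: diagram_simps)
  also have "?E \<dots>
    [dH 0 4 7, gA 7 9, dH 4 5 10, fA 5 1, mA 1 9 2, dH 10 6 8, S 8 11, mH 6 11 3]"
    by (rule eqv_rewrite[OF eqv_sym[OF id_S], where ns = "[10, 6, 8, 11, 3]"]) (simp_all add: diagram_simps)
  finally show ?thesis .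
qed

text \<open>\<open>g \<and> f \<and> g = g\<close>, bracketed to the right.\<close>

lemma g_K:
  "eqv [h 0] [a 5]
    [dH 0 1 2, gA 1 3, KA 2 4, mA 3 4 5]
    [gA 0 5]"
proof -
  let ?E = "eqv [h 0] [a 5]"
  have "?E
    [dH 0 1 2, gA 1 3, KA 2 4, mA 3 4 5]
    [dH 0 1 2, gA 1 3, dH 2 6 7, fA 6 8, gA 7 9, mA 8 9 4, mA 3 4 5]"
    by (rule eqv_rewrite[OF K_convolution, where ns = "[2, 6, 7, 8, 4, 9]"]) (simp_all add: diagram_simps)
  also have "?E \<dots>
    [dH 0 1 2, gA 1 3, dH 2 6 7, fA 6 8, gA 7 9, mA 3 8 4, mA 4 9 5]"
    by (rule eqv_rewrite[OF eqv_sym[OF assocA], where ns = "[3, 8, 9, 4, 5]"]) (simp_all add: diagram_simps)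
  also have "?E \<dots>
    [dH 0 2 7, dH 2 1 6, gA 1 3, fA 6 8, gA 7 9, mA 3 8 4, mA 4 9 5]"
    by (rule eqv_rewrite[OF eqv_sym[OF coassocH], where ns = "[0, 2, 1, 6, 7]"]) (simp_all add: diagram_simps)
  also have "?E \<dots>
    [dH 0 2 7, gA 7 9, EA 2 4, mA 4 9 5]"
    by (rule eqv_rewrite[OF g_f, where ns = "[2, 1, 6, 3, 8, 4]"]) (simp_all add: diagram_simps)
  also have "?E \<dots>
    [gA 0 5]"
    by (rule eqv_rewrite[OF E_g, where ns = "[0, 2, 7, 4, 9, 5]"]) (simp_all add: diagram_simps)
  finally show ?thesis .
qed

text \<open>From \<open>g = g \<and> K\<close> and \<open>rho_K\<close>, \<open>\<rho> \<circ> g\<close> is the product of \<open>\<rho> \<circ> (g \<and> f) = \<rho> \<circ> E\<close> with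
\<open>x \<mapsto> g(x\<^sub>2) \<otimes> \<lambda>(x\<^sub>1)\<close>. By \<open>rho_E\<close> this is \<open>u\<^sub>0 g(x\<^sub>3) \<otimes> u\<^sub>1 \<Pi>\<^sup>R(x\<^sub>1) \<lambda>(x\<^sub>2) = u\<^sub>0 g(x\<^sub>2) \<otimes> u\<^sub>1 \<lambda>(x\<^sub>1)\<close>;
moving \<open>u\<^sub>1\<close>, which is in the image of \<open>\<Pi>\<^sup>L\<close>, past \<open>\<lambda>\<close> produces \<open>E\<close> and hence \<open>E \<and> g = g\<close>.\<close>

lemma rho_g:
  "eqv [h 0] [a 2, h 3]
    [gA 0 1, rho 1 2 3]
    [dH 0 7 1, S 7 3, gA 1 2]"
proof -
  let ?E = "eqv [h 0] [a 2, h 3]"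
  have "?E
    [gA 0 1, rho 1 2 3]
    [dH 0 4 5, gA 4 6, KA 5 7, mA 6 7 1, rho 1 2 3]"
    by (rule eqv_rewrite[OF eqv_sym[OF g_K], where ns = "[0, 4, 5, 6, 7, 1]"]) (simp_all add: diagram_simps)
  also have "?E \<dots>
    [dH 0 4 5, gA 4 6, KA 5 7, rho 6 8 9, rho 7 10 11, mA 8 10 2, mH 9 11 3]"
    by (rule eqv_rewrite[OF rho_mult, where ns = "[6, 7, 1, 2, 3, 8, 9, 10, 11]"]) (simp_all add: diagram_simps)
  also have "?E \<dots>
    [dH 0 4 5, gA 4 6, rho 6 8 9, dH 5 1 14, gA 14 16, dH 1 12 17, fA 12 7, mA 7 16 10, dH 17 13 15, S 15 18, mH 13 18 11, mA 8 10 2, mH 9 11 3]"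
    by (rule eqv_rewrite[OF rho_K, where ns = "[5, 7, 10, 11, 1, 12, 13, 14, 15, 16, 17, 18]"]) (simp_all add: diagram_simps)
  also have "?E \<dots>
    [dH 0 4 5, gA 4 6, rho 6 8 9, dH 5 1 14, gA 14 16, dH 1 17 15, dH 17 12 13, fA 12 7, mA 7 16 10, S 15 18, mH 13 18 11, mA 8 10 2, mH 9 11 3]"
    by (rule eqv_rewrite[OF eqv_sym[OF coassocH], where ns = "[1, 17, 12, 13, 15]"]) (simp_all add: diagram_simps)
  \<comment> \<open>regroup the factors so that \<open>\<rho>(g(x\<^sub>1)) \<rho>(f(x\<^sub>2)) = \<rho>(g(x\<^sub>1) f(x\<^sub>2))\<close> can be formed\<close>
  also have "?E \<dots>
    [dH 0 4 5, gA 4 6, rho 6 8 9, dH 5 1 14, gA 14 16, dH 1 17 15, S 15 18, fA 17 19, rho 19 7 13, mA 7 16 10, mH 13 18 11, mA 8 10 2, mH 9 11 3]"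
    by (rule eqv_rewrite[OF eqv_sym[OF f_coact], where ns = "[17, 19, 7, 13, 12]"]) (simp_all add: diagram_simps)
  also have "?E \<dots>
    [dH 0 4 5, gA 4 6, rho 6 8 9, dH 5 1 14, gA 14 16, dH 1 17 15, S 15 18, fA 17 19, rho 19 7 13, mH 13 18 11, mH 9 11 3, mA 8 7 10, mA 10 16 2]"
    by (rule eqv_rewrite[OF eqv_sym[OF assocA], where ns = "[8, 7, 16, 10, 2]"]) (simp_all add: diagram_simps)
  also have "?E \<dots>
    [dH 0 4 5, gA 4 6, rho 6 8 9, dH 5 1 14, gA 14 16, dH 1 17 15, S 15 18, fA 17 19, rho 19 7 13, mA 8 7 10, mA 10 16 2, mH 9 13 11, mH 11 18 3]"
    by (rule eqv_rewrite[OF eqv_sym[OF assocH], where ns = "[9, 13, 18, 11, 3]"]) (simp_all add: diagram_simps)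
  also have "?E \<dots>
    [dH 0 4 5, gA 4 6, dH 5 1 14, gA 14 16, dH 1 17 15, S 15 18, fA 17 19, mA 6 19 12, rho 12 10 11, mA 10 16 2, mH 11 18 3]"
    by (rule eqv_rewrite[OF eqv_sym[OF rho_mult], where ns = "[6, 19, 12, 10, 11, 8, 9, 7, 13]"]) (simp_all add: diagram_simps)
  also have "?E \<dots>
    [dH 0 4 5, gA 4 6, dH 5 17 1, dH 1 15 14, gA 14 16, S 15 18, fA 17 19, mA 6 19 12, rho 12 10 11, mA 10 16 2, mH 11 18 3]"
    by (rule eqv_rewrite[OF coassocH, where ns = "[5, 1, 17, 15, 14]"]) (simp_all add: diagram_simps)
  also have "?E \<dots>
    [dH 0 5 1, dH 5 4 17, gA 4 6, dH 1 15 14, gA 14 16, S 15 18, fA 17 19, mA 6 19 12, rho 12 10 11, mA 10 16 2, mH 11 18 3]"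
    by (rule eqv_rewrite[OF eqv_sym[OF coassocH], where ns = "[0, 5, 4, 17, 1]"]) (simp_all add: diagram_simps)
  also have "?E \<dots>
    [dH 0 5 1, dH 1 15 14, gA 14 16, S 15 18, EA 5 12, rho 12 10 11, mA 10 16 2, mH 11 18 3]"
    by (rule eqv_rewrite[OF g_f, where ns = "[5, 4, 17, 6, 19, 12]"]) (simp_all add: diagram_simps)
  also have "?E \<dots>
    [dH 0 5 1, dH 1 15 14, gA 14 16, S 15 18, uA 4, rho 4 10 6, PR 5 7, mH 6 7 11, mA 10 16 2, mH 11 18 3]"
    by (rule eqv_rewrite[OF rho_E, where ns = "[5, 12, 10, 11, 4, 0, 1, 2, 6, 7]"]) (simp_all add: diagram_simps)
  also have "?E \<dots>
    [dH 0 5 1, dH 1 15 14, gA 14 16, S 15 18, uA 4, rho 4 10 6, PR 5 7, mA 10 16 2, mH 7 18 11, mH 6 11 3]"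
    by (rule eqv_rewrite[OF assocH, where ns = "[6, 7, 18, 11, 3]"]) (simp_all add: diagram_simps)
  also have "?E \<dots>
    [uA 4, rho 4 10 6, dH 0 1 14, dH 1 5 15, gA 14 16, S 15 18, PR 5 7, mA 10 16 2, mH 7 18 11, mH 6 11 3]"
    by (rule eqv_rewrite[OF eqv_sym[OF coassocH], where ns = "[0, 1, 5, 15, 14]"]) (simp_all add: diagram_simps)
  also have "?E \<dots>
    [uA 4, rho 4 10 6, dH 0 1 14, gA 14 16, mA 10 16 2, S 1 11, mH 6 11 3]"
    by (rule eqv_rewrite[OF PR_S, where ns = "[1, 5, 15, 7, 18, 11]"]) (simp_all add: diagram_simps)
  \<comment> \<open>\<open>u\<^sub>1\<close> is in the image of \<open>\<Pi>\<^sup>L\<close>, so it can be moved past \<open>\<lambda>\<close>\<close>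
  also have "?E \<dots>
    [dH 0 1 14, gA 14 16, S 1 11, uA 4, rho 4 10 5, PL 5 6, mA 10 16 2, mH 6 11 3]"
    by (rule eqv_rewrite[OF eqv_sym[OF rho_unit], where ns = "[4, 10, 5, 6]"]) (simp_all add: diagram_simps)
  also have "?E \<dots>
    [dH 0 1 14, gA 14 16, uA 4, rho 4 10 5, mA 10 16 2, dH 1 7 6, mH 6 5 8, eH 8, S 7 3]"
    by (rule eqv_rewrite[OF PL_mult_S, where ns = "[5, 1, 6, 11, 3, 7, 0, 2, 4, 9, 10, 12, 8]"]) (simp_all add: diagram_simps)
  also have "?E \<dots>
    [dH 0 1 14, gA 14 16, dH 1 7 6, S 7 3, EA 6 10, mA 10 16 2]"
    by (rule eqv_rewrite[OF eqv_sym[OF E_unfold], where ns = "[6, 10, 4, 5, 8]"]) (simp_all add: diagram_simps)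
  also have "?E \<dots>
    [dH 0 7 1, dH 1 6 14, gA 14 16, S 7 3, EA 6 10, mA 10 16 2]"
    by (rule eqv_rewrite[OF coassocH, where ns = "[0, 1, 7, 6, 14]"]) (simp_all add: diagram_simps)
  also have "?E \<dots>
    [dH 0 7 1, S 7 3, gA 1 2]"
    by (rule eqv_rewrite[OF E_g, where ns = "[1, 6, 14, 10, 16, 2]"]) (simp_all add: diagram_simps)
  finally show ?thesis .
qed

text \<open>In \<open>\<rho>(g(1)) = g(1\<^sub>2) \<otimes> \<lambda>(1\<^sub>1)\<close> the factor \<open>\<lambda>(1\<^sub>1)\<close> is fixed by \<open>\<Pi>\<^sup>L\<close>, so \<open>g(1)\<close> is coinvariant.\<close>

lemma rho_g_unit:
  "eqv [] [a 2, h 3]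
    [uH 0, gA 0 1, rho 1 2 3]
    [uH 4, gA 4 1, uA 5, rho 5 6 3, mA 6 1 2]"
proof -
  let ?E = "eqv [] [a 2, h 3]"
  have "?E
    [uH 0, gA 0 1, rho 1 2 3]
    [uH 0, dH 0 4 1, S 4 3, gA 1 2]"
    by (rule eqv_rewrite[OF rho_g, where ns = "[0, 1, 2, 3, 5, 6, 7, 4]"]) (simp_all add: diagram_simps)
  also have "?E \<dots>
    [uH 5, dH 5 6 1, PL 6 3, gA 1 2]"
    by (rule eqv_rewrite[OF unit_S, where ns = "[0, 4, 1, 3, 5, 2, 6]"]) (simp_all add: diagram_simps)
  also have "?E \<dots>
    [uH 5, dH 5 6 1, gA 1 2, PL 6 0, PL 0 3]"
    by (rule eqv_rewrite[OF eqv_sym[OF PL_PL], where ns = "[6, 0, 3]"]) (simp_all add: diagram_simps)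
  also have "?E \<dots>
    [uH 4, dH 4 7 1, S 7 0, gA 1 2, PL 0 3]"
    by (rule eqv_rewrite[OF eqv_sym[OF unit_S], where ns = "[4, 7, 1, 0, 5, 2, 6]"]) (simp_all add: diagram_simps)
  also have "?E \<dots>
    [uH 4, gA 4 1, rho 1 2 0, PL 0 3]"
    by (rule eqv_rewrite[OF eqv_sym[OF rho_g], where ns = "[4, 1, 2, 0, 3, 5, 6, 7]"]) (simp_all add: diagram_simps)
  also have "?E \<dots>
    [uH 4, gA 4 1, uA 5, rho 5 6 3, mA 6 1 2]"
    by (rule eqv_rewrite[OF eqv_sym[OF rho_PL], where ns = "[1, 2, 5, 3, 6, 4, 7, 8, 0]"]) (simp_all add: diagram_simps)
  finally show ?thesis .
qed

text \<open>\<open>\<rho>(f(x) g(1)) = \<rho>(f(x)) \<rho>(1) (g(1) \<otimes> 1)\<close>, and the middle factor is absorbed.\<close>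

lemma t_coact:
  "eqv [h 0] [a 3, h 4]
    [fA 0 1, uH 7, gA 7 8, mA 1 8 2, rho 2 3 4]
    [dH 0 5 4, fA 5 6, uH 2, gA 2 8, mA 6 8 3]"
proof -
  let ?E = "eqv [h 0] [a 3, h 4]"
  have "?E
    [fA 0 1, uH 7, gA 7 8, mA 1 8 2, rho 2 3 4]
    [fA 0 1, uH 7, gA 7 8, rho 1 5 9, rho 8 6 10, mA 5 6 3, mH 9 10 4]"
    by (rule eqv_rewrite[OF rho_mult, where ns = "[1, 8, 2, 3, 4, 5, 9, 6, 10]"]) (simp_all add: diagram_simps)
  also have "?E \<dots>
    [fA 0 1, rho 1 5 9, uH 2, gA 2 8, uA 11, rho 11 12 10, mA 12 8 6, mA 5 6 3, mH 9 10 4]"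
    by (rule eqv_rewrite[OF rho_g_unit, where ns = "[7, 8, 6, 10, 2, 11, 12]"]) (simp_all add: diagram_simps)
  also have "?E \<dots>
    [fA 0 1, rho 1 5 9, uH 2, gA 2 8, uA 11, rho 11 12 10, mH 9 10 4, mA 5 12 6, mA 6 8 3]"
    by (rule eqv_rewrite[OF eqv_sym[OF assocA], where ns = "[5, 12, 8, 6, 3]"]) (simp_all add: diagram_simps)
  also have "?E \<dots>
    [fA 0 1, uH 2, gA 2 8, rho 1 6 4, mA 6 8 3]"
    by (rule eqv_rewrite[OF rho_unit_right, where ns = "[1, 5, 9, 11, 12, 10, 6, 4]"]) (simp_all add: diagram_simps)
  also have "?E \<dots>
    [dH 0 5 4, fA 5 6, uH 2, gA 2 8, mA 6 8 3]"
    by (rule eqv_rewrite[OF f_coact, where ns = "[0, 1, 6, 4, 5]"]) (simp_all add: diagram_simps)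
  finally show ?thesis .
qed

text \<open>On the left leg of \<open>\<delta>(1)\<close> the maps \<open>E\<close> and \<open>K\<close> agree: it commutes with \<open>u\<^sub>1\<close>, which is in the
image of \<open>\<Pi>\<^sup>L\<close>.\<close>

lemma unit_E:
  "eqv [] [h 1, a 2]
    [uH 0, dH 0 3 1, EA 3 2]
    [uH 0, dH 0 3 1, KA 3 2]"
proof -
  let ?E = "eqv [] [h 1, a 2]"
  have "?E
    [uH 0, dH 0 3 1, EA 3 2]
    [uH 0, dH 0 3 1, uA 4, rho 4 2 5, mH 3 5 6, eH 6]"
    by (rule eqv_rewrite[OF E_unfold, where ns = "[3, 2, 4, 5, 6]"]) (simp_all add: diagram_simps)
  also have "?E \<dots>
    [uH 0, dH 0 3 1, uA 4, rho 4 2 7, PL 7 5, mH 3 5 6, eH 6]"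
    by (rule eqv_rewrite[OF eqv_sym[OF rho_unit], where ns = "[4, 2, 7, 5]"]) (simp_all add: diagram_simps)
  also have "?E \<dots>
    [uA 4, rho 4 2 7, uH 0, dH 0 3 1, PL 7 5, mH 5 3 6, eH 6]"
    by (rule eqv_rewrite[OF counit_PL_unit, where ns = "[7, 1, 5, 0, 3, 6]"]) (simp_all add: diagram_simps)
  also have "?E \<dots>
    [uH 0, dH 0 3 1, uA 4, rho 4 2 5, mH 5 3 6, eH 6]"
    by (rule eqv_rewrite[OF rho_unit, where ns = "[4, 2, 7, 5]"]) (simp_all add: diagram_simps)
  also have "?E \<dots>
    [uH 0, dH 0 3 1, KA 3 2]"
    by (rule eqv_rewrite[OF eqv_sym[OF K_unfold], where ns = "[3, 2, 4, 5, 6]"]) (simp_all add: diagram_simps)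
  finally show ?thesis .
qed

text \<open>\<open>f(1) g(1) = f(1) E(1\<^sub>1) g(1\<^sub>2) = f(1) K(1\<^sub>1) g(1\<^sub>2) = f(1'\<^sub>1) \<epsilon>(1'\<^sub>2 1\<^sub>1) g(1\<^sub>2) = f(1\<^sub>1) g(1\<^sub>2) = K(1) = 1\<close>.\<close>

lemma t_unit:
  "eqv [] [a 4]
    [uH 0, fA 0 1, uH 2, gA 2 3, mA 1 3 4]
    [uA 4]"
proof -
  let ?E = "eqv [] [a 4]"
  have "?E
    [uH 0, fA 0 1, uH 2, gA 2 3, mA 1 3 4]
    [uH 0, fA 0 1, uH 2, dH 2 5 6, EA 5 7, gA 6 8, mA 7 8 3, mA 1 3 4]"
    by (rule eqv_rewrite[OF eqv_sym[OF E_g], where ns = "[2, 5, 6, 7, 8, 3]"]) (simp_all add: diagram_simps)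
  also have "?E \<dots>
    [uH 0, fA 0 1, uH 2, dH 2 5 6, KA 5 7, gA 6 8, mA 7 8 3, mA 1 3 4]"
    by (rule eqv_rewrite[OF unit_E, where ns = "[2, 6, 7, 5]"]) (simp_all add: diagram_simps)
  also have "?E \<dots>
    [uH 0, fA 0 1, uH 2, dH 2 5 6, KA 5 7, gA 6 8, mA 1 7 3, mA 3 8 4]"
    by (rule eqv_rewrite[OF eqv_sym[OF assocA], where ns = "[1, 7, 8, 3, 4]"]) (simp_all add: diagram_simps)
  also have "?E \<dots>
    [uH 0, fA 0 1, uH 2, dH 2 5 6, gA 6 8, rho 1 3 10, mH 10 5 9, eH 9, mA 3 8 4]"
    by (rule eqv_rewrite[OF mult_K, where ns = "[1, 5, 7, 3, 0, 9, 2, 4, 6, 10]"]) (simp_all add: diagram_simps)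
  also have "?E \<dots>
    [uH 0, uH 2, dH 2 5 6, gA 6 8, dH 0 7 10, fA 7 3, mH 10 5 9, eH 9, mA 3 8 4]"
    by (rule eqv_rewrite[OF f_coact, where ns = "[0, 1, 3, 10, 7]"]) (simp_all add: diagram_simps)
  also have "?E \<dots>
    [uH 0, dH 0 7 6, gA 6 8, fA 7 3, mA 3 8 4]"
    by (rule eqv_rewrite[OF unit_counit, where ns = "[0, 7, 6, 1, 2, 10, 5, 9]"]) (simp_all add: diagram_simps)
  also have "?E \<dots>
    [uH 0, KA 0 4]"
    by (rule eqv_rewrite[OF eqv_sym[OF K_convolution], where ns = "[0, 7, 6, 3, 4, 8]"]) (simp_all add: diagram_simps)
  also have "?E \<dots>
    [uH 0, uA 1, rho 1 4 2, mH 2 0 3, eH 3]"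
    by (rule eqv_rewrite[OF K_unfold, where ns = "[0, 4, 1, 2, 3]"]) (simp_all add: diagram_simps)
  also have "?E \<dots>
    [uA 1, rho 1 4 2, eH 2]"
    by (rule eqv_rewrite[OF unitHR, where ns = "[2, 0, 3]"]) (simp_all add: diagram_simps)
  also have "?E \<dots>
    [uA 4]"
    by (rule eqv_rewrite[OF rho_counit, where ns = "[1, 4, 2]"]) (simp_all add: diagram_simps)
  finally show ?thesis .
qed

text \<open>\<open>\<rho>(f(1)) = f(1\<^sub>1) \<otimes> 1\<^sub>2\<close>, and the right leg is fixed by \<open>\<Pi>\<^sup>L\<close>.\<close>

lemma f_unit_coinvariant:
  "eqv [] [a 2, h 3]
    [uH 0, fA 0 1, rho 1 2 3]
    [uH 0, fA 0 5, uA 4, rho 4 6 3, mA 6 5 2]"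
proof -
  let ?E = "eqv [] [a 2, h 3]"
  have "?E
    [uH 0, fA 0 1, rho 1 2 3]
    [uH 0, dH 0 4 3, fA 4 2]"
    by (rule eqv_rewrite[OF f_coact, where ns = "[0, 1, 2, 3, 4]"]) (simp_all add: diagram_simps)
  also have "?E \<dots>
    [uH 0, dH 0 4 1, PL 1 3, fA 4 2]"
    by (rule eqv_rewrite[OF eqv_sym[OF unit_PL], where ns = "[0, 4, 1, 3]"]) (simp_all add: diagram_simps)
  also have "?E \<dots>
    [uH 0, fA 0 5, rho 5 2 1, PL 1 3]"
    by (rule eqv_rewrite[OF eqv_sym[OF f_coact], where ns = "[0, 5, 2, 1, 4]"]) (simp_all add: diagram_simps)
  also have "?E \<dots>
    [uH 0, fA 0 5, uA 4, rho 4 6 3, mA 6 5 2]"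
    by (rule eqv_rewrite[OF eqv_sym[OF rho_PL], where ns = "[5, 2, 4, 3, 6, 0, 7, 8, 1]"]) (simp_all add: diagram_simps)
  finally show ?thesis .
qed

text \<open>Both \<open>f(1) u\<^sub>0 \<otimes> u\<^sub>1\<close> and \<open>u\<^sub>0 f(1) \<otimes> u\<^sub>1\<close> are equal to \<open>\<rho>(f(1)) = f(1\<^sub>1) \<otimes> 1\<^sub>2\<close>: the first by
\<open>mult_rho_unit\<close>, the second because \<open>f(1)\<close> is coinvariant.\<close>

lemma f_unit_commute:
  "eqv [] [a 5, h 4]
    [uH 0, fA 0 1, uA 2, rho 2 3 4, mA 1 3 5]
    [uH 0, fA 0 3, uA 2, rho 2 6 4, mA 6 3 5]"
proof -
  let ?E = "eqv [] [a 5, h 4]"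
  have "?E
    [uH 0, fA 0 1, uA 2, rho 2 3 4, mA 1 3 5]
    [uH 0, fA 0 1, uH 6, dH 6 9 4, rho 1 5 8, mH 8 9 7, eH 7]"
    by (rule eqv_rewrite[OF mult_rho_unit, where ns = "[1, 2, 3, 4, 5, 6, 7, 0, 10, 11, 8, 12, 9]"]) (simp_all add: diagram_simps)
  also have "?E \<dots>
    [uH 0, uH 6, dH 6 9 4, dH 0 2 8, fA 2 5, mH 8 9 7, eH 7]"
    by (rule eqv_rewrite[OF f_coact, where ns = "[0, 1, 5, 8, 2]"]) (simp_all add: diagram_simps)
  also have "?E \<dots>
    [uH 0, dH 0 2 4, fA 2 5]"
    by (rule eqv_rewrite[OF unit_counit, where ns = "[0, 2, 4, 1, 6, 8, 9, 7]"]) (simp_all add: diagram_simps)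
  also have "?E \<dots>
    [uH 0, fA 0 1, rho 1 5 4]"
    by (rule eqv_rewrite[OF eqv_sym[OF f_coact], where ns = "[0, 1, 5, 4, 2]"]) (simp_all add: diagram_simps)
  also have "?E \<dots>
    [uH 0, fA 0 3, uA 2, rho 2 6 4, mA 6 3 5]"
    by (rule eqv_rewrite[OF f_unit_coinvariant, where ns = "[0, 1, 5, 4, 2, 3, 6]"]) (simp_all add: diagram_simps)
  finally show ?thesis .
qed

lemma f_unit_E:
  "eqv [h 0] [a 4]
    [uH 1, fA 1 2, EA 0 3, mA 2 3 4]
    [uH 1, fA 1 3, EA 0 8, mA 8 3 4]"
proof -
  let ?E = "eqv [h 0] [a 4]"
  have "?E
    [uH 1, fA 1 2, EA 0 3, mA 2 3 4]
    [uH 1, fA 1 2, uA 5, rho 5 3 6, mH 0 6 7, eH 7, mA 2 3 4]"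
    by (rule eqv_rewrite[OF E_unfold, where ns = "[0, 3, 5, 6, 7]"]) (simp_all add: diagram_simps)
  also have "?E \<dots>
    [uH 1, fA 1 3, uA 5, rho 5 8 6, mA 8 3 4, mH 0 6 7, eH 7]"
    by (rule eqv_rewrite[OF f_unit_commute, where ns = "[1, 2, 5, 3, 6, 4, 8]"]) (simp_all add: diagram_simps)
  also have "?E \<dots>
    [uH 1, fA 1 3, EA 0 8, mA 8 3 4]"
    by (rule eqv_rewrite[OF eqv_sym[OF E_unfold], where ns = "[0, 8, 5, 6, 7]"]) (simp_all add: diagram_simps)
  finally show ?thesis .
qed

end

section \<open>Cocommutative weak Hopf algebras\<close>

locale cocommutative_cleft_diagrams = cleft_diagrams +
  assumes cocommutative: "is_cocommutative C (obj H) \<delta>\<^bsub>H\<^esub>"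
begin

lemma cocomm: "eqv [h 0] [h 1, h 2] [dH 0 1 2] [dH 0 2 1]"
  by (rule eqv_of_eq[OF cocommutative[unfolded is_cocommutative_def, symmetric]]; (rule compiles_intros | simp add: diagram_simps; fail)+)

text \<open>By cocommutativity \<open>g(1) = g(1\<^sub>1) K(1\<^sub>2) = g(1\<^sub>2) K(1\<^sub>1) = g(1\<^sub>2) u\<^sub>0 \<epsilon>(u\<^sub>1 1\<^sub>1) = g(u\<^sub>1) u\<^sub>0\<close>. As
\<open>u\<^sub>0 f(1) \<otimes> u\<^sub>1 = f(1\<^sub>1) \<otimes> 1\<^sub>2\<close>, this gives \<open>g(1) f(1) = g(1\<^sub>2) f(1\<^sub>1)\<close>, which is \<open>g(1\<^sub>1) f(1\<^sub>2) = E(1) = 1\<close>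
by cocommutativity again.\<close>

lemma g_f_unit:
  "eqv [] [a 4]
    [uH 0, gA 0 1, uH 2, fA 2 3, mA 1 3 4]
    [uA 4]"
proof -
  let ?E = "eqv [] [a 4]"
  have "?E
    [uH 0, gA 0 1, uH 2, fA 2 3, mA 1 3 4]
    [uH 0, uH 2, fA 2 3, dH 0 5 6, gA 5 7, KA 6 8, mA 7 8 1, mA 1 3 4]"
    by (rule eqv_rewrite[OF eqv_sym[OF g_K], where ns = "[0, 5, 6, 7, 8, 1]"]) (simp_all add: diagram_simps)
  also have "?E \<dots>
    [uH 0, uH 2, fA 2 3, dH 0 6 5, gA 5 7, KA 6 8, mA 7 8 1, mA 1 3 4]"
    by (rule eqv_rewrite[OF cocomm, where ns = "[0, 5, 6]"]) (simp_all add: diagram_simps)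
  also have "?E \<dots>
    [uH 0, uH 2, fA 2 3, dH 0 6 5, gA 5 7, uA 9, rho 9 8 10, mH 10 6 11, eH 11, mA 7 8 1, mA 1 3 4]"
    by (rule eqv_rewrite[OF K_unfold, where ns = "[6, 8, 9, 10, 11]"]) (simp_all add: diagram_simps)
  \<comment> \<open>the projection on \<open>u\<^sub>1\<close> is made visible, so that \<open>\<epsilon>(u\<^sub>1 1\<^sub>1) 1\<^sub>2 = \<Pi>\<^sup>L(u\<^sub>1)\<close> can be read off\<close>
  also have "?E \<dots>
    [uH 0, uH 2, fA 2 3, dH 0 6 5, gA 5 7, uA 9, rho 9 8 12, PL 12 10, mH 10 6 11, eH 11, mA 7 8 1, mA 1 3 4]"
    by (rule eqv_rewrite[OF eqv_sym[OF rho_unit], where ns = "[9, 8, 12, 10]"]) (simp_all add: diagram_simps)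
  also have "?E \<dots>
    [uH 2, fA 2 3, uA 9, rho 9 8 12, PL 12 10, uH 0, dH 0 6 5, mH 6 10 11, eH 11, gA 5 7, mA 7 8 1, mA 1 3 4]"
    by (rule eqv_rewrite[OF eqv_sym[OF counit_PL_unit], where ns = "[12, 5, 10, 0, 6, 11]"]) (simp_all add: diagram_simps)
  also have "?E \<dots>
    [uH 2, fA 2 3, uA 9, rho 9 8 12, PL 12 10, PL 10 5, gA 5 7, mA 7 8 1, mA 1 3 4]"
    by (rule eqv_rewrite[OF eqv_sym[OF PL_unfold], where ns = "[10, 5, 0, 6, 11]"]) (simp_all add: diagram_simps)
  also have "?E \<dots>
    [uH 2, fA 2 3, uA 9, rho 9 8 10, PL 10 5, gA 5 7, mA 7 8 1, mA 1 3 4]"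
    by (rule eqv_rewrite[OF rho_unit, where ns = "[9, 8, 12, 10]"]) (simp_all add: diagram_simps)
  also have "?E \<dots>
    [uH 2, fA 2 3, uA 9, rho 9 8 5, gA 5 7, mA 7 8 1, mA 1 3 4]"
    by (rule eqv_rewrite[OF rho_unit, where ns = "[9, 8, 10, 5]"]) (simp_all add: diagram_simps)
  \<comment> \<open>now \<open>g(u\<^sub>1) u\<^sub>0 f(1)\<close> has been reached\<close>
  also have "?E \<dots>
    [uH 2, fA 2 3, uA 9, rho 9 8 5, gA 5 7, mA 8 3 1, mA 7 1 4]"
    by (rule eqv_rewrite[OF assocA, where ns = "[7, 8, 3, 1, 4]"]) (simp_all add: diagram_simps)
  also have "?E \<dots>
    [uH 2, fA 2 0, rho 0 1 5, gA 5 7, mA 7 1 4]"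
    by (rule eqv_rewrite[OF eqv_sym[OF f_unit_coinvariant], where ns = "[2, 0, 1, 5, 9, 3, 8]"]) (simp_all add: diagram_simps)
  also have "?E \<dots>
    [uH 2, dH 2 3 5, fA 3 1, gA 5 7, mA 7 1 4]"
    by (rule eqv_rewrite[OF f_coact, where ns = "[2, 0, 1, 5, 3]"]) (simp_all add: diagram_simps)
  also have "?E \<dots>
    [uH 2, dH 2 5 3, fA 3 1, gA 5 7, mA 7 1 4]"
    by (rule eqv_rewrite[OF cocomm, where ns = "[2, 3, 5]"]) (simp_all add: diagram_simps)
  also have "?E \<dots>
    [uH 2, EA 2 4]"
    by (rule eqv_rewrite[OF g_f, where ns = "[2, 5, 3, 7, 1, 4]"]) (simp_all add: diagram_simps)
  also have "?E \<dots>
    [uH 2, uA 0, rho 0 4 1, mH 2 1 3, eH 3]"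
    by (rule eqv_rewrite[OF E_unfold, where ns = "[2, 4, 0, 1, 3]"]) (simp_all add: diagram_simps)
  also have "?E \<dots>
    [uA 0, rho 0 4 1, eH 1]"
    by (rule eqv_rewrite[OF unitHL, where ns = "[1, 2, 3]"]) (simp_all add: diagram_simps)
  also have "?E \<dots>
    [uA 4]"
    by (rule eqv_rewrite[OF rho_counit, where ns = "[0, 4, 1]"]) (simp_all add: diagram_simps)
  finally show ?thesis .
qed

text \<open>\<open>f(1) g(x\<^sub>1) f(x\<^sub>2) g(1) = f(1) E(x) g(1) = E(x) f(1) g(1) = E(x)\<close>.\<close>

lemma k_conv_t:
  "eqv [h 0] [a 20]
    [dH 0 1 2, uH 3, fA 3 4, gA 1 5, mA 4 5 6, fA 2 7, uH 8, gA 8 9, mA 7 9 10, mA 6 10 20]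
    [EA 0 20]"
proof -
  let ?E = "eqv [h 0] [a 20]"
  have "?E
    [dH 0 1 2, uH 3, fA 3 4, gA 1 5, mA 4 5 6, fA 2 7, uH 8, gA 8 9, mA 7 9 10, mA 6 10 20]
    [dH 0 1 2, uH 3, fA 3 4, gA 1 5, fA 2 7, uH 8, gA 8 9, mA 7 9 10, mA 5 10 6, mA 4 6 20]"
    by (rule eqv_rewrite[OF assocA, where ns = "[4, 5, 10, 6, 20]"]) (simp_all add: diagram_simps)
  also have "?E \<dots>
    [dH 0 1 2, uH 3, fA 3 4, gA 1 5, fA 2 7, uH 8, gA 8 9, mA 5 7 10, mA 10 9 6, mA 4 6 20]"
    by (rule eqv_rewrite[OF eqv_sym[OF assocA], where ns = "[5, 7, 9, 10, 6]"]) (simp_all add: diagram_simps)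
  also have "?E \<dots>
    [uH 3, fA 3 4, uH 8, gA 8 9, EA 0 10, mA 10 9 6, mA 4 6 20]"
    by (rule eqv_rewrite[OF g_f, where ns = "[0, 1, 2, 5, 7, 10]"]) (simp_all add: diagram_simps)
  also have "?E \<dots>
    [uH 3, fA 3 4, uH 8, gA 8 9, EA 0 10, mA 4 10 6, mA 6 9 20]"
    by (rule eqv_rewrite[OF eqv_sym[OF assocA], where ns = "[4, 10, 9, 6, 20]"]) (simp_all add: diagram_simps)
  also have "?E \<dots>
    [uH 8, gA 8 9, uH 3, fA 3 10, EA 0 1, mA 1 10 6, mA 6 9 20]"
    by (rule eqv_rewrite[OF f_unit_E, where ns = "[0, 3, 4, 10, 6, 2, 5, 7, 1]"]) (simp_all add: diagram_simps)
  also have "?E \<dots>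
    [uH 8, gA 8 9, uH 3, fA 3 10, EA 0 1, mA 10 9 6, mA 1 6 20]"
    by (rule eqv_rewrite[OF assocA, where ns = "[1, 10, 9, 6, 20]"]) (simp_all add: diagram_simps)
  also have "?E \<dots>
    [EA 0 1, uA 6, mA 1 6 20]"
    by (rule eqv_rewrite[OF t_unit, where ns = "[3, 10, 8, 9, 6]"]) (simp_all add: diagram_simps)
  also have "?E \<dots>
    [EA 0 20]"
    by (rule eqv_rewrite[OF unitAR, where ns = "[1, 6, 20]"]) (simp_all add: diagram_simps)
  finally show ?thesis .
qed

text \<open>The factors \<open>g(1) f(1)\<close> in \<open>f(x\<^sub>1) g(1) f(1) g(x\<^sub>2)\<close> cancel.\<close>

lemma t_conv_k:
  "eqv [h 0] [a 20]
    [dH 0 1 2, fA 1 3, uH 4, gA 4 5, mA 3 5 6, uH 7, fA 7 8, gA 2 9, mA 8 9 10, mA 6 10 20]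
    [uA 1, rho 1 20 2, mH 2 0 3, eH 3]"
proof -
  let ?E = "eqv [h 0] [a 20]"
  have "?E
    [dH 0 1 2, fA 1 3, uH 4, gA 4 5, mA 3 5 6, uH 7, fA 7 8, gA 2 9, mA 8 9 10, mA 6 10 20]
    [dH 0 1 2, fA 1 3, uH 4, gA 4 5, uH 7, fA 7 8, gA 2 9, mA 8 9 10, mA 5 10 6, mA 3 6 20]"
    by (rule eqv_rewrite[OF assocA, where ns = "[3, 5, 10, 6, 20]"]) (simp_all add: diagram_simps)
  also have "?E \<dots>
    [dH 0 1 2, fA 1 3, uH 4, gA 4 5, uH 7, fA 7 8, gA 2 9, mA 5 8 10, mA 10 9 6, mA 3 6 20]"
    by (rule eqv_rewrite[OF eqv_sym[OF assocA], where ns = "[5, 8, 9, 10, 6]"]) (simp_all add: diagram_simps)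
  also have "?E \<dots>
    [dH 0 1 2, fA 1 3, gA 2 9, uA 10, mA 10 9 6, mA 3 6 20]"
    by (rule eqv_rewrite[OF g_f_unit, where ns = "[4, 5, 7, 8, 10]"]) (simp_all add: diagram_simps)
  also have "?E \<dots>
    [dH 0 1 2, fA 1 3, gA 2 9, mA 3 9 20]"
    by (rule eqv_rewrite[OF unitAL, where ns = "[9, 10, 6]"]) (simp_all add: diagram_simps)
  also have "?E \<dots>
    [KA 0 20]"
    by (rule eqv_rewrite[OF eqv_sym[OF K_convolution], where ns = "[0, 1, 2, 3, 20, 9]"]) (simp_all add: diagram_simps)
  also have "?E \<dots>
    [uA 1, rho 1 20 2, mH 2 0 3, eH 3]"
    by (rule eqv_rewrite[OF K_unfold, where ns = "[0, 20, 1, 2, 3]"]) (simp_all add: diagram_simps)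
  finally show ?thesis .
qed

text \<open>\<open>E(x\<^sub>1) f(1) g(x\<^sub>2) = f(1) E(x\<^sub>1) g(x\<^sub>2) = f(1) g(x)\<close>.\<close>

lemma E_conv_k:
  "eqv [h 0] [a 20]
    [dH 0 1 2, EA 1 3, uH 4, fA 4 5, gA 2 6, mA 5 6 7, mA 3 7 20]
    [uH 4, fA 4 8, gA 0 7, mA 8 7 20]"
proof -
  let ?E = "eqv [h 0] [a 20]"
  have "?E
    [dH 0 1 2, EA 1 3, uH 4, fA 4 5, gA 2 6, mA 5 6 7, mA 3 7 20]
    [dH 0 1 2, EA 1 3, uH 4, fA 4 5, gA 2 6, mA 3 5 7, mA 7 6 20]"
    by (rule eqv_rewrite[OF eqv_sym[OF assocA], where ns = "[3, 5, 6, 7, 20]"]) (simp_all add: diagram_simps)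
  also have "?E \<dots>
    [dH 0 1 2, gA 2 6, uH 4, fA 4 8, EA 1 5, mA 8 5 7, mA 7 6 20]"
    by (rule eqv_rewrite[OF eqv_sym[OF f_unit_E], where ns = "[1, 4, 8, 5, 7, 0, 2, 6, 3]"]) (simp_all add: diagram_simps)
  also have "?E \<dots>
    [dH 0 1 2, gA 2 6, uH 4, fA 4 8, EA 1 5, mA 5 6 7, mA 8 7 20]"
    by (rule eqv_rewrite[OF assocA, where ns = "[8, 5, 6, 7, 20]"]) (simp_all add: diagram_simps)
  also have "?E \<dots>
    [uH 4, fA 4 8, gA 0 7, mA 8 7 20]"
    by (rule eqv_rewrite[OF E_g, where ns = "[0, 1, 2, 5, 6, 7]"]) (simp_all add: diagram_simps)
  finally show ?thesis .
qed

end

section \<open>The total integral of a cleft extension\<close>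

theorem proposition2p14:
  fixes C :: "('o, 'm, 'x) smc_scheme" (structure)
    and H :: "('o, 'm, 'y) weak_hopf_scheme"
    and A :: "('o, 'm, 'z) comodule_algebra_scheme"
    and AH :: 'o and i f finv :: 'm
  assumes "strict_symmetric_monoidal_category_with_equalizers C"
    and "weak_hopf_algebra C H"
    and "is_iso C (antipode H)"
    and "right_comodule_algebra C H A"
    and "is_cleft_extension C H A AH i f"
    and "is_convolution_inverse C H A f finv"
  shows "is_total_integral C H A (\<mu>\<^bsub>A\<^esub> \<cdot> (f \<otimes> (finv \<cdot> \<eta>\<^bsub>H\<^esub>))) \<and>
    (is_cocommutative C (obj H) \<delta>\<^bsub>H\<^esub> \<longrightarrow>
      is_convolution_invertible C H A (\<mu>\<^bsub>A\<^esub> \<cdot> (f \<otimes> (finv \<cdot> \<eta>\<^bsub>H\<^esub>))))"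
proof -
  interpret strict_symmetric_monoidal_category_with_equalizers C by fact
  interpret weak_hopf_algebra C H by fact
  interpret comodule_algebra_diagrams C H A
    by (intro comodule_algebra_diagrams.intro weak_hopf_diagrams.intro assms(2,4)) unfold_locales
  let ?K = "convolution C \<delta>\<^bsub>H\<^esub> A f finv"
  obtain g u where coinv: "is_equalizer C AH i \<rho>\<^bsub>A\<^esub> ((\<I> (obj A) \<otimes> Pi_L C H) \<cdot> \<rho>\<^bsub>A\<^esub>)"
    and int: "is_integral C H A f" and g: "is_convolution_inverse C H A f g"
    and u: "u \<in> hom C (obj H) AH" "i \<cdot> u = convolution C \<delta>\<^bsub>H\<^esub> A f g"
    using assms(5) by (auto simp: is_cleft_extension_def is_coinvariants_def)
  \<comment> \<open>\<open>f \<and> g\<close> is prescribed by the coaction on the unit, hence the same for every inverse of \<open>f\<close>\<close>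
  have "i \<cdot> u = ?K"
    using u(2) g assms(6) by (simp add: is_convolution_inverse_def)
  have PL [simp]: "Pi_L C H \<in> Arr C" "src C (Pi_L C H) = obj H" "tgt C (Pi_L C H) = obj H"
    using Pi_homs by (simp_all add: hom_def)
  have i [simp]: "i \<in> Arr C" "src C i = AH" "tgt C i = obj A" "u \<in> Arr C" "src C u = obj H" "tgt C u = AH"
    using coinv u(1) by (simp_all add: is_equalizer_def hom_def)
  have eq: "\<rho>\<^bsub>A\<^esub> \<cdot> i = ((\<I> (obj A) \<otimes> Pi_L C H) \<cdot> \<rho>\<^bsub>A\<^esub>) \<cdot> i"
    using coinv by (simp add: is_equalizer_def)
  have "(\<I> (obj A) \<otimes> Pi_L C H) \<cdot> \<rho>\<^bsub>A\<^esub> \<cdot> i \<cdot> u = (((\<I> (obj A) \<otimes> Pi_L C H) \<cdot> \<rho>\<^bsub>A\<^esub>) \<cdot> i) \<cdot> u"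
    by simp
  also have "\<dots> = \<rho>\<^bsub>A\<^esub> \<cdot> i \<cdot> u" unfolding eq[symmetric] by simp
  finally have K: "(\<I> (obj A) \<otimes> Pi_L C H) \<cdot> \<rho>\<^bsub>A\<^esub> \<cdot> ?K = \<rho>\<^bsub>A\<^esub> \<cdot> ?K"
    unfolding \<open>i \<cdot> u = ?K\<close> .
  interpret cleft_diagrams C H A f finv
    by unfold_locales (fact int assms(6) K)+
  let ?h = "\<mu>\<^bsub>A\<^esub> \<cdot> (f \<otimes> (finv \<cdot> \<eta>\<^bsub>H\<^esub>))" and ?k = "\<mu>\<^bsub>A\<^esub> \<cdot> ((f \<cdot> \<eta>\<^bsub>H\<^esub>) \<otimes> finv)"
  have "\<rho>\<^bsub>A\<^esub> \<cdot> ?h = (?h \<otimes> \<I> (obj H)) \<cdot> \<delta>\<^bsub>H\<^esub>"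
    by (rule eq_of_eqv[OF t_coact]; (rule compiles_intros | simp add: diagram_simps; fail)+)
  moreover have "?h \<cdot> \<eta>\<^bsub>H\<^esub> = \<eta>\<^bsub>A\<^esub>"
    by (rule eq_of_eqv[OF t_unit]; (rule compiles_intros | simp add: diagram_simps; fail)+)
  ultimately have total: "is_total_integral C H A ?h"
    by (simp add: is_total_integral_def is_integral_def hom_def)
  have "is_convolution_inverse C H A ?h ?k" if "is_cocommutative C (obj H) \<delta>\<^bsub>H\<^esub>"
  proof -
    interpret cocommutative_cleft_diagrams C H A f finv by unfold_locales (fact that)
    have "\<mu>\<^bsub>A\<^esub> \<cdot> (?k \<otimes> ?h) \<cdot> \<delta>\<^bsub>H\<^esub> = e_map C H A"
      by (rule eq_of_eqv[OF k_conv_t]; (rule compiles_intros | simp add: diagram_simps; fail)+)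
    moreover have "\<mu>\<^bsub>A\<^esub> \<cdot> (?h \<otimes> ?k) \<cdot> \<delta>\<^bsub>H\<^esub> =
        (\<I> (obj A) \<otimes> (\<epsilon>\<^bsub>H\<^esub> \<cdot> \<mu>\<^bsub>H\<^esub>)) \<cdot> ((\<rho>\<^bsub>A\<^esub> \<cdot> \<eta>\<^bsub>A\<^esub>) \<otimes> \<I> (obj H))"
      by (rule eq_of_eqv[OF t_conv_k]; (rule compiles_intros | simp add: diagram_simps; fail)+)
    moreover have "\<mu>\<^bsub>A\<^esub> \<cdot> (e_map C H A \<otimes> ?k) \<cdot> \<delta>\<^bsub>H\<^esub> = ?k"
      by (rule eq_of_eqv[OF E_conv_k]; (rule compiles_intros | simp add: diagram_simps; fail)+)
    ultimately show ?thesis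
      by (simp add: is_convolution_inverse_def convolution_def hom_def)
  qed
  with total show ?thesis by (auto simp: is_convolution_invertible_def)
qed

end
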